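(* Let $\beta>0$, $\mathbb{S}_\beta=\{z\in\mathbb{C}:0<\operatorname{Im}z<\beta\}$ and $\mathbb{T}_\beta=\mathbb{R}/\beta\mathbb{Z}$, with $[y]=y+\beta\mathbb{Z}$. Any reflection positive function $\varphi_{\mathbb{T}}$ on $\mathbb{T}_\beta$ extends analytically to a continuous function $\Phi$ on the closed strip $\overline{\mathbb{S}_\beta}$ that is holomorphic on the interior. We thus obtain a bijection $\varphi_{\mathbb{T}}\mapsto\varphi_{\mathbb{R}}:=\Phi|_{\mathbb{R}}$ from continuous reflection positive functions on $\mathbb{T}_\beta$ to those positive definite functions $\varphi_{\mathbb{R}}:\mathbb{R}\to\mathbb{C}$ satisfying the $\beta$-KMS condition, i.e. $\varphi_{\mathbb{R}}$ extends to a continuous function $\overline{\mathbb{S}_\beta}\to\mathbb{C}$, holomorphic on the interior and satisfying $$\varphi_{\mathbb{R}}(i\beta+t)=\overline{\varphi_{\mathbb{R}}(t)}\quad\text{ for } t\in\mathbb{R}.$$ Any reflection positive function $\varphi_{\mathbb{T}}$ has an integral representation $$\varphi_{\mathbb{T}}([y])=\int_{[0,\infty)}\varphi_\lambda([y])\,d\mu(\lambda)\quad\text{ for } 0\le y\le\beta,$$ where $\mu$ is a finite positive Borel measure on $[0,\infty)$, and the function $\varphi_{\mathbb{R}}=\widehat\nu$ is the Fourier transform of the measure $$\nu=\Gamma(\mu):=\frac{\mu+\mu^\vee}{1+e_{-\beta}}.$$ Vice versa, if $\varphi_{\mathbb{R}}=\widehat\nu$ for a finite Borel measure $\nu$ on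 $\mathbb{R}$, then $\varphi_{\mathbb{T}}([y]):=\widehat\nu(iy)$ for $0\le y\le\beta$ defines a reflection positive function on $\mathbb{T}_\beta$.
   Context: A function $\varphi:\mathbb{T}_\beta\to\mathbb{C}$ with $\varphi([-t])=\varphi([t])$ is called reflection positive (with respect to $(\mathbb{T}_\beta,\mathbb{T}_{\beta,+},-\mathrm{id})$, where $\mathbb{T}_{\beta,+}=\{[t]:0<t<\beta/2\}$) if it is positive definite on the group $\mathbb{T}_\beta$ and the kernel $(\varphi([t+s]))_{0<t,s<\beta/2}$ is positive definite. For the analytic extension, $\varphi_{\mathbb{T}}$ is considered as a function on the vertical segment $[0,\beta]i\subseteq\mathbb{C}$, i.e. $\Phi(iy)=\varphi_{\mathbb{T}}([y])$ for $0\le y\le\beta$. For $\lambda\ge 0$ and $0\le y\le\beta$, $$\varphi_\lambda([y]):=\frac{e^{-\lambda y}+e^{-\lambda(\beta-y)}}{1+e^{-\lambda\beta}}.$$ For a measure $\nu$ on $\mathbb{R}$, $\widehat\nu(z)=\int_{\mathbb{R}}e^{iz\lambda}\,d\nu(\lambda)$. The measure $\mu$ is regarded as a measure on $\mathbb{R}$ supported on $[0,\infty)$, $d\mu^\vee(\lambda)=d\mu(-\lambda)$, and $e_{-\beta}(\lambda)=e^{-\beta\lambda}$; division by $1+e_{-\beta}$ means multiplication of the measure by the density $(1+e^{-\beta\lambda})^{-1}$.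
   Formalization: Reflection positive functions are taken to be continuous throughout (the indicator of [0] is a counterexample otherwise), and in the "vice versa" φ_R is assumed positive definite with the β-KMS condition (for ν=δ_1, ν̂(iy) differs at y=0 and y=β). *)

theory Defs
  imports "HOL-Analysis.Analysis" "HOL-Algebra.Coset"
begin

section \<open>The circle group\<close>

definition real_group :: "real monoid" where
  "real_group = \<lparr>carrier = UNIV, monoid.mult = (+), one = 0\<rparr>"

definition period_lattice :: "real \<Rightarrow> real set" where
  "period_lattice \<beta> = range (\<lambda>k::int. of_int k * \<beta>)"

definition circle :: "real \<Rightarrow> real set monoid" where
  "circle \<beta> = real_group Mod period_lattice \<beta>"

definition cls :: "real \<Rightarrow> real \<Rightarrow> real set" where
  "cls \<beta> y = period_lattice \<beta> #>\<^bsub>real_group\<^esub> y"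

text \<open>The quotient topology with respect to \<^term>\<open>cls \<beta>\<close>; see \<open>quotient_map_cls\<close> below.\<close>

definition circle_topology :: "real \<Rightarrow> real set topology" where
  "circle_topology \<beta> = topology (\<lambda>U. U \<subseteq> carrier (circle \<beta>) \<and> open (cls \<beta> -` U))"

lemma comm_group_real_group: "comm_group real_group"
proof (rule comm_groupI)
  fix x assume "x \<in> carrier real_group"
  show "\<exists>y\<in>carrier real_group. y \<otimes>\<^bsub>real_group\<^esub> x = \<one>\<^bsub>real_group\<^esub>"
    by (auto simp: real_group_def intro: exI [of _ "- x"])
qed (auto simp: real_group_def)

lemma inv_real_group: "inv\<^bsub>real_group\<^esub> x = - x"
proof -
  interpret comm_group real_group by (rule comm_group_real_group)
  show ?thesis by (rule inv_equality) (auto simp: real_group_def)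
qed

lemma normal_period_lattice: "period_lattice \<beta> \<lhd> real_group"
proof -
  interpret comm_group real_group by (rule comm_group_real_group)
  have "subgroup (period_lattice \<beta>) real_group"
  proof (rule subgroupI)
    fix a b assume "a \<in> period_lattice \<beta>" "b \<in> period_lattice \<beta>"
    then obtain k l :: int where "a = of_int k * \<beta>" "b = of_int l * \<beta>"
      by (auto simp: period_lattice_def)
    then have "a \<otimes>\<^bsub>real_group\<^esub> b = of_int (k + l) * \<beta>" "inv\<^bsub>real_group\<^esub> a = of_int (- k) * \<beta>"
      by (auto simp: inv_real_group) (auto simp: real_group_def algebra_simps)
    then show "a \<otimes>\<^bsub>real_group\<^esub> b \<in> period_lattice \<beta>" "inv\<^bsub>real_group\<^esub> a \<in> period_lattice \<beta>"
      unfolding period_lattice_def by blast+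
  qed (auto simp: real_group_def period_lattice_def)
  then show ?thesis by (rule subgroup_imp_normal)
qed

lemma cls_altdef: "cls \<beta> y = {y + of_int k * \<beta> | k::int. True}"
  by (auto simp: cls_def r_coset_def real_group_def period_lattice_def add.commute)

lemma carrier_circle: "carrier (circle \<beta>) = range (cls \<beta>)"
  by (simp add: circle_def carrier_FactGroup cls_def [abs_def] real_group_def)

lemma mult_circle_cls: "cls \<beta> s \<otimes>\<^bsub>circle \<beta>\<^esub> cls \<beta> t = cls \<beta> (s + t)"
  using normal.rcos_sum [OF normal_period_lattice, of s t \<beta>]
  by (simp add: circle_def cls_def real_group_def)

lemma inv_circle_cls: "inv\<^bsub>circle \<beta>\<^esub> cls \<beta> t = cls \<beta> (- t)"
proof -
  interpret group "circle \<beta>"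
    unfolding circle_def by (rule normal.factorgroup_is_group [OF normal_period_lattice])
  have "cls \<beta> 0 = \<one>\<^bsub>circle \<beta>\<^esub>"
    by (auto simp: circle_def cls_altdef period_lattice_def)
  then show ?thesis
    by (intro inv_equality) (auto simp: mult_circle_cls carrier_circle)
qed

lemma quotient_map_cls: "quotient_map euclideanreal (circle_topology \<beta>) (cls \<beta>)"
proof -
  have "istopology (\<lambda>U. U \<subseteq> carrier (circle \<beta>) \<and> open (cls \<beta> -` U))"
    unfolding istopology_def by (auto simp: vimage_Union)
  then have *: "openin (circle_topology \<beta>) U \<longleftrightarrow>
      U \<subseteq> carrier (circle \<beta>) \<and> open (cls \<beta> -` U)" for U
    by (simp add: circle_topology_def topology_inverse')
  have "topspace (circle_topology \<beta>) = carrier (circle \<beta>)"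
  proof -
    have "openin (circle_topology \<beta>) (carrier (circle \<beta>))"
      unfolding * by (auto simp: carrier_circle vimage_def)
    then show ?thesis
      using * openin_subset openin_topspace by (metis subset_antisym)
  qed
  then show ?thesis
    by (auto simp: quotient_map_def * carrier_circle vimage_def)
qed


section \<open>Positive definiteness and reflection positivity\<close>

definition pd_kernel :: "'a set \<Rightarrow> ('a \<Rightarrow> 'a \<Rightarrow> complex) \<Rightarrow> bool" where
  "pd_kernel X K \<longleftrightarrow>
     (\<forall>F c. finite F \<and> F \<subseteq> X \<longrightarrow>
        (\<Sum>x\<in>F. \<Sum>y\<in>F. c x * cnj (c y) * K x y) \<in> \<real>\<^sub>\<ge>\<^sub>0)"

definition pd_function :: "('a, 'b) monoid_scheme \<Rightarrow> ('a \<Rightarrow> complex) \<Rightarrow> bool" where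
  "pd_function G f \<longleftrightarrow> pd_kernel (carrier G) (\<lambda>x y. f (x \<otimes>\<^bsub>G\<^esub> inv\<^bsub>G\<^esub> y))"

definition reflection_positive :: "real \<Rightarrow> (real set \<Rightarrow> complex) \<Rightarrow> bool" where
  "reflection_positive \<beta> \<phi> \<longleftrightarrow>
     (\<forall>t. \<phi> (cls \<beta> (- t)) = \<phi> (cls \<beta> t)) \<and>
     pd_function (circle \<beta>) \<phi> \<and>
     pd_kernel {0<..<\<beta>/2} (\<lambda>t s. \<phi> (cls \<beta> (t + s)))"

text \<open>
  Functions on the circle are represented by functions on all of \<^typ>\<open>real set\<close> that are
  \<^const>\<open>undefined\<close> off the carrier, so that equality is equality on the circle. Continuity cannot be
  dropped: the indicator function of the neutral element is reflection positive, but it has no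
  analytic extension to the strip.
\<close>

definition cont_refl_pos :: "real \<Rightarrow> (real set \<Rightarrow> complex) set" where
  "cont_refl_pos \<beta> = {\<phi> \<in> extensional (carrier (circle \<beta>)).
     continuous_map (circle_topology \<beta>) euclidean \<phi> \<and> reflection_positive \<beta> \<phi>}"


section \<open>Analytic extension to the strip and the KMS condition\<close>

definition strip :: "real \<Rightarrow> complex set" where
  "strip \<beta> = {z. 0 < Im z \<and> Im z < \<beta>}"

definition strip_extension :: "real \<Rightarrow> (real set \<Rightarrow> complex) \<Rightarrow> (complex \<Rightarrow> complex) \<Rightarrow> bool" where
  "strip_extension \<beta> \<phi> \<Phi> \<longleftrightarrow>
     \<Phi> \<in> extensional (closure (strip \<beta>)) \<and>
     continuous_on (closure (strip \<beta>)) \<Phi> \<and>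
     \<Phi> holomorphic_on strip \<beta> \<and>
     (\<forall>y\<in>{0..\<beta>}. \<Phi> (\<i> * of_real y) = \<phi> (cls \<beta> y))"

text \<open>Only meaningful where the extension exists and is unique.\<close>

definition real_restriction :: "real \<Rightarrow> (real set \<Rightarrow> complex) \<Rightarrow> real \<Rightarrow> complex" where
  "real_restriction \<beta> \<phi> t = (THE \<Phi>. strip_extension \<beta> \<phi> \<Phi>) (of_real t)"

definition KMS :: "real \<Rightarrow> (real \<Rightarrow> complex) \<Rightarrow> bool" where
  "KMS \<beta> f \<longleftrightarrow>
     (\<exists>F. continuous_on (closure (strip \<beta>)) F \<and> F holomorphic_on strip \<beta> \<and>
          (\<forall>t. F (of_real t) = f t) \<and>
          (\<forall>t. F (\<i> * of_real \<beta> + of_real t) = cnj (f t)))"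

definition pd_KMS :: "real \<Rightarrow> (real \<Rightarrow> complex) set" where
  "pd_KMS \<beta> = {f. pd_function real_group f \<and> KMS \<beta> f}"


section \<open>Measures and their Fourier transforms\<close>

text \<open>
  \<^term>\<open>basic_rp \<beta> l y\<close> is the value of the function with parameter \<open>l \<ge> 0\<close> at the class of \<open>y\<close>;
  the formula is meant for \<open>0 \<le> y \<le> \<beta>\<close> only and is not periodic in \<open>y\<close>.
\<close>

definition basic_rp :: "real \<Rightarrow> real \<Rightarrow> real \<Rightarrow> real" where
  "basic_rp \<beta> l y = (exp (- l * y) + exp (- l * (\<beta> - y))) / (1 + exp (- l * \<beta>))"

definition fourier :: "real measure \<Rightarrow> complex \<Rightarrow> complex" where
  "fourier \<nu> z = (LINT l|\<nu>. exp (\<i> * z * of_real l))"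

definition plus_measure :: "'a measure \<Rightarrow> 'a measure \<Rightarrow> 'a measure" where
  "plus_measure M N = measure_of (space M) (sets M) (\<lambda>A. emeasure M A + emeasure N A)"

definition Gamma_measure :: "real \<Rightarrow> real measure \<Rightarrow> real measure" where
  "Gamma_measure \<beta> \<mu> =
     density (plus_measure \<mu> (distr \<mu> borel uminus)) (\<lambda>l. ennreal (1 / (1 + exp (- \<beta> * l))))"

lemma sets_plus_measure [simp]: "sets (plus_measure M N) = sets M"
  by (simp add: plus_measure_def sets.sets_measure_of_eq)

lemma emeasure_plus_measure:
  assumes "sets M = sets N" "A \<in> sets M"
  shows "emeasure (plus_measure M N) A = emeasure M A + emeasure N A"
proof (rule emeasure_measure_of [OF plus_measure_def])
  show "countably_additive (sets (plus_measure M N)) (\<lambda>A. emeasure M A + emeasure N A)"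
  proof (rule countably_additiveI)
    fix B :: "nat \<Rightarrow> 'a set"
    assume "range B \<subseteq> sets (plus_measure M N)" "disjoint_family B"
    then show "(\<Sum>i. emeasure M (B i) + emeasure N (B i)) =
        emeasure M (\<Union>i. B i) + emeasure N (\<Union>i. B i)"
      using assms by (simp add: suminf_add [symmetric] suminf_emeasure)
  qed
qed (use assms sets.sets_into_space in \<open>auto simp: positive_def\<close>)

end

theory Submission
  imports Defs "HOL-Probability.Probability" "HOL-Complex_Analysis.Complex_Analysis"
begin

text \<open>
  Read on the period \<open>[0, \<beta>]\<close>, a continuous reflection positive function is a function \<open>g\<close> with
  \<open>g (\<beta> - y) = g y\<close> whose kernel \<open>g (s + t)\<close> is positive definite for \<open>0 < s, t < \<beta> / 2\<close>. The
  theorem holds because such functions are exactly the Laplace transforms \<open>g y = \<integral> e\<^sup>-\<^sup>y\<^sup>l d\<nu>(l)\<close> of the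
  finite measures \<open>\<nu>\<close> that are transformed into \<open>e\<^sup>-\<^sup>\<beta>\<^sup>l d\<nu>(l)\<close> by the reflection \<open>l \<mapsto> - l\<close>. For such a
  measure the function \<open>\<integral> e\<^sup>i\<^sup>z\<^sup>l d\<nu>(l)\<close> is continuous on the closed strip and holomorphic inside; it is
  \<open>g\<close> on the imaginary segment and a positive definite function on the real line, and the symmetry
  of \<open>\<nu>\<close> is the KMS condition.

  From the circle to the line the essential step is the measure
  (\<open>reflection_positive_integral_representation\<close>). On the grid \<open>y = k h\<close> the substitution
  \<open>x = e\<^sup>-\<^sup>l\<^sup>h\<close> turns a linear combination of the functions \<open>\<phi>\<^sub>l = basic_rp \<beta> l\<close>, up to a positive factor, into a
  polynomial in \<open>x > 0\<close>. If it is nonnegative, it is a sum of terms \<open>q\<^sup>2\<close> and \<open>x q\<^sup>2\<close>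
  (\<open>nonneg_poly_in_halfline_sos\<close>), and these are the combinations whose counterparts for \<open>g\<close> are
  nonnegative by positive definiteness of \<open>g (s + t)\<close>. Hence no linear inequality on the grid
  separates \<open>g\<close> from the mixtures of the functions \<open>\<phi>\<^sub>l\<close>, so that mixtures approximate \<open>g\<close> there
  (\<open>approximate_moment_problem\<close>). Continuity of \<open>g\<close> at \<open>0\<close> keeps the mixing measures tight, and
  Helly's theorem provides the limit for finer and finer dyadic grids.

  From the line to the circle let \<open>F\<close> be the function on the strip with boundary values \<open>f\<close>.
  Multiplied by a wide Gaussian, \<open>f\<close> becomes the Fourier transform of a finite measure \<open>\<nu>\<close>
  (\<open>gaussian_damped_pd_is_fourier\<close>). A Fourier transform that extends to the strip is
  given there by an absolutely convergent integral (\<open>fourier_extension\<close>): the half of \<open>\<nu>\<close> that could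
  cause divergence has a transform that continues across the real line, and the Taylor coefficients
  of a Laplace transform of a positive measure have a fixed sign pattern, so that convergence of the Taylor
  series is convergence of the integral. Therefore the damped \<open>F (\<i> (s + t))\<close> is a positive
  definite kernel, and so is \<open>F (\<i> (s + t))\<close> in the limit. The KMS condition and \<open>f (- t) = cnj (f t)\<close>
  give \<open>F (\<i> \<beta> - z) = F z\<close>, and the integral representation applies to \<open>y \<mapsto> F (\<i> y)\<close>. It also yields
  positive definiteness on the whole circle, because each \<open>\<phi>\<^sub>l\<close> is positive definite there
  (\<open>pd_kernel_basic_rp_difference\<close>).

  The extension is unique, and the correspondence is injective, because a function on the strip is
  determined by its values on the imaginary segment, and also by its values on the real line
  (\<open>strip_identity_vertical\<close>, \<open>strip_identity_real_line\<close>).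
\<close>

section \<open>Polynomials that are nonnegative on a half-line\<close>

text \<open>
  The degree bounds belong to the definition because a positive functional given by finitely many
  moments can be evaluated on such squares only.
\<close>
inductive_set halfline_sos :: "nat \<Rightarrow> real poly set" for n where
  square: "2 * degree q \<le> n \<Longrightarrow> q ^ 2 \<in> halfline_sos n"
| shifted_square: "2 * degree q + 1 \<le> n \<Longrightarrow> [:0, 1:] * q ^ 2 \<in> halfline_sos n"
| add: "p \<in> halfline_sos n \<Longrightarrow> q \<in> halfline_sos n \<Longrightarrow> p + q \<in> halfline_sos n"

lemma halfline_sos_mono:
  assumes "p \<in> halfline_sos m" "m \<le> n"
  shows "p \<in> halfline_sos n"
  using assms(1) by induction (use assms(2) in \<open>auto intro: halfline_sos.intros simp del: mult_pCons_left\<close>)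

lemma degree_linear_mult_le: "degree ([:a, b:] * q) \<le> Suc (degree q)" for q :: "real poly"
  using degree_mult_le[of "[:a, b:]" q] by (auto split: if_splits simp del: mult_pCons_left)

lemma halfline_sos_mult_var:
  assumes "p \<in> halfline_sos n"
  shows "[:0, 1:] * p \<in> halfline_sos (Suc n)"
  using assms
proof induction
  case (square q)
  then show ?case
    by (intro halfline_sos.shifted_square) auto
next
  case (shifted_square q)
  have "[:0, 1:] * ([:0, 1:] * q ^ 2) = ([:0, 1:] * q) ^ 2"
    by (simp only: power2_eq_square mult_ac)
  moreover have "2 * degree ([:0, 1:] * q) \<le> Suc n"
    using shifted_square degree_linear_mult_le[of 0 1 q] by linarith
  ultimately show ?case
    by (metis halfline_sos.square)
next
  case (add p q)
  then show ?case
    by (metis halfline_sos.add distrib_left)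
qed

lemma halfline_sos_mult_square:
  assumes "p \<in> halfline_sos n"
  shows "[:- r, 1:] ^ 2 * p \<in> halfline_sos (n + 2)"
  using assms
proof induction
  case (square q)
  have "[:- r, 1:] ^ 2 * q ^ 2 = ([:- r, 1:] * q) ^ 2"
    by (simp only: power_mult_distrib)
  moreover have "2 * degree ([:- r, 1:] * q) \<le> n + 2"
    using square degree_linear_mult_le[of "-r" 1 q] by linarith
  ultimately show ?case
    by (metis halfline_sos.square)
next
  case (shifted_square q)
  have "[:- r, 1:] ^ 2 * ([:0, 1:] * q ^ 2) = [:0, 1:] * ([:- r, 1:] * q) ^ 2"
    by (simp only: power2_eq_square mult_ac)
  moreover have "2 * degree ([:- r, 1:] * q) + 1 \<le> n + 2"
    using shifted_square degree_linear_mult_le[of "-r" 1 q] by linarith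
  ultimately show ?case
    by (metis halfline_sos.shifted_square)
next
  case (add p q)
  then show ?case
    by (metis halfline_sos.add distrib_left)
qed

text \<open>
  Dividing a nonnegative polynomial by \<open>x\<close> or by \<open>(x - r)\<^sup>2\<close> leaves the sign of the quotient unknown at one
  point, where continuity supplies it.
\<close>
lemma poly_nonneg_except_point:
  fixes p :: "real poly"
  assumes "\<And>x. 0 < x \<Longrightarrow> x \<noteq> r \<Longrightarrow> 0 \<le> poly p x" and "0 \<le> x"
  shows "0 \<le> poly p x"
proof (rule tendsto_lowerbound)
  show "(poly p \<longlongrightarrow> poly p x) (at_right x)"
    by (intro tendsto_intros)
  have "\<forall>\<^sub>F y in at_right x. y \<in> (if x < r then {x<..<r} else {x<..<x+1})"
    using eventually_at_right_less[of x] 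
    by (auto intro: eventually_at_rightI[of _ r] eventually_at_rightI[of _ "x+1"])
  then show "\<forall>\<^sub>F y in at_right x. 0 \<le> poly p y"
    by eventually_elim (use assms in \<open>auto split: if_splits\<close>)
qed auto

lemma poly_attains_min_halfline:
  fixes p :: "real poly"
  assumes nonneg: "\<And>x. 0 \<le> x \<Longrightarrow> 0 \<le> poly p x" and "degree p > 0"
  obtains r where "0 \<le> r" "\<And>x. 0 \<le> x \<Longrightarrow> poly p r \<le> poly p x"
proof -
  have lc: "lead_coeff (p - [:poly p 0:]) = lead_coeff p"
    using \<open>degree p > 0\<close> by (cases p) (auto split: if_splits)
  have "lead_coeff p > 0"
  proof (rule ccontr)
    assume "\<not> lead_coeff p > 0"
    moreover have "lead_coeff p \<noteq> 0"
      using \<open>degree p > 0\<close> by auto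
    ultimately have "lead_coeff (- p) > 0"
      by (simp del: leading_coeff_0_iff)
    then obtain n where "\<And>x. n \<le> x \<Longrightarrow> poly (- p) x \<ge> lead_coeff (- p)"
      using poly_pinfty_gt_lc by blast
    from this[of "max n 0"] \<open>lead_coeff (- p) > 0\<close> nonneg[of "max n 0"] show False
      by simp
  qed
  with lc obtain n where n: "\<And>x. n \<le> x \<Longrightarrow> poly (p - [:poly p 0:]) x \<ge> lead_coeff p"
    using poly_pinfty_gt_lc[of "p - [:poly p 0:]"] by auto
  define R where "R = max n 0"
  obtain r where r: "r \<in> {0..R}" "\<And>x. x \<in> {0..R} \<Longrightarrow> poly p r \<le> poly p x"
    using continuous_attains_inf[of "{0..R}" "poly p", OF _ _ continuous_on_poly[OF continuous_on_id]]
    by (auto simp: R_def)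
  have "poly p r \<le> poly p x" if "0 \<le> x" for x
  proof (cases "x \<le> R")
    case False
    then have "poly p 0 \<le> poly p x"
      using n[of x] \<open>lead_coeff p > 0\<close> unfolding R_def by fastforce
    with r(2)[of 0] show ?thesis
      by (simp add: R_def)
  qed (use r that in auto)
  with r(1) that show thesis
    by auto
qed

text \<open>
  Subtract the minimum of \<open>p\<close> on the half-line, which is a nonnegative constant and hence a square. If the minimum
  is attained at \<open>0\<close>, the rest is divisible by \<open>x\<close>; if it is attained at \<open>r > 0\<close>, the rest has a
  double root there and is divisible by \<open>(x - r)\<^sup>2\<close>. In both cases the quotient is again
  nonnegative and of smaller degree, and multiplication by \<open>x\<close> or \<open>(x - r)\<^sup>2\<close> preserves the cone.
\<close>
theorem nonneg_poly_in_halfline_sos: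
  assumes "\<And>x. 0 \<le> x \<Longrightarrow> 0 \<le> poly p x"
  shows "p \<in> halfline_sos (degree p)"
  using assms
proof (induction "degree p" arbitrary: p rule: less_induct)
  case less
  have const: "[:c:] \<in> halfline_sos n" if "0 \<le> c" for c n
    using halfline_sos.square[of "[:sqrt c:]" n] that
    by (simp add: power2_eq_square)
  show ?case
  proof (cases "degree p = 0")
    case True
    then obtain c where "p = [:c:]"
      by (meson degree_eq_zeroE)
    with less.prems[of 0] const show ?thesis
      by simp
  next
    case False
    then obtain r where r: "0 \<le> r" "\<And>x. 0 \<le> x \<Longrightarrow> poly p r \<le> poly p x"
      using poly_attains_min_halfline[of p] less.prems by (metis gr0I)
    have "poly (p - [:poly p r:]) r = 0"
      by simp
    then obtain s where s: "p - [:poly p r:] = [:- r, 1:] * s"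
      unfolding poly_eq_0_iff_dvd by (auto elim: dvdE)
    then have p: "p = [:poly p r:] + [:- r, 1:] * s"
      by (simp add: algebra_simps)
    have "s \<noteq> 0"
    proof
      assume "s = 0"
      with p have "p = [:poly p r:]"
        by simp
      with False show False
        by (metis degree_pCons_0)
    qed
    have deg_s: "degree p = Suc (degree s)"
    proof -
      have d: "degree ([:- r, 1:] * s) = Suc (degree s)"
        using \<open>s \<noteq> 0\<close> by (subst degree_mult_eq) auto
      have "degree p = degree ([:- r, 1:] * s)"
        by (subst p, rule degree_add_eq_right) (use d in simp)
      with d show ?thesis
        by simp
    qed
    have ps: "poly p r + (x - r) * poly s x = poly p x" for x
      using arg_cong[OF s, of "\<lambda>p. poly p x"] by (simp add: algebra_simps)
    have rest: "[:- r, 1:] * s \<in> halfline_sos (degree p)"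
    proof (cases "r = 0")
      case True
      have "0 \<le> poly s x" if "0 \<le> x" for x
      proof (rule poly_nonneg_except_point[of 0])
        fix y :: real assume "0 < y"
        then have "0 \<le> y * poly s y"
          using ps[of y] r(2)[of y] True by simp
        then show "0 \<le> poly s y"
          using \<open>0 < y\<close> by (simp add: zero_le_mult_iff)
      qed (fact that)
      with less.hyps[of s] deg_s halfline_sos_mult_var[of s "degree s"] True show ?thesis
        by simp
    next
      case False
      with r have "r > 0"
        by simp
      have *: "0 \<le> (x - r) * poly s x" if "0 \<le> x" for x
        using r(2)[OF that] ps[of x] by simp
      \<comment> \<open>Across the interior minimum the cofactor changes sign, so the root is double.\<close>
      have "0 \<le> poly s r"
      proof (rule tendsto_lowerbound)
        show "(poly s \<longlongrightarrow> poly s r) (at_right r)"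
          by (intro tendsto_intros)
        show "\<forall>\<^sub>F y in at_right r. 0 \<le> poly s y"
          by (rule eventually_mono[OF eventually_at_right_less])
            (use *[of y for y] \<open>r > 0\<close> in \<open>smt (verit) mult_pos_neg\<close>)
      qed simp
      moreover have "poly s r \<le> 0"
      proof (rule tendsto_upperbound)
        show "(poly s \<longlongrightarrow> poly s r) (at_left r)"
          by (intro tendsto_intros)
        show "\<forall>\<^sub>F y in at_left r. poly s y \<le> 0"
        proof (rule eventually_at_leftI)
          fix y assume "y \<in> {0<..<r}"
          with *[of y] show "poly s y \<le> 0"
            by (smt (verit) greaterThanLessThan_iff mult_neg_pos)
        qed (fact \<open>r > 0\<close>)
      qed simp
      ultimately obtain t where t: "s = [:- r, 1:] * t"
        using poly_eq_0_iff_dvd[of s r] by (auto elim: dvdE)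
      then have "t \<noteq> 0"
        using \<open>s \<noteq> 0\<close> by auto
      then have deg_t: "degree s = Suc (degree t)"
        unfolding t by (subst degree_mult_eq) auto
      have "0 \<le> poly t x" if "0 \<le> x" for x
      proof (rule poly_nonneg_except_point[of r])
        fix y assume "0 < y" "y \<noteq> r"
        then have "0 \<le> (y - r) * ((y - r) * poly t y)"
          using *[of y] unfolding t by (simp add: algebra_simps)
        then have "0 \<le> (y - r)\<^sup>2 * poly t y"
          by (simp add: power2_eq_square mult_ac)
        then show "0 \<le> poly t y"
          using \<open>y \<noteq> r\<close> by (simp add: zero_le_mult_iff)
      qed (fact that)
      with less.hyps[of t] deg_s deg_t have "[:- r, 1:] ^ 2 * t \<in> halfline_sos (degree t + 2)"
        by (intro halfline_sos_mult_square) simp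
      moreover have "[:- r, 1:] * s = [:- r, 1:] ^ 2 * t"
        by (simp only: t power2_eq_square mult.assoc)
      moreover have "degree t + 2 = degree p"
        using deg_s deg_t by simp
      ultimately show ?thesis
        by metis
    qed
    show ?thesis
      by (subst p, rule halfline_sos.add[OF const rest]) (use less.prems r in auto)
  qed
qed

section \<open>Sums of measures and approximate moment problems\<close>

lemma nn_integral_plus_measure:
  assumes sets: "sets M = sets N" and "f \<in> borel_measurable M"
  shows "(\<integral>\<^sup>+x. f x \<partial>plus_measure M N) = (\<integral>\<^sup>+x. f x \<partial>M) + (\<integral>\<^sup>+x. f x \<partial>N)"
  using assms(2)
proof induction
  case (cong f g)
  moreover have "space (plus_measure M N) = space M" "space N = space M"
    using sets sets_eq_imp_space_eq[of "plus_measure M N" M] sets_eq_imp_space_eq[of N M] by auto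
  ultimately show ?case
    by (simp cong: nn_integral_cong_simp)
next
  case (set A)
  then show ?case
    using sets by (simp add: emeasure_plus_measure)
next
  case (mult u c)
  then have "u \<in> borel_measurable N" "u \<in> borel_measurable (plus_measure M N)"
    using sets by (auto cong: measurable_cong_sets)
  with mult show ?case
    by (simp add: nn_integral_cmult distrib_left)
next
  case (add u v)
  then have "u \<in> borel_measurable N" "u \<in> borel_measurable (plus_measure M N)"
      "v \<in> borel_measurable N" "v \<in> borel_measurable (plus_measure M N)"
    using sets by (auto cong: measurable_cong_sets)
  with add show ?case
    by (simp add: nn_integral_add ac_simps)
next
  case (seq U)
  have mN: "U i \<in> borel_measurable N" "U i \<in> borel_measurable (plus_measure M N)" for i
    using seq(1)[of i] sets by (auto cong: measurable_cong_sets)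
  have "(\<integral>\<^sup>+x. (SUP i. U i) x \<partial>K) = (SUP i. \<integral>\<^sup>+x. U i x \<partial>K)"
    if "\<And>i. U i \<in> borel_measurable K" for K
    using nn_integral_monotone_convergence_SUP[OF \<open>incseq U\<close>, of K] that by (simp add: image_comp)
  note SUP = this[of "plus_measure M N", OF mN(2)] this[of M, OF seq(1)] this[of N, OF mN(1)]
  have mono: "incseq (\<lambda>i. \<integral>\<^sup>+x. U i x \<partial>K)" for K
    using \<open>incseq U\<close> by (auto simp: incseq_def le_fun_def intro!: nn_integral_mono)
  show ?case
    unfolding SUP using seq.IH by (simp add: ennreal_SUP_add mono)
qed

lemma integrable_plus_measure_iff:
  fixes f :: "'a \<Rightarrow> 'b :: {banach, second_countable_topology}"
  assumes sets: "sets M = sets N"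
  shows "integrable (plus_measure M N) f \<longleftrightarrow> integrable M f \<and> integrable N f"
proof (cases "f \<in> borel_measurable M")
  case True
  then have "f \<in> borel_measurable N" "f \<in> borel_measurable (plus_measure M N)"
    using sets by (auto cong: measurable_cong_sets)
  with True sets show ?thesis
    by (simp add: integrable_iff_bounded nn_integral_plus_measure)
next
  case False
  then have "f \<notin> borel_measurable (plus_measure M N)"
    by (auto cong: measurable_cong_sets)
  with False show ?thesis
    by (auto dest: borel_measurable_integrable)
qed

lemma integral_plus_measure:
  fixes f :: "'a \<Rightarrow> 'b :: {banach, second_countable_topology}"
  assumes sets: "sets M = sets N" and "integrable M f" "integrable N f"
  shows "(\<integral>x. f x \<partial>plus_measure M N) = (\<integral>x. f x \<partial>M) + (\<integral>x. f x \<partial>N)"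
proof -
  have space: "space (plus_measure M N) = space M" "space N = space M"
    using sets sets_eq_imp_space_eq[of "plus_measure M N" M] sets_eq_imp_space_eq[of N M] by auto
  have "integrable (plus_measure M N) f"
    using assms integrable_plus_measure_iff by blast
  then show ?thesis
  proof (induction rule: integrable_induct)
    case (base A c)
    then have "emeasure M A < \<infinity>" "emeasure N A < \<infinity>"
      using sets emeasure_plus_measure[OF sets, of A] by auto
    with base sets emeasure_plus_measure[OF sets, of A] show ?case
      by (simp add: measure_def enn2real_plus scaleR_left_distrib)
  next
    case (add f g)
    then show ?case
      using sets by (simp add: integrable_plus_measure_iff ac_simps)
  next
    case (lim f s)
    have int: "integrable K f" "\<And>i. integrable K (s i)" if "K \<in> {M, N}" for K
      using lim(1,4) that unfolding integrable_plus_measure_iff[OF sets] by auto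
    have "(\<lambda>i. \<integral>x. s i x \<partial>K) \<longlonglongrightarrow> (\<integral>x. f x \<partial>K)" if "K \<in> {plus_measure M N, M, N}" for K
    proof (rule integral_dominated_convergence[where w = "\<lambda>x. 2 * norm (f x)"])
      show "integrable K (\<lambda>x. 2 * norm (f x))" "f \<in> borel_measurable K" 
          "s i \<in> borel_measurable K" for i
        using int[of K] lim(1,4) that by auto
      have "space K = space (plus_measure M N)"
        using that space by auto
      then show "AE x in K. (\<lambda>i. s i x) \<longlonglongrightarrow> f x"
          "\<And>i. AE x in K. norm (s i x) \<le> 2 * norm (f x)"
        using lim(2,3) by auto
    qed
    then have "(\<lambda>i. \<integral>x. s i x \<partial>plus_measure M N) \<longlonglongrightarrow> (\<integral>x. f x \<partial>plus_measure M N)"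
        "(\<lambda>i. (\<integral>x. s i x \<partial>M) + (\<integral>x. s i x \<partial>N)) \<longlonglongrightarrow> (\<integral>x. f x \<partial>M) + (\<integral>x. f x \<partial>N)"
      by (auto intro!: tendsto_add)
    with lim(5) show ?case
      using LIMSEQ_unique by auto
  qed
qed

lemma mixture_with_point_mass:
  fixes x :: real
  assumes "real_distribution M" and "0 \<le> e" "e \<le> 1"
  obtains M' where "real_distribution M'"
    "\<And>f :: real \<Rightarrow> real. integrable M f \<Longrightarrow> f \<in> borel_measurable borel \<Longrightarrow> (\<integral>y. f y \<partial>M') = (1 - e) * (\<integral>y. f y \<partial>M) + e * f x"
proof
  interpret real_distribution M by fact
  interpret ret: prob_space "return borel x"
    by (rule prob_space_return) simp
  define M1 where "M1 = density M (\<lambda>_. ennreal (1 - e))"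
  define M2 where "M2 = density (return borel x) (\<lambda>_. ennreal e)"
  have sets: "sets M1 = sets borel" "sets M2 = sets borel" "sets M1 = sets M2"
    by (auto simp: M1_def M2_def)
  have "emeasure (plus_measure M1 M2) UNIV = emeasure M1 UNIV + emeasure M2 UNIV"
    using sets by (intro emeasure_plus_measure) auto
  also have "\<dots> = ennreal (1 - e) + ennreal e"
    using emeasure_space_1 ret.emeasure_space_1 by (simp add: M1_def M2_def emeasure_density nn_integral_cmult)
  also have "\<dots> = 1"
    using assms by (simp flip: ennreal_plus)
  finally have "prob_space (plus_measure M1 M2)"
    by (intro prob_spaceI) (use sets sets_eq_imp_space_eq[of "plus_measure M1 M2" borel] in simp)
  then show "real_distribution (plus_measure M1 M2)"
    by (simp add: real_distribution_def real_distribution_axioms_def sets)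
  fix f :: "real \<Rightarrow> real" assume f: "integrable M f" "f \<in> borel_measurable borel"
  have "integrable (return borel x) f"
    using f by (simp add: integrable_iff_bounded nn_integral_return)
  then show "(\<integral>y. f y \<partial>plus_measure M1 M2) = (1 - e) * (\<integral>y. f y \<partial>M) + e * f x"
    using f assms by (subst integral_plus_measure[OF sets(3)])
      (auto simp: M1_def M2_def integral_density integrable_density integral_return)
qed

text \<open>
  The hypothesis says that no affine inequality valid for all points \<open>\<psi> x\<close> fails at \<open>v\<close>, so that \<open>v\<close>
  lies in the closed convex hull of these points. The separation argument is carried out directly on
  measures: near a minimiser \<open>M\<close> of the squared distance, moving a mass \<open>e\<close> to a point \<open>x\<close> cannot decrease
  this squared distance by more than \<open>e\<^sup>2\<close>. To first order in \<open>e\<close> this is an affine inequality in \<open>\<psi> x\<close>, and at \<open>v\<close> it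
  bounds the squared distance itself.
\<close>
lemma approximate_moment_problem:
  fixes \<psi> :: "'k \<Rightarrow> real \<Rightarrow> real" and v :: "'k \<Rightarrow> real"
  assumes fin: "finite K"
    and meas: "\<And>k. \<psi> k \<in> borel_measurable borel"
    and bound: "\<And>k x. \<bar>\<psi> k x\<bar> \<le> 1"
    and pos: "\<And>a c. (\<And>x. 0 \<le> c + (\<Sum>k\<in>K. a k * \<psi> k x)) \<Longrightarrow> 0 \<le> c + (\<Sum>k\<in>K. a k * v k)"
    and "0 < \<delta>"
  obtains M where "real_distribution M" "(\<Sum>k\<in>K. ((\<integral>x. \<psi> k x \<partial>M) - v k)\<^sup>2) \<le> \<delta>"
proof -
  define J where "J M = (\<Sum>k\<in>K. ((\<integral>x. \<psi> k x \<partial>M) - v k)\<^sup>2)" for M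
  define I where "I = (INF M \<in> Collect real_distribution. J M)"
  have bdd: "bdd_below (J ` Collect real_distribution)"
    by (auto simp: J_def intro!: bdd_belowI[of _ 0] sum_nonneg)
  have "real_distribution (return borel 0)"
    by (simp add: real_distribution_def real_distribution_axioms_def prob_space_return)
  then have ne: "J ` Collect real_distribution \<noteq> {}"
    by auto
  define C where "C = 1 + 4 * real (card K)"
  have "C > 0"
    by (simp add: C_def add_pos_nonneg)
  define e where "e = min 1 (2 * \<delta> / C)"
  have e: "0 < e" "e \<le> 1" "e * C \<le> 2 * \<delta>"
    using \<open>0 < \<delta>\<close> \<open>C > 0\<close> by (auto simp: e_def min_def field_simps)
  obtain M where M: "real_distribution M" "J M < I + e\<^sup>2"
    using cInf_lessD[OF ne, of "I + e\<^sup>2"] e by (auto simp: I_def)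
  interpret real_distribution M by fact
  have int: "integrable M (\<psi> k)" for k
    by (rule integrable_const_bound[of _ 1]) (use meas bound in auto)
  define m where "m k = (\<integral>x. \<psi> k x \<partial>M)" for k
  define c where "c k = m k - v k" for k
  have JM: "J M = (\<Sum>k\<in>K. (c k)\<^sup>2)"
    by (simp add: J_def c_def m_def)
  have m_bound: "\<bar>m k\<bar> \<le> 1" for k
  proof -
    have "\<bar>m k\<bar> \<le> (\<integral>x. \<bar>\<psi> k x\<bar> \<partial>M)"
      unfolding m_def by (rule integral_abs_bound)
    also have "\<dots> \<le> (\<integral>x. 1 \<partial>M)"
      using int bound by (intro integral_mono) auto
    finally show ?thesis
      using prob_space by simp
  qed
  \<comment> \<open>The quadratic term contributes at most \<open>4 e\<^sup>2\<close> for each index because \<open>\<psi>\<close> and \<open>m\<close> are bounded by \<open>1\<close>;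
    together with the slack \<open>e\<^sup>2\<close> of the near minimiser this gives the constant \<open>C\<close>.\<close>
  have variation: "0 \<le> (e * C - 2 * (\<Sum>k\<in>K. c k * m k)) + (\<Sum>k\<in>K. (2 * c k) * \<psi> k x)" for x
  proof -
    obtain M' where M': "real_distribution M'"
        "\<And>k. (\<integral>y. \<psi> k y \<partial>M') = (1 - e) * m k + e * \<psi> k x"
      using mixture_with_point_mass[OF M(1), of e x] int meas e unfolding m_def by (metis less_imp_le)
    define d where "d k = \<psi> k x - m k" for k
    have d: "(d k)\<^sup>2 \<le> 4" for k
    proof -
      have "\<bar>d k\<bar> \<le> 2"
        unfolding d_def using m_bound[of k] bound[of k x] by linarith
      then show ?thesis
        using abs_le_square_iff[of "d k" 2] by simp
    qed
    have "I \<le> J M'"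
      unfolding I_def using M'(1) by (intro cINF_lower bdd) auto
    also have "J M' = (\<Sum>k\<in>K. (c k + e * d k)\<^sup>2)"
      unfolding J_def M'(2) by (simp add: c_def d_def algebra_simps)
    also have "\<dots> = J M + 2 * e * (\<Sum>k\<in>K. c k * d k) + e\<^sup>2 * (\<Sum>k\<in>K. (d k)\<^sup>2)"
      by (simp add: JM power2_sum power_mult_distrib sum.distrib sum_distrib_left mult_ac)
    also have "e\<^sup>2 * (\<Sum>k\<in>K. (d k)\<^sup>2) \<le> e\<^sup>2 * (4 * real (card K))"
      using sum_mono[of K "\<lambda>k. (d k)\<^sup>2" "\<lambda>_. 4"] d by (intro mult_left_mono) auto
    finally have "I \<le> J M + 2 * e * (\<Sum>k\<in>K. c k * d k) + e\<^sup>2 * (4 * real (card K))"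
      by simp
    with M(2) have "0 \<le> 2 * e * (\<Sum>k\<in>K. c k * d k) + e\<^sup>2 * C"
      by (simp add: C_def algebra_simps)
    then have "0 \<le> e * (2 * (\<Sum>k\<in>K. c k * d k) + e * C)"
      by (simp add: algebra_simps power2_eq_square)
    then have "0 \<le> 2 * (\<Sum>k\<in>K. c k * d k) + e * C"
      using e by (simp add: zero_le_mult_iff)
    then show ?thesis
      by (simp add: d_def right_diff_distrib sum_subtractf sum_distrib_left mult_ac)
  qed
  have "0 \<le> (e * C - 2 * (\<Sum>k\<in>K. c k * m k)) + (\<Sum>k\<in>K. (2 * c k) * v k)"
    by (rule pos) (fact variation)
  also have "\<dots> = e * C - 2 * J M"
    by (simp add: JM c_def power2_eq_square algebra_simps sum_subtractf sum.distrib sum_distrib_left)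
  finally have "J M \<le> \<delta>"
    using e by simp
  with M(1) that show thesis
    by (simp add: J_def)
qed

section \<open>The basic reflection positive functions\<close>

lemma basic_rp_pos: "0 < basic_rp \<beta> l y"
  unfolding basic_rp_def by (intro divide_pos_pos add_pos_pos) auto

lemma basic_rp_le_1:
  assumes "0 \<le> y" "y \<le> \<beta>"
  shows "basic_rp \<beta> l y \<le> 1"
proof -
  have "0 \<le> (1 - exp (- l * y)) * (1 - exp (- l * (\<beta> - y)))"
    using assms by (cases "0 \<le> l") (auto intro!: mult_nonneg_nonneg mult_nonpos_nonpos simp: mult_nonneg_nonneg mult_nonpos_nonneg)
  also have "\<dots> = 1 + exp (- l * \<beta>) - (exp (- l * y) + exp (- l * (\<beta> - y)))"
    by (simp add: algebra_simps flip: exp_add)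
  finally show ?thesis
    unfolding basic_rp_def by (simp add: divide_le_eq_1 add_pos_pos)
qed

lemma abs_basic_rp_le_1: "0 \<le> y \<Longrightarrow> y \<le> \<beta> \<Longrightarrow> \<bar>basic_rp \<beta> l y\<bar> \<le> 1"
  using basic_rp_le_1[of y \<beta> l] basic_rp_pos[of \<beta> l y] by simp

lemma basic_rp_zero [simp]: "basic_rp \<beta> l 0 = 1"
  by (simp add: basic_rp_def add_pos_pos pos_add_strict order.strict_implies_not_eq[symmetric])

text \<open>
  As the functions are even in the parameter, mixing measures may live on the whole line until the
  very end, where they are pushed to the half-line by \<open>abs\<close>.
\<close>
lemma basic_rp_uminus [simp]: "basic_rp \<beta> (- l) y = basic_rp \<beta> l y"
proof -
  have "basic_rp \<beta> (- l) y = (exp (- l * \<beta>) * (exp (l * y) + exp (l * (\<beta> - y)))) / (exp (- l * \<beta>) * (1 + exp (l * \<beta>)))"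
    by (simp add: basic_rp_def)
  also have "\<dots> = basic_rp \<beta> l y"
    by (simp add: basic_rp_def algebra_simps flip: exp_add)
  finally show ?thesis .
qed

lemma basic_rp_abs [simp]: "basic_rp \<beta> \<bar>l\<bar> y = basic_rp \<beta> l y"
  by (simp add: abs_if)

lemma continuous_on_basic_rp [continuous_intros]:
  "continuous_on S f \<Longrightarrow> continuous_on S g \<Longrightarrow> continuous_on S (\<lambda>x. basic_rp \<beta> (f x) (g x))"
  unfolding basic_rp_def
  by (intro continuous_intros) (simp_all add: add_pos_pos order.strict_implies_not_eq[symmetric])

lemma borel_measurable_basic_rp [measurable]: "(\<lambda>l. basic_rp \<beta> l y) \<in> borel_measurable borel"
  by (intro borel_measurable_continuous_onI continuous_intros)

lemma basic_rp_decay: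
  assumes "0 \<le> y" "y \<le> \<beta> / 2"
  shows "basic_rp \<beta> l y \<le> 2 * exp (- \<bar>l\<bar> * y)"
proof -
  have "basic_rp \<beta> l y = basic_rp \<beta> \<bar>l\<bar> y"
    by simp
  also have "\<dots> \<le> exp (- \<bar>l\<bar> * y) + exp (- \<bar>l\<bar> * (\<beta> - y))"
    unfolding basic_rp_def using divide_left_mono[of 1 "1 + exp (- \<bar>l\<bar> * \<beta>)" "exp (- \<bar>l\<bar> * y) + exp (- \<bar>l\<bar> * (\<beta> - y))"]
    by (simp add: add_pos_pos)
  also have "exp (- \<bar>l\<bar> * (\<beta> - y)) \<le> exp (- \<bar>l\<bar> * y)"
    using assms by (auto intro!: mult_left_mono)
  finally show ?thesis
    by simp
qed

text \<open>
  The functional \<open>L\<close> sends \<open>x\<^sup>k\<close> to \<open>g (k h)\<close>. On \<open>q\<^sup>2\<close> it is the quadratic form of the kernel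
  \<open>g (s + t)\<close> at the points \<open>i h\<close>, and on \<open>x q\<^sup>2\<close> the form at the points \<open>i h + h / 2\<close>; the
  degree bounds keep these points in \<open>[0, \<beta> / 2]\<close>. With \<open>x = e\<^sup>-\<^sup>l\<^sup>h\<close> the given combination becomes the
  polynomial \<open>P\<close>, which is palindromic because \<open>\<phi>\<^sub>l\<close> is symmetric about \<open>\<beta> / 2\<close>.
\<close>
lemma positive_on_grid:
  fixes g :: "real \<Rightarrow> real" and a :: "nat \<Rightarrow> real"
  assumes "0 < \<beta>" "0 < m" and h: "h = \<beta> / (2 * real m)"
    and sym: "\<And>y. y \<in> {0..\<beta>} \<Longrightarrow> g (\<beta> - y) = g y"
    and psd: "\<And>(n::nat) b s. inj_on s {..n} \<Longrightarrow> s ` {..n} \<subseteq> {0..\<beta>/2} \<Longrightarrow>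
        0 \<le> (\<Sum>i\<le>n. \<Sum>j\<le>n. b i * b j * g (s i + s j))"
    and nonneg: "\<And>l. 0 \<le> (\<Sum>k\<le>2*m. a k * basic_rp \<beta> l (k * h))"
  shows "0 \<le> (\<Sum>k\<le>2*m. a k * g (k * h))"
proof -
  have "h > 0" "2 * real m * h = \<beta>"
    using assms by (auto simp: h)
  define L where "L p = (\<Sum>k\<le>2*m. coeff p k * g (k * h))" for p
  have L_add: "L (p + q) = L p + L q" for p q
    by (simp add: L_def sum.distrib algebra_simps)
  have L_zero: "L 0 = 0"
    by (simp add: L_def)
  have L_sum: "L (sum f A) = (\<Sum>x\<in>A. L (f x))" for f and A :: "nat set"
    by (induction A rule: infinite_finite_induct) (simp_all add: L_add L_zero)
  have L_monom: "L (monom c k) = c * g (k * h)" if "k \<le> 2 * m" for c k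
    using that by (simp add: L_def if_distrib [of "\<lambda>x. x * _"] cong: if_cong)
  have square_expand: "q ^ 2 = (\<Sum>i\<le>degree q. \<Sum>j\<le>degree q. monom (coeff q i * coeff q j) (i + j))"
    for q :: "real poly"
    by (subst (1) poly_as_sum_of_monoms[symmetric])
      (simp only: power2_eq_square sum_product mult_monom)
  have L_sos: "0 \<le> L p" if "p \<in> halfline_sos (2 * m)" for p
    using that
  proof induction
    case (square q)
    have "L (q ^ 2) = (\<Sum>i\<le>degree q. \<Sum>j\<le>degree q. coeff q i * coeff q j * g (i * h + j * h))"
      unfolding square_expand L_sum using square by (intro sum.cong refl, subst L_monom) (auto simp: algebra_simps)
    also have "\<dots> \<ge> 0"
    proof (rule psd)
      show "(\<lambda>i. real i * h) ` {..degree q} \<subseteq> {0..\<beta>/2}"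
      proof safe
        fix i assume "i \<le> degree q"
        then have "real i * h \<le> real m * h"
          using square \<open>h > 0\<close> by simp
        then show "real i * h \<in> {0..\<beta>/2}"
          using \<open>h > 0\<close> \<open>2 * real m * h = \<beta>\<close> by auto
      qed
    qed (use \<open>h > 0\<close> in \<open>auto simp: inj_on_def\<close>)
    finally show ?case .
  next
    case (shifted_square q)
    have "[:0, 1:] * q ^ 2 = monom 1 1 * q ^ 2"
      by (simp add: monom_altdef)
    also have "\<dots> = (\<Sum>i\<le>degree q. \<Sum>j\<le>degree q. monom (coeff q i * coeff q j) (Suc (i + j)))"
      unfolding square_expand sum_distrib_left mult_monom by simp
    finally have "L ([:0, 1:] * q ^ 2) = (\<Sum>i\<le>degree q. \<Sum>j\<le>degree q. coeff q i * coeff q j * g ((i * h + h / 2) + (j * h + h / 2)))"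
      unfolding L_sum using shifted_square 
      by (simp only: L_sum) (intro sum.cong refl, subst L_monom, auto simp: algebra_simps)
    also have "\<dots> \<ge> 0"
    proof (rule psd)
      show "(\<lambda>i. real i * h + h / 2) ` {..degree q} \<subseteq> {0..\<beta>/2}"
      proof safe
        fix i assume "i \<le> degree q"
        then have "2 * real i + 1 \<le> 2 * real m"
          using shifted_square by linarith
        then have "(2 * real i + 1) * h \<le> (2 * real m) * h"
          using \<open>h > 0\<close> by (intro mult_right_mono) auto
        then show "real i * h + h / 2 \<in> {0..\<beta>/2}"
          using \<open>h > 0\<close> \<open>2 * real m * h = \<beta>\<close> by (auto simp: algebra_simps)
      qed
    qed (use \<open>h > 0\<close> in \<open>auto simp: inj_on_def\<close>)
    finally show ?case .
  next
    case (add p q)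
    then show ?case by (simp add: L_add)
  qed
  define P where "P = (\<Sum>k\<le>2*m. monom (a k) k + monom (a k) (2 * m - k))"
  have P_pos: "0 \<le> poly P x" if "0 < x" for x
  proof -
    define l where "l = - ln x / h"
    have x: "exp (- l * (real k * h)) = x ^ k" for k
    proof -
      have "- l * (real k * h) = of_nat k * ln x"
        using \<open>h > 0\<close> by (simp add: l_def)
      then show ?thesis
        using \<open>0 < x\<close> by (metis exp_ln exp_of_nat_mult)
    qed
    have beta: "\<beta> = real (2 * m) * h"
      using \<open>2 * real m * h = \<beta>\<close> by simp
    have "basic_rp \<beta> l (k * h) = (x ^ k + x ^ (2 * m - k)) / (1 + x ^ (2 * m))" if "k \<le> 2 * m" for k
    proof -
      have "\<beta> - k * h = real (2 * m - k) * h"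
        using that by (simp add: beta algebra_simps of_nat_diff)
      moreover have "exp (- l * \<beta>) = x ^ (2 * m)"
        unfolding beta by (rule x)
      ultimately show ?thesis
        by (simp only: basic_rp_def x)
    qed
    then have "(\<Sum>k\<le>2*m. a k * basic_rp \<beta> l (k * h)) = (\<Sum>k\<le>2*m. a k * ((x ^ k + x ^ (2 * m - k)) / (1 + x ^ (2 * m))))"
      by (intro sum.cong) auto
    also have "\<dots> = poly P x / (1 + x ^ (2 * m))"
      by (simp add: P_def poly_sum poly_monom sum_divide_distrib algebra_simps)
    finally have "0 \<le> poly P x / (1 + x ^ (2 * m))"
      using nonneg[of l] by simp
    moreover have "0 < 1 + x ^ (2 * m)"
      using \<open>0 < x\<close> by (simp add: add_pos_pos)
    ultimately show ?thesis
      by (simp add: zero_le_divide_iff)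
  qed
  have "degree P \<le> 2 * m"
    unfolding P_def by (intro degree_sum_le degree_add_le) (auto intro: order_trans[OF degree_monom_le])
  moreover have "P \<in> halfline_sos (degree P)"
    by (rule nonneg_poly_in_halfline_sos, rule poly_nonneg_except_point[of 0]) (use P_pos in auto)
  ultimately have "0 \<le> L P"
    using L_sos halfline_sos_mono by blast
  also have "L P = (\<Sum>k\<le>2*m. a k * g (k * h) + a k * g (real (2 * m - k) * h))"
    unfolding P_def L_sum by (intro sum.cong) (auto simp: L_add L_monom)
  also have "\<dots> = (\<Sum>k\<le>2*m. 2 * (a k * g (k * h)))"
  proof (intro sum.cong refl)
    fix k assume "k \<in> {..2*m}"
    then have "real k * h \<le> real (2 * m) * h"
      using \<open>h > 0\<close> by (intro mult_right_mono) auto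
    then have "real k * h \<in> {0..\<beta>}"
      using \<open>h > 0\<close> \<open>2 * real m * h = \<beta>\<close> by auto
    moreover have "real (2 * m - k) * h = \<beta> - real k * h"
      using \<open>k \<in> {..2*m}\<close> \<open>2 * real m * h = \<beta>\<close> by (simp add: of_nat_diff algebra_simps)
    ultimately show "a k * g (k * h) + a k * g (real (2 * m - k) * h) = 2 * (a k * g (k * h))"
      using sym by simp
  qed
  finally show ?thesis
    by (simp flip: sum_distrib_left)
qed

lemma real_distribution_symmetric_interval:
  assumes "real_distribution M" and "0 < \<epsilon>"
  obtains L where "\<And>L'. L \<le> L' \<Longrightarrow> measure M {- L'..L'} > 1 - \<epsilon>"
proof -
  interpret real_distribution M by fact
  have "(\<lambda>n. measure M {- real n..real n}) \<longlonglongrightarrow> measure M (\<Union>n. {- real n..real n})"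
    by (rule finite_Lim_measure_incseq) (auto simp: incseq_def)
  also have "(\<Union>n. {- real n..real n}) = UNIV"
  proof -
    have "\<exists>n. x \<in> {- real n..real n}" for x
      using real_arch_simple[of "\<bar>x\<bar>"] by (auto simp: abs_le_iff minus_le_iff)
    then show ?thesis by auto
  qed
  finally have "(\<lambda>n. measure M {- real n..real n}) \<longlonglongrightarrow> 1"
    using prob_space by simp
  then obtain n where n: "measure M {- real n..real n} > 1 - \<epsilon>"
    using order_tendstoD(1)[of _ 1 sequentially "1 - \<epsilon>"] \<open>0 < \<epsilon>\<close>
    by (auto simp: eventually_sequentially)
  show thesis
  proof
    fix L' assume "real n \<le> L'"
    then have "measure M {- real n..real n} \<le> measure M {- L'..L'}"
      by (intro finite_measure_mono) auto
    with n show "measure M {- L'..L'} > 1 - \<epsilon>"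
      by simp
  qed
qed

text \<open>
  A single measure on the line is tight, so finitely many exceptions do no harm.
\<close>
lemma tight_if_eventually:
  assumes distr: "\<And>n. real_distribution (M n)"
    and ev: "\<And>\<epsilon>. 0 < \<epsilon> \<Longrightarrow> \<exists>L. \<forall>\<^sub>F n in sequentially. measure (M n) {- L..L} > 1 - \<epsilon>"
  shows "tight M"
  unfolding tight_def
proof (intro conjI allI impI)
  fix \<epsilon> :: real assume "0 < \<epsilon>"
  from ev[OF this] obtain L N where L: "\<And>n. N \<le> n \<Longrightarrow> measure (M n) {- L..L} > 1 - \<epsilon>"
    by (auto simp: eventually_sequentially)
  have "\<forall>n. \<exists>L. \<forall>L'\<ge>L. measure (M n) {- L'..L'} > 1 - \<epsilon>"
    by (rule allI, rule real_distribution_symmetric_interval[OF distr \<open>0 < \<epsilon>\<close>]) blast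
  then obtain K where K: "\<And>n L'. K n \<le> L' \<Longrightarrow> measure (M n) {- L'..L'} > 1 - \<epsilon>"
    by metis
  define B where "B = Max (insert 1 (insert L (K ` {..<N})))"
  have B: "1 \<le> B" "L \<le> B" "\<And>n. n < N \<Longrightarrow> K n \<le> B"
    unfolding B_def by (rule Max_ge; simp)+
  have "1 - \<epsilon> < measure (M n) {- B - 1<..B}" for n
  proof -
    interpret real_distribution "M n" by (rule distr)
    have "1 - \<epsilon> < measure (M n) {- B..B}"
    proof (cases "n < N")
      case False
      then have "1 - \<epsilon> < measure (M n) {- L..L}"
        using L by simp
      also have "\<dots> \<le> measure (M n) {- B..B}"
        using B by (intro finite_measure_mono) auto
      finally show ?thesis .
    qed (use K B in auto)
    also have "\<dots> \<le> measure (M n) {- B - 1<..B}"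
      by (intro finite_measure_mono) auto
    finally show ?thesis .
  qed
  moreover have "- B - 1 < B"
    using B by simp
  ultimately show "\<exists>a b. a < b \<and> (\<forall>n. 1 - \<epsilon> < measure (M n) {a<..b})"
    by blast
qed (fact distr)

section \<open>Integral representation on an interval\<close>

text \<open>
  The measures \<open>M j\<close> reproduce \<open>g\<close> on the grid of mesh \<open>\<beta> / 2\<^sup>j\<^sup>+\<^sup>1\<close> up to \<open>1 / (j + 1)\<close>. They are tight: at a
  small \<open>y > 0\<close> the value \<open>g y\<close> is close to \<open>g 0 = 1\<close>, whereas \<open>\<phi>\<^sub>l y \<le> 1 / 2\<close> for large \<open>l\<close>, so little mass
  can sit at large parameters. A weak limit represents \<open>g\<close> at all dyadic points and hence, by
  continuity, everywhere.
\<close>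
lemma normalised_mixture:
  fixes g :: "real \<Rightarrow> real"
  assumes "0 < \<beta>" and cont: "continuous_on {0..\<beta>} g" and "g 0 = 1"
    and sym: "\<And>y. y \<in> {0..\<beta>} \<Longrightarrow> g (\<beta> - y) = g y"
    and psd: "\<And>(n::nat) b s. inj_on s {..n} \<Longrightarrow> s ` {..n} \<subseteq> {0..\<beta>/2} \<Longrightarrow>
        0 \<le> (\<Sum>i\<le>n. \<Sum>j\<le>n. b i * b j * g (s i + s j))"
  obtains M where "real_distribution M" "\<And>y. y \<in> {0..\<beta>} \<Longrightarrow> g y = (\<integral>l. basic_rp \<beta> l y \<partial>M)"
proof -
  define h where "h j = \<beta> / (2 * real (2 ^ j))" for j :: nat
  have h_bounds: "real k * h j \<in> {0..\<beta>}" if "k \<le> 2 * 2 ^ j" for k j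
  proof -
    have "real k \<le> 2 * real (2 ^ j)"
      using that by (metis of_nat_le_iff of_nat_mult of_nat_numeral)
    then show ?thesis
      using \<open>0 < \<beta>\<close> by (simp add: h_def field_simps)
  qed
  have min_h: "min \<beta> (real k * h j) = real k * h j" if "k \<le> 2 * 2 ^ j" for k j
    using h_bounds[OF that] by simp
  \<comment> \<open>The value at \<open>0\<close> is the total mass, so the constant term of a positive combination may be
    moved to the grid point \<open>0\<close>.\<close>
  have ex: "\<exists>M. real_distribution M \<and>
      (\<Sum>k\<in>{..2*2^j}. ((\<integral>l. basic_rp \<beta> l (min \<beta> (real k * h j)) \<partial>M) - g (k * h j))\<^sup>2) \<le> (1 / Suc j)\<^sup>2" for j
  proof -
    have pos: "0 \<le> c + (\<Sum>k\<le>2*2^j. a k * g (k * h j))"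
      if nonneg: "\<And>l. 0 \<le> c + (\<Sum>k\<le>2*2^j. a k * basic_rp \<beta> l (min \<beta> (real k * h j)))" for a :: "nat \<Rightarrow> real" and c
    proof -
      define a' where "a' k = a k + (if k = 0 then c else 0)" for k
      have split: "(\<Sum>k\<le>2*2^j. a' k * f k) = c * f 0 + (\<Sum>k\<le>2*2^j. a k * f k)" for f :: "nat \<Rightarrow> real"
        by (simp add: a'_def algebra_simps sum.distrib if_distrib[of "\<lambda>x. _ * x"] cong: if_cong)
      have "0 \<le> (\<Sum>k\<le>2*2^j. a' k * g (k * h j))"
      proof (rule positive_on_grid[OF \<open>0 < \<beta>\<close> _ h_def sym psd])
        fix l
        have "(\<Sum>k\<le>2*2^j. a k * basic_rp \<beta> l (min \<beta> (real k * h j))) = (\<Sum>k\<le>2*2^j. a k * basic_rp \<beta> l (real k * h j))"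
          by (intro sum.cong) (auto simp: min_h)
        with nonneg[of l] show "0 \<le> (\<Sum>k\<le>2*2^j. a' k * basic_rp \<beta> l (k * h j))"
          by (simp add: split[of "\<lambda>k. basic_rp \<beta> l (k * h j)"])
      qed auto
      then show ?thesis
        using \<open>g 0 = 1\<close> by (simp add: split[of "\<lambda>k. g (k * h j)"])
    qed
    have d: "0 < (1 / real (Suc j))\<^sup>2"
      by simp
    show ?thesis
    proof (rule approximate_moment_problem[of "{..2*2^j}" "\<lambda>k l. basic_rp \<beta> l (min \<beta> (real k * h j))" "\<lambda>k. g (k * h j)", OF _ _ _ pos d])
      show "\<bar>basic_rp \<beta> l (min \<beta> (real k * h j))\<bar> \<le> 1" for k l
        using \<open>0 < \<beta>\<close> by (intro abs_basic_rp_le_1) (auto simp: h_def)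
    qed auto
  qed
  obtain M where "\<forall>j. real_distribution (M j) \<and>
      (\<Sum>k\<in>{..2*2^j}. ((\<integral>l. basic_rp \<beta> l (min \<beta> (real k * h j)) \<partial>M j) - g (k * h j))\<^sup>2) \<le> (1 / Suc j)\<^sup>2"
    by (rule exE[OF choice[OF allI[OF ex]]])
  then have M: "\<And>j. real_distribution (M j)"
      "\<And>j. (\<Sum>k\<in>{..2*2^j}. ((\<integral>l. basic_rp \<beta> l (min \<beta> (real k * h j)) \<partial>M j) - g (k * h j))\<^sup>2) \<le> (1 / Suc j)\<^sup>2"
    by auto
  have approx: "\<bar>(\<integral>l. basic_rp \<beta> l (real k * h j) \<partial>M j) - g (k * h j)\<bar> \<le> 1 / Suc j" if "k \<le> 2 * 2 ^ j" for k j
  proof -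
    have "((\<integral>l. basic_rp \<beta> l (min \<beta> (real k * h j)) \<partial>M j) - g (k * h j))\<^sup>2 \<le> (1 / Suc j)\<^sup>2"
      using that by (intro order_trans[OF member_le_sum M(2)]) auto
    then show ?thesis
      unfolding min_h[OF that] by (simp only: abs_le_square_iff[symmetric]) simp
  qed
  define D where "D = {real k * \<beta> / 2 ^ i | k i :: nat. k \<le> 2 ^ i}"
  have D_sub: "y \<in> {0..\<beta>}" if "y \<in> D" for y
  proof -
    from that obtain k i :: nat where "y = real k * \<beta> / 2 ^ i" "k \<le> 2 ^ i"
      by (auto simp: D_def)
    moreover from this have "real k \<le> 2 ^ i"
      by (metis of_nat_le_iff of_nat_numeral of_nat_power)
    then have "real k * \<beta> \<le> 2 ^ i * \<beta>"
      using \<open>0 < \<beta>\<close> by (intro mult_right_mono) auto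
    ultimately show ?thesis
      using \<open>0 < \<beta>\<close> by (simp add: divide_le_eq mult.commute)
  qed
  have conv: "(\<lambda>j. \<integral>l. basic_rp \<beta> l y \<partial>M j) \<longlonglongrightarrow> g y" if "y \<in> D" for y
  proof -
    from that obtain k i :: nat where y: "y = real k * \<beta> / 2 ^ i" "k \<le> 2 ^ i"
      by (auto simp: D_def)
    have "(\<lambda>j. (\<integral>l. basic_rp \<beta> l y \<partial>M j) - g y) \<longlonglongrightarrow> 0"
    proof (rule Lim_null_comparison)
      show "\<forall>\<^sub>F j in sequentially. norm ((\<integral>l. basic_rp \<beta> l y \<partial>M j) - g y) \<le> 1 / Suc j"
        using eventually_ge_at_top[of i]
      proof eventually_elim
        case (elim j)
        define k' where "k' = k * 2 ^ (j - i) * 2"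
        have pow: "2 ^ j = 2 ^ i * (2::nat) ^ (j - i)" "2 ^ j = 2 ^ i * (2::real) ^ (j - i)"
          using elim by (simp_all flip: power_add)
        have "k' \<le> 2 * 2 ^ j"
          using y(2) by (simp add: k'_def pow(1))
        moreover have "y = real k' * h j"
          by (simp add: y(1) k'_def h_def pow(2))
        ultimately show ?case
          using approx[of k' j] by simp
      qed
      show "(\<lambda>j. 1 / real (Suc j)) \<longlonglongrightarrow> 0"
        using LIMSEQ_inverse_real_of_nat by (simp add: inverse_eq_divide)
    qed
    then show ?thesis
      by (rule LIM_zero_cancel)
  qed
  have "tight M"
  proof (rule tight_if_eventually)
    fix \<epsilon> :: real assume "0 < \<epsilon>"
    have "(\<lambda>i. \<beta> / 2 ^ i) \<longlonglongrightarrow> 0"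
      using tendsto_mult[OF tendsto_const[of \<beta>] LIMSEQ_realpow_zero[of "1/2"]] by (simp add: power_divide)
    then have "(\<lambda>i. g (\<beta> / 2 ^ i)) \<longlonglongrightarrow> g 0"
      using \<open>0 < \<beta>\<close> by (intro continuous_on_tendsto_compose[OF cont]) (auto simp: field_simps)
    then have "\<forall>\<^sub>F i in sequentially. g (\<beta> / 2 ^ i) > 1 - \<epsilon> / 4"
      using \<open>g 0 = 1\<close> \<open>0 < \<epsilon>\<close> by (intro order_tendstoD(1)) auto
    then have "\<forall>\<^sub>F i in sequentially. 1 \<le> i \<and> g (\<beta> / 2 ^ i) > 1 - \<epsilon> / 4"
      by (intro eventually_conj eventually_ge_at_top)
    then obtain i where "i \<ge> 1" and i: "g (\<beta> / 2 ^ i) > 1 - \<epsilon> / 4"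
      using eventually_happens'[OF sequentially_bot] by blast
    define y where "y = \<beta> / 2 ^ i"
    have "y \<in> D"
      unfolding D_def y_def by (rule CollectI, rule exI[of _ 1], rule exI[of _ i]) simp
    have "(2::real) ^ 1 \<le> 2 ^ i"
      using \<open>i \<ge> 1\<close> by (intro power_increasing) auto
    then have y: "0 < y" "y \<le> \<beta> / 2"
      using \<open>0 < \<beta>\<close> divide_left_mono[of 2 "2 ^ i" \<beta>] by (simp_all add: y_def)
    define L where "L = ln 4 / y"
    have tail: "basic_rp \<beta> l y \<le> 1 - indicator (- {- L..L}) l / 2" for l
    proof (cases "l \<in> {- L..L}")
      case False
      then have "L < \<bar>l\<bar>"
        by auto
      then have "ln 4 \<le> \<bar>l\<bar> * y"
        using y by (simp add: L_def field_simps)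
      then have "exp (- \<bar>l\<bar> * y) \<le> exp (- ln 4)"
        by simp
      then have "exp (- \<bar>l\<bar> * y) \<le> 1 / 4"
        by (simp add: exp_minus inverse_eq_divide)
      with False basic_rp_decay[of y \<beta> l] y show ?thesis
        by simp
    qed (use basic_rp_le_1 y in auto)
    have "\<forall>\<^sub>F j in sequentially. (\<integral>l. basic_rp \<beta> l y \<partial>M j) > 1 - \<epsilon> / 4"
      using order_tendstoD(1)[OF conv[OF \<open>y \<in> D\<close>]] i by (simp add: y_def)
    then have "\<forall>\<^sub>F j in sequentially. measure (M j) {- L..L} > 1 - \<epsilon>"
    proof eventually_elim
      case (elim j)
      interpret real_distribution "M j" by (rule M)
      have int: "integrable (M j) (\<lambda>l. basic_rp \<beta> l y)"
        by (rule integrable_const_bound[of _ 1]) (use abs_basic_rp_le_1 y in auto)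
      have "(\<integral>l. basic_rp \<beta> l y \<partial>M j) \<le> (\<integral>l. 1 - indicator (- {- L..L}) l / 2 \<partial>M j)"
        using tail by (intro integral_mono int) (auto simp: integrable_real_indicator emeasure_eq_measure)
      also have "\<dots> = 1 - prob (- {- L..L}) / 2"
        using prob_space by (subst Bochner_Integration.integral_diff) (auto simp: integrable_real_indicator emeasure_eq_measure)
      also have "prob (- {- L..L}) = 1 - prob {- L..L}"
        using prob_compl[of "{- L..L}"] by (simp add: Compl_eq_Diff_UNIV)
      finally show ?case
        using elim \<open>0 < \<epsilon>\<close> by (simp add: field_simps)
    qed
    then show "\<exists>L. \<forall>\<^sub>F n in sequentially. 1 - \<epsilon> < measure (M n) {- L..L}"
      by blast
  qed (rule M)
  then obtain r M' where r: "strict_mono (r :: nat \<Rightarrow> nat)" and M': "real_distribution M'" "weak_conv_m (M \<circ> id \<circ> r) M'"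
    using tight_imp_convergent_subsubsequence[of M id] by (auto simp: strict_mono_def)
  interpret M': real_distribution M' by fact
  have eq_D: "g y = (\<integral>l. basic_rp \<beta> l y \<partial>M')" if "y \<in> D" for y
  proof -
    have "(\<lambda>n. \<integral>l. basic_rp \<beta> l y \<partial>M (r n)) \<longlonglongrightarrow> (\<integral>l. basic_rp \<beta> l y \<partial>M')"
    proof (rule weak_conv_imp_integral_bdd_continuous_conv[where B = 1])
      show "real_distribution (M (r n))" for n
        by (rule M)
      show "weak_conv_m (\<lambda>n. M (r n)) M'"
        using M' by (simp add: comp_def)
      show "isCont (\<lambda>l. basic_rp \<beta> l y) x" for x
        by (rule continuous_on_interior[of UNIV]) (auto intro!: continuous_intros)
      show "norm (basic_rp \<beta> x y) \<le> 1" for x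
        using abs_basic_rp_le_1 D_sub[OF that] by simp
    qed (rule M')
    moreover have "(\<lambda>n. \<integral>l. basic_rp \<beta> l y \<partial>M (r n)) \<longlonglongrightarrow> g y"
      using LIMSEQ_subseq_LIMSEQ[OF conv[OF that] r] by (simp add: comp_def)
    ultimately show ?thesis
      by (rule LIMSEQ_unique[symmetric])
  qed
  show thesis
  proof (rule that[OF M'(1)])
    fix y assume y: "y \<in> {0..\<beta>}"
    define x where "x i = real (nat \<lfloor>2 ^ i * (y / \<beta>)\<rfloor>) * \<beta> / 2 ^ i" for i :: nat
    have fl: "real (nat \<lfloor>2 ^ i * (y / \<beta>)\<rfloor>) = of_int \<lfloor>2 ^ i * (y / \<beta>)\<rfloor>" for i :: nat
      using y \<open>0 < \<beta>\<close> by (simp add: of_nat_nat)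
    have xD: "x i \<in> D" for i
    proof -
      have "real (nat \<lfloor>2 ^ i * (y / \<beta>)\<rfloor>) \<le> 2 ^ i * (y / \<beta>)"
        unfolding fl by (rule of_int_floor_le)
      also have "\<dots> \<le> 2 ^ i * 1"
        using y \<open>0 < \<beta>\<close> by (intro mult_left_mono) auto
      finally have "nat \<lfloor>2 ^ i * (y / \<beta>)\<rfloor> \<le> 2 ^ i"
        by (metis mult.right_neutral of_nat_le_iff of_nat_numeral of_nat_power)
      then show ?thesis
        unfolding D_def x_def by blast
    qed
    have x_lim: "x \<longlonglongrightarrow> y"
    proof (rule real_tendsto_sandwich[of "\<lambda>i. y - \<beta> * (1/2) ^ i" _ _ "\<lambda>_. y"])
      have "y - \<beta> * (1/2) ^ i \<le> x i \<and> x i \<le> y" for i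
      proof -
        define t where "t = 2 ^ i * (y / \<beta>)"
        define c where "c = \<beta> * (1/2) ^ i"
        have "0 < c" "t * c = y" "x i = of_int \<lfloor>t\<rfloor> * c"
          using \<open>0 < \<beta>\<close> fl[of i] by (simp_all add: c_def t_def x_def power_divide)
        moreover have "(t - 1) * c \<le> of_int \<lfloor>t\<rfloor> * c" "of_int \<lfloor>t\<rfloor> * c \<le> t * c"
          using \<open>0 < c\<close> by (intro mult_right_mono; linarith)+
        ultimately show ?thesis
          by (simp add: c_def left_diff_distrib)
      qed
      then show "\<forall>\<^sub>F i in sequentially. y - \<beta> * (1/2) ^ i \<le> x i" "\<forall>\<^sub>F i in sequentially. x i \<le> y"
        by auto
      show "(\<lambda>i. y - \<beta> * (1/2) ^ i) \<longlonglongrightarrow> y"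
        using tendsto_diff[OF tendsto_const[of y] tendsto_mult[OF tendsto_const[of \<beta>] LIMSEQ_realpow_zero[of "1/2"]]] by simp
    qed simp
    have "(\<lambda>i. g (x i)) \<longlonglongrightarrow> g y"
      using continuous_on_tendsto_compose[OF cont x_lim y] D_sub[OF xD] by simp
    moreover have "(\<lambda>i. \<integral>l. basic_rp \<beta> l (x i) \<partial>M') \<longlonglongrightarrow> (\<integral>l. basic_rp \<beta> l y \<partial>M')"
    proof (rule integral_dominated_convergence[where w = "\<lambda>_. 1"])
      have "continuous_on UNIV (basic_rp \<beta> l)" for l
        by (intro continuous_intros)
      then have "isCont (basic_rp \<beta> l) y" for l
        by (simp add: continuous_on_eq_continuous_at)
      then show "AE l in M'. (\<lambda>i. basic_rp \<beta> l (x i)) \<longlonglongrightarrow> basic_rp \<beta> l y"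
        using x_lim by (auto intro: isCont_tendsto_compose)
      show "AE l in M'. norm (basic_rp \<beta> l (x i)) \<le> 1" for i
        using abs_basic_rp_le_1 D_sub[OF xD] by auto
    qed auto
    ultimately show "g y = (\<integral>l. basic_rp \<beta> l y \<partial>M')"
      using eq_D[OF xD] by (auto intro: LIMSEQ_unique)
  qed
qed

text \<open>
  The end points \<open>0\<close> and \<open>\<beta> / 2\<close> are needed for the grid and are reached by moving all points slightly
  towards \<open>\<beta> / 4\<close>, which keeps them distinct.
\<close>
lemma pd_kernel_on_closed_half:
  fixes \<phi> :: "real \<Rightarrow> complex" and s :: "nat \<Rightarrow> real"
  assumes "0 < \<beta>" and cont: "continuous_on {0..\<beta>} \<phi>"
    and pd: "pd_kernel {0<..<\<beta>/2} (\<lambda>s t. \<phi> (s + t))"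
    and I: "finite I" "inj_on s I" "s ` I \<subseteq> {0..\<beta>/2}"
  shows "(\<Sum>i\<in>I. \<Sum>j\<in>I. c i * cnj (c j) * \<phi> (s i + s j)) \<in> \<real>\<^sub>\<ge>\<^sub>0"
proof -
  define e where "e n = 1 / real (Suc (Suc n))" for n
  define x where "x n i = (1 - e n) * s i + e n * (\<beta> / 4)" for n i
  have e: "0 < e n" "e n < 1" for n
    by (auto simp: e_def)
  have "e \<longlonglongrightarrow> 0"
    unfolding e_def using LIMSEQ_Suc[OF LIMSEQ_inverse_real_of_nat] by (simp add: inverse_eq_divide)
  have x_in: "x n i \<in> {0<..<\<beta>/2}" if "i \<in> I" for n i
  proof -
    have "0 \<le> s i" "s i \<le> \<beta> / 2"
      using I(3) that by auto
    then have "0 \<le> (1 - e n) * s i" "(1 - e n) * s i \<le> (1 - e n) * (\<beta> / 2)"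
      using e[of n] by (auto intro!: mult_left_mono)
    moreover have "0 < e n * (\<beta> / 4)" "e n * (\<beta> / 4) < e n * (\<beta> / 2)"
      using e[of n] \<open>0 < \<beta>\<close> by auto
    ultimately show ?thesis
      by (auto simp: x_def algebra_simps)
  qed
  have inj: "inj_on (x n) I" for n
    using I(2) e[of n] by (auto simp: inj_on_def x_def)
  have x_lim: "(\<lambda>n. x n i) \<longlonglongrightarrow> s i" for i
    unfolding x_def using tendsto_add[OF tendsto_mult[OF tendsto_diff[OF tendsto_const[of 1] \<open>e \<longlonglongrightarrow> 0\<close>] tendsto_const[of "s i"]] tendsto_mult[OF \<open>e \<longlonglongrightarrow> 0\<close> tendsto_const[of "\<beta> / 4"]]]
    by simp
  have "(\<Sum>i\<in>I. \<Sum>j\<in>I. c i * cnj (c j) * \<phi> (x n i + x n j)) \<in> \<real>\<^sub>\<ge>\<^sub>0" for n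
  proof -
    define d where "d y = c (the_inv_into I (x n) y)" for y
    have d: "d (x n i) = c i" if "i \<in> I" for i
      using that inj[of n] by (simp add: d_def the_inv_into_f_f)
    have "(\<Sum>y\<in>x n ` I. \<Sum>z\<in>x n ` I. d y * cnj (d z) * \<phi> (y + z)) \<in> \<real>\<^sub>\<ge>\<^sub>0"
      using pd[unfolded pd_kernel_def, rule_format, of "x n ` I" d] I(1) x_in by blast
    also have "(\<Sum>y\<in>x n ` I. \<Sum>z\<in>x n ` I. d y * cnj (d z) * \<phi> (y + z)) = (\<Sum>i\<in>I. \<Sum>j\<in>I. c i * cnj (c j) * \<phi> (x n i + x n j))"
      using inj[of n] d by (simp add: sum.reindex cong: sum.cong)
    finally show ?thesis .
  qed
  moreover have "(\<lambda>n. \<Sum>i\<in>I. \<Sum>j\<in>I. c i * cnj (c j) * \<phi> (x n i + x n j)) \<longlonglongrightarrow> (\<Sum>i\<in>I. \<Sum>j\<in>I. c i * cnj (c j) * \<phi> (s i + s j))"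
  proof (intro tendsto_sum tendsto_mult tendsto_const continuous_on_tendsto_compose[OF cont] tendsto_add x_lim)
    fix i j assume "i \<in> I" "j \<in> I"
    then have "s i \<in> {0..\<beta>/2}" "s j \<in> {0..\<beta>/2}"
      using I(3) by blast+
    then show "s i + s j \<in> {0..\<beta>}"
      by simp
    show "\<forall>\<^sub>F n in sequentially. x n i + x n j \<in> {0..\<beta>}"
      using x_in[OF \<open>i \<in> I\<close>] x_in[OF \<open>j \<in> I\<close>] by (intro always_eventually) (simp add: less_imp_le add_nonneg_nonneg, smt (verit))
  qed
  ultimately show ?thesis
    by (rule closed_sequentially[OF closed_nonneg_Reals_complex])
qed

text \<open>
  This is a version of Widder's theorem on Laplace transforms for a bounded interval with a reflection
  symmetry. Evaluating the kernel at single points shows that \<open>\<phi>\<close> is real and nonnegative; if \<open>\<phi> 0 = 0\<close>,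
  the Cauchy-Schwarz argument forces \<open>\<phi> = 0\<close>, and otherwise \<open>\<phi>\<close> can be normalised.
\<close>
theorem reflection_positive_integral_representation:
  fixes \<phi> :: "real \<Rightarrow> complex"
  assumes "0 < \<beta>" and cont: "continuous_on {0..\<beta>} \<phi>"
    and sym: "\<And>y. y \<in> {0..\<beta>} \<Longrightarrow> \<phi> (\<beta> - y) = \<phi> y"
    and pd: "pd_kernel {0<..<\<beta>/2} (\<lambda>s t. \<phi> (s + t))"
  obtains \<mu> where "finite_measure \<mu>" "sets \<mu> = sets borel" "emeasure \<mu> {..<0} = 0"
    "\<And>y. y \<in> {0..\<beta>} \<Longrightarrow> \<phi> y = of_real (\<integral>l. basic_rp \<beta> l y \<partial>\<mu>)"
proof -
  note psd = pd_kernel_on_closed_half[OF \<open>0 < \<beta>\<close> cont pd]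
  have nonneg: "\<phi> y \<in> \<real>\<^sub>\<ge>\<^sub>0" if "y \<in> {0..\<beta>}" for y
    using psd[of "{0}" "\<lambda>_. y / 2" "\<lambda>_. 1"] that by simp
  define g where "g y = Re (\<phi> y)" for y
  have \<phi>: "\<phi> y = of_real (g y)" and g_nonneg: "0 \<le> g y" if "y \<in> {0..\<beta>}" for y
    using nonneg[OF that] by (auto simp: g_def complex_eq_iff elim!: nonneg_Reals_cases)
  have g_cont: "continuous_on {0..\<beta>} g"
    unfolding g_def by (intro continuous_intros cont)
  have g_sym: "g (\<beta> - y) = g y" if "y \<in> {0..\<beta>}" for y
    using sym[OF that] by (simp add: g_def)
  have g_psd: "0 \<le> (\<Sum>i\<le>n. \<Sum>j\<le>n. b i * b j * g (s i + s j))"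
    if "inj_on s {..n}" "s ` {..n} \<subseteq> {0..\<beta>/2}" for n :: nat and b s :: "nat \<Rightarrow> real"
  proof -
    have "(\<Sum>i\<le>n. \<Sum>j\<le>n. complex_of_real (b i) * cnj (of_real (b j)) * \<phi> (s i + s j)) \<in> \<real>\<^sub>\<ge>\<^sub>0"
      using that by (intro psd) auto
    also have "(\<Sum>i\<le>n. \<Sum>j\<le>n. complex_of_real (b i) * cnj (of_real (b j)) * \<phi> (s i + s j)) = of_real (\<Sum>i\<le>n. \<Sum>j\<le>n. b i * b j * g (s i + s j))"
    proof -
      have "s i + s j \<in> {0..\<beta>}" if "i \<le> n" "j \<le> n" for i j
      proof -
        have "s i \<in> {0..\<beta>/2}" "s j \<in> {0..\<beta>/2}"
          using that \<open>s ` {..n} \<subseteq> {0..\<beta>/2}\<close> by blast+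
        then show ?thesis
          by simp
      qed
      then show ?thesis
        by (simp add: \<phi>)
    qed
    finally show ?thesis
      by (simp only: nonneg_Reals_of_real_iff)
  qed
  show thesis
  proof (cases "g 0 = 0")
    case True
    have half: "g y = 0" if "y \<in> {0..\<beta>/2}" for y
    proof (cases "y = 0")
      case False
      \<comment> \<open>The kernel on the two points \<open>0\<close> and \<open>y\<close> has the form \<open>2 r g y + g (2 y) \<ge> 0\<close> for all real \<open>r\<close>.\<close>
      have "0 \<le> 2 * r * g y + g (2 * y)" for r
      proof -
        have "0 \<le> (\<Sum>i\<le>1::nat. \<Sum>j\<le>1::nat. (if i = 0 then r else 1) * (if j = 0 then r else 1) * g ((if i = 0 then 0 else y) + (if j = 0 then 0 else y)))"
          by (rule g_psd[of "\<lambda>i. if i = 0 then 0 else y" 1 "\<lambda>i. if i = 0 then r else 1"])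
            (use that False in \<open>auto simp: inj_on_def le_Suc_eq\<close>)
        then show ?thesis
          using True by (simp add: algebra_simps)
      qed
      from this[of "- (g (2 * y) + 1) / (2 * g y)"] show "g y = 0"
        by (cases "g y = 0") (auto simp: field_simps)
    qed (use True in simp)
    have "g y = 0" if "y \<in> {0..\<beta>}" for y
      using half[of y] half[of "\<beta> - y"] g_sym[OF that] that by (cases "y \<le> \<beta> / 2") auto
    then show thesis
      by (intro that[of "null_measure borel"]) (auto simp: \<phi> integral_null_measure intro!: finite_measureI)
  next
    case False
    with g_nonneg[of 0] \<open>0 < \<beta>\<close> have "0 < g 0"
      by simp
    obtain M where M: "real_distribution M" "\<And>y. y \<in> {0..\<beta>} \<Longrightarrow> g y / g 0 = (\<integral>l. basic_rp \<beta> l y \<partial>M)"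
    proof (rule normalised_mixture[OF \<open>0 < \<beta>\<close>, of "\<lambda>y. g y / g 0"])
      show "0 \<le> (\<Sum>i\<le>n. \<Sum>j\<le>n. b i * b j * (g (s i + s j) / g 0))"
        if "inj_on s {..n}" "s ` {..n} \<subseteq> {0..\<beta>/2}" for n :: nat and b s :: "nat \<Rightarrow> real"
        using g_psd[OF that, of b] \<open>0 < g 0\<close> by (simp flip: sum_divide_distrib add: times_divide_eq_right)
    qed (use \<open>0 < g 0\<close> g_sym in \<open>auto intro!: continuous_intros g_cont\<close>)
    interpret real_distribution M by fact
    define \<mu> where "\<mu> = density (distr M borel abs) (\<lambda>_. ennreal (g 0))"
    have "finite_measure \<mu>"
      by (intro finite_measureI) (simp add: \<mu>_def emeasure_density emeasure_distr nn_integral_cmult ennreal_mult_eq_top_iff emeasure_eq_measure)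
    moreover have "sets \<mu> = sets borel"
      by (simp add: \<mu>_def)
    moreover have "emeasure \<mu> {..<0} = 0"
    proof -
      have "abs -` {..<0} = ({} :: real set)"
        by auto
      then show ?thesis
        by (simp add: \<mu>_def emeasure_density emeasure_distr nn_integral_cmult)
    qed
    moreover have "\<phi> y = of_real (\<integral>l. basic_rp \<beta> l y \<partial>\<mu>)" if "y \<in> {0..\<beta>}" for y
    proof -
      have "(\<integral>l. basic_rp \<beta> l y \<partial>\<mu>) = g 0 * (\<integral>l. basic_rp \<beta> l y \<partial>M)"
        using \<open>0 < g 0\<close> by (simp add: \<mu>_def integral_density integral_distr)
      also have "\<dots> = g y"
        using M(2)[OF that] \<open>0 < g 0\<close> by (simp add: field_simps)
      finally show ?thesis
        using \<phi>[OF that] by simp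
    qed
    ultimately show thesis
      by (rule that)
  qed
qed

section \<open>Fourier transforms on a strip\<close>

lemma norm_fourier_kernel: "norm (exp (\<i> * z * complex_of_real l)) = exp (- Im z * l)"
  by (simp add: norm_exp_eq_Re)

lemma exp_interpolation_le:
  fixes a b y l :: real
  assumes "a \<le> y" "y \<le> b"
  shows "exp (- y * l) \<le> exp (- a * l) + exp (- b * l)"
proof (cases "0 \<le> l")
  case True
  then have "exp (- y * l) \<le> exp (- a * l)"
    using assms by (simp add: mult_right_mono)
  then show ?thesis
    by (simp add: add_increasing2)
next
  case False
  then have "exp (- y * l) \<le> exp (- b * l)"
    using assms by (simp add: mult_right_mono_neg)
  then show ?thesis
    by (simp add: add_increasing)
qed

context
  fixes \<nu> :: "real measure" and a b :: real
  assumes sets_\<nu> [measurable_cong]: "sets \<nu> = sets borel"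
    and int_a: "integrable \<nu> (\<lambda>l. exp (- a * l))"
    and int_b: "integrable \<nu> (\<lambda>l. exp (- b * l))"
begin

lemma integrable_fourier_kernel:
  assumes "a \<le> Im z" "Im z \<le> b"
  shows "integrable \<nu> (\<lambda>l. exp (\<i> * z * complex_of_real l))"
proof (rule Bochner_Integration.integrable_bound)
  show "integrable \<nu> (\<lambda>l. exp (- a * l) + exp (- b * l))"
    by (intro Bochner_Integration.integrable_add int_a int_b)
  show "AE l in \<nu>. norm (exp (\<i> * z * complex_of_real l)) \<le> norm (exp (- a * l) + exp (- b * l))"
    using exp_interpolation_le[OF assms] by (auto simp: norm_fourier_kernel)
qed measurable

lemma continuous_on_fourier: "continuous_on {z. a \<le> Im z \<and> Im z \<le> b} (fourier \<nu>)"
  unfolding continuous_on_sequentially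
proof safe
  fix X z assume X: "\<forall>n. X n \<in> {z. a \<le> Im z \<and> Im z \<le> b}" "X \<longlonglongrightarrow> z" and z: "a \<le> Im z" "Im z \<le> b"
  have "(\<lambda>n. fourier \<nu> (X n)) \<longlonglongrightarrow> fourier \<nu> z"
    unfolding fourier_def
  proof (rule integral_dominated_convergence[where w = "\<lambda>l. exp (- a * l) + exp (- b * l)"])
    show "integrable \<nu> (\<lambda>l. exp (- a * l) + exp (- b * l))"
      by (intro Bochner_Integration.integrable_add int_a int_b)
    show "AE l in \<nu>. (\<lambda>n. exp (\<i> * X n * complex_of_real l)) \<longlonglongrightarrow> exp (\<i> * z * complex_of_real l)"
      by (intro AE_I2 tendsto_intros X)
    show "AE l in \<nu>. norm (exp (\<i> * X n * complex_of_real l)) \<le> exp (- a * l) + exp (- b * l)" for n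
      unfolding norm_fourier_kernel using X(1) by (intro AE_I2 exp_interpolation_le) auto
  qed measurable
  then show "(fourier \<nu> \<circ> X) \<longlonglongrightarrow> fourier \<nu> z"
    by (simp add: comp_def)
qed

text \<open>
  The majorant for differentiating under the integral: the factor \<open>\<bar>l\<bar>\<close> and the increment of the
  exponent are absorbed by the margin \<open>2 \<delta>\<close> to the boundary of the strip.
\<close>
lemma fourier_kernel_difference_bound:
  fixes h z :: complex and l :: real
  assumes "0 < \<delta>" "norm h < \<delta>" "h \<noteq> 0" "a + 2 * \<delta> \<le> Im z" "Im z + 2 * \<delta> \<le> b"
  shows "norm ((exp (\<i> * (z + h) * of_real l) - exp (\<i> * z * of_real l)) / h) \<le> 2 / \<delta> * (exp (- a * l) + exp (- b * l))"
proof -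
  define y where "y = Im z"
  have "norm (exp (\<i> * h * of_real l) - 1) \<le> exp (norm (\<i> * h * of_real l)) * norm (\<i> * h * of_real l)"
    using Taylor_exp_field[of "\<i> * h * of_real l" 0] by simp
  also have "\<dots> \<le> exp (\<delta> * \<bar>l\<bar>) * (norm h * \<bar>l\<bar>)"
    using assms by (intro mult_mono) (auto simp: norm_mult intro!: mult_right_mono)
  finally have *: "norm (exp (\<i> * h * of_real l) - 1) / norm h \<le> exp (\<delta> * \<bar>l\<bar>) * \<bar>l\<bar>"
    using assms by (simp add: divide_le_eq mult_ac)
  have "norm ((exp (\<i> * (z + h) * of_real l) - exp (\<i> * z * of_real l)) / h)
      = norm (exp (\<i> * z * of_real l) * (exp (\<i> * h * of_real l) - 1)) / norm h"
    by (simp add: norm_divide algebra_simps exp_add)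
  also have "\<dots> = exp (- y * l) * (norm (exp (\<i> * h * of_real l) - 1) / norm h)"
    by (simp only: norm_mult norm_fourier_kernel y_def times_divide_eq_right)
  also have "\<dots> \<le> exp (- y * l) * (exp (\<delta> * \<bar>l\<bar>) * \<bar>l\<bar>)"
    using * by (intro mult_left_mono) auto
  also have "\<dots> \<le> exp (- y * l) * (exp (\<delta> * \<bar>l\<bar>) * (exp (\<delta> * \<bar>l\<bar>) / \<delta>))"
  proof -
    have "\<bar>l\<bar> \<le> exp (\<delta> * \<bar>l\<bar>) / \<delta>"
      using exp_ge_add_one_self[of "\<delta> * \<bar>l\<bar>"] unfolding pos_le_divide_eq[OF \<open>0 < \<delta>\<close>]
      by (subst mult.commute) linarith
    then show ?thesis
      by (intro mult_left_mono) auto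
  qed
  also have "\<dots> = exp (- y * l + 2 * \<delta> * \<bar>l\<bar>) / \<delta>"
    by (simp flip: exp_add)
  also have "\<dots> \<le> 2 * (exp (- a * l) + exp (- b * l)) / \<delta>"
  proof (rule divide_right_mono)
    have "exp (- y * l + 2 * \<delta> * \<bar>l\<bar>) \<le> exp (- (y - 2 * \<delta>) * l) + exp (- (y + 2 * \<delta>) * l)"
      by (cases "0 \<le> l") (auto simp: algebra_simps)
    also have "\<dots> \<le> (exp (- a * l) + exp (- b * l)) + (exp (- a * l) + exp (- b * l))"
      using assms by (intro add_mono exp_interpolation_le) (auto simp: y_def)
    finally show "exp (- y * l + 2 * \<delta> * \<bar>l\<bar>) \<le> 2 * (exp (- a * l) + exp (- b * l))"
      by simp
  qed (use \<open>0 < \<delta>\<close> in simp)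
  finally show ?thesis
    by simp
qed

lemma holomorphic_on_fourier: "fourier \<nu> holomorphic_on {z. a < Im z \<and> Im z < b}"
proof (rule holomorphic_onI)
  fix z assume z: "z \<in> {z. a < Im z \<and> Im z < b}"
  define \<delta> where "\<delta> = min (Im z - a) (b - Im z) / 2"
  have \<delta>: "0 < \<delta>" "a + 2 * \<delta> \<le> Im z" "Im z + 2 * \<delta> \<le> b"
    using z by (auto simp: \<delta>_def)
  define D where "D = (\<integral>l. \<i> * of_real l * exp (\<i> * z * complex_of_real l) \<partial>\<nu>)"
  have "((\<lambda>h. (fourier \<nu> (z + h) - fourier \<nu> z) / h) \<longlongrightarrow> D) (at 0)"
    unfolding tendsto_at_iff_sequentially
  proof (intro allI impI)
    fix X :: "nat \<Rightarrow> complex" assume X: "\<forall>i. X i \<in> UNIV - {0}" "X \<longlonglongrightarrow> 0"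
    from X(2) \<delta>(1) obtain N where N: "\<And>n. N \<le> n \<Longrightarrow> norm (X n) < \<delta>"
      unfolding LIMSEQ_iff by auto
    define Y where "Y n = X (n + N)" for n
    have Y: "norm (Y n) < \<delta>" "Y n \<noteq> 0" for n
      using X(1) N by (auto simp: Y_def)
    have Y0: "Y \<longlonglongrightarrow> 0"
      unfolding Y_def by (rule LIMSEQ_ignore_initial_segment[OF X(2)])
    have "(fourier \<nu> (z + Y n) - fourier \<nu> z) / Y n =
        (\<integral>l. (exp (\<i> * (z + Y n) * of_real l) - exp (\<i> * z * of_real l)) / Y n \<partial>\<nu>)" for n
    proof -
      have "\<bar>Im (Y n)\<bar> < \<delta>"
        using Y(1)[of n] abs_Im_le_cmod[of "Y n"] by linarith
      then have "integrable \<nu> (\<lambda>l. exp (\<i> * (z + Y n) * complex_of_real l))" "integrable \<nu> (\<lambda>l. exp (\<i> * z * complex_of_real l))"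
        using \<delta> by (auto intro!: integrable_fourier_kernel)
      then show ?thesis
        unfolding fourier_def by (simp del: exp_complex_eqI)
    qed
    moreover have "(\<lambda>n. \<integral>l. (exp (\<i> * (z + Y n) * of_real l) - exp (\<i> * z * of_real l)) / Y n \<partial>\<nu>) \<longlonglongrightarrow> D"
      unfolding D_def
    proof (rule integral_dominated_convergence[where w = "\<lambda>l. 2 / \<delta> * (exp (- a * l) + exp (- b * l))"])
      show "integrable \<nu> (\<lambda>l. 2 / \<delta> * (exp (- a * l) + exp (- b * l)))"
        by (intro integrable_mult_right Bochner_Integration.integrable_add int_a int_b)
      show "AE l in \<nu>. norm ((exp (\<i> * (z + Y n) * of_real l) - exp (\<i> * z * of_real l)) / Y n) \<le> 2 / \<delta> * (exp (- a * l) + exp (- b * l))" for n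
        using Y \<delta> by (intro AE_I2 fourier_kernel_difference_bound) auto
      have "((\<lambda>w. exp (\<i> * w * complex_of_real l)) has_field_derivative \<i> * of_real l * exp (\<i> * z * complex_of_real l)) (at z)" for l
        by (auto intro!: derivative_eq_intros)
      then have "((\<lambda>h. (exp (\<i> * (z + h) * complex_of_real l) - exp (\<i> * z * complex_of_real l)) / h) \<longlongrightarrow> \<i> * of_real l * exp (\<i> * z * complex_of_real l)) (at 0)" for l
        unfolding DERIV_def .
      moreover have "filterlim Y (at 0) sequentially"
        using Y0 Y(2) by (simp add: filterlim_at)
      ultimately show "AE l in \<nu>. (\<lambda>n. (exp (\<i> * (z + Y n) * of_real l) - exp (\<i> * z * of_real l)) / Y n) \<longlonglongrightarrow> \<i> * of_real l * exp (\<i> * z * complex_of_real l)"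
        by (intro AE_I2) (rule filterlim_compose)
    qed measurable
    ultimately have "(\<lambda>n. (fourier \<nu> (z + Y n) - fourier \<nu> z) / Y n) \<longlonglongrightarrow> D"
      by (simp only:)
    then show "((\<lambda>h. (fourier \<nu> (z + h) - fourier \<nu> z) / h) \<circ> X) \<longlonglongrightarrow> D"
      unfolding Y_def comp_def by (rule LIMSEQ_offset)
  qed
  then have "(fourier \<nu> has_field_derivative D) (at z)"
    by (simp add: DERIV_def)
  then show "fourier \<nu> field_differentiable at z within {z. a < Im z \<and> Im z < b}"
    using field_differentiable_at_within field_differentiable_def by blast
qed

end

lemma open_strip: "open {z. a < Im z \<and> Im z < b}"
  by (simp add: open_Collect_conj open_halfspace_Im_gt open_halfspace_Im_lt)

lemma closure_strip:
  assumes "0 < \<beta>"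
  shows "closure (strip \<beta>) = {z. 0 \<le> Im z \<and> Im z \<le> \<beta>}"
proof
  have "closed {z. 0 \<le> Im z \<and> Im z \<le> \<beta>}"
    by (simp add: closed_Collect_conj closed_halfspace_Im_ge closed_halfspace_Im_le)
  then show "closure (strip \<beta>) \<subseteq> {z. 0 \<le> Im z \<and> Im z \<le> \<beta>}"
    by (intro closure_minimal) (auto simp: strip_def)
  show "{z. 0 \<le> Im z \<and> Im z \<le> \<beta>} \<subseteq> closure (strip \<beta>)"
  proof
    fix z assume z: "z \<in> {z. 0 \<le> Im z \<and> Im z \<le> \<beta>}"
    define e where "e n = 1 / real (Suc (Suc n))" for n
    have e: "0 < e n" "e n < 1" for n
      by (auto simp: e_def)
    have "e \<longlonglongrightarrow> 0"
      unfolding e_def using LIMSEQ_Suc[OF LIMSEQ_inverse_real_of_nat] by (simp add: inverse_eq_divide)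
    define x where "x n = Complex (Re z) ((1 - e n) * Im z + e n * (\<beta> / 2))" for n
    have "(\<lambda>n. (1 - e n) * Im z + e n * (\<beta> / 2)) \<longlonglongrightarrow> (1 - 0) * Im z + 0 * (\<beta> / 2)"
      by (intro tendsto_intros \<open>e \<longlonglongrightarrow> 0\<close>)
    then have "x \<longlonglongrightarrow> Complex (Re z) (Im z)"
      unfolding x_def by (intro tendsto_Complex tendsto_const) simp
    then have "x \<longlonglongrightarrow> z"
      by simp
    moreover have "x n \<in> strip \<beta>" for n
    proof -
      have "0 \<le> (1 - e n) * Im z" "(1 - e n) * Im z \<le> (1 - e n) * \<beta>"
        using e[of n] z by (auto intro!: mult_left_mono)
      moreover have "0 < e n * (\<beta> / 2)" "e n * (\<beta> / 2) < e n * \<beta>"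
        using e[of n] \<open>0 < \<beta>\<close> by auto
      ultimately show ?thesis
        by (auto simp: x_def strip_def algebra_simps)
    qed
    ultimately show "z \<in> closure (strip \<beta>)"
      unfolding closure_sequential by blast
  qed
qed

lemma strip_eq: "strip \<beta> = {z. 0 < Im z \<and> Im z < \<beta>}"
  by (simp add: strip_def)

lemma convex_strip: "convex {z. a < Im z \<and> Im z < b}"
  by (simp add: convex_Int convex_halfspace_Im_gt convex_halfspace_Im_lt Collect_conj_eq)

lemma strip_identity_vertical:
  assumes "0 < \<beta>"
    and F: "continuous_on (closure (strip \<beta>)) F" "F holomorphic_on strip \<beta>"
    and G: "continuous_on (closure (strip \<beta>)) G" "G holomorphic_on strip \<beta>"
    and eq: "\<And>y. 0 < y \<Longrightarrow> y < \<beta> \<Longrightarrow> F (\<i> * of_real y) = G (\<i> * of_real y)"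
    and z: "z \<in> closure (strip \<beta>)"
  shows "F z = G z"
proof -
  define U where "U = (\<lambda>y. \<i> * complex_of_real y) ` {0<..<\<beta>}"
  have zero: "F w - G w = 0" if "w \<in> strip \<beta>" for w
  proof (rule analytic_continuation[of "\<lambda>w. F w - G w" "strip \<beta>" U "\<i> * of_real (\<beta> / 2)"])
    show "open (strip \<beta>)" "connected (strip \<beta>)"
      unfolding strip_def using open_strip convex_strip by (auto intro: convex_connected)
    show "U \<subseteq> strip \<beta>" "\<i> * of_real (\<beta> / 2) \<in> strip \<beta>"
      using \<open>0 < \<beta>\<close> by (auto simp: U_def strip_def)
    have "(\<beta> / 2) islimpt {0<..<\<beta>}"
      using \<open>0 < \<beta>\<close> by (simp add: islimpt_greaterThanLessThan1 open_imp_islimpt)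
    then obtain f where f: "\<And>n. f n \<in> {0<..<\<beta>} - {\<beta> / 2}" "f \<longlonglongrightarrow> \<beta> / 2"
      unfolding islimpt_sequential by blast
    have "(\<lambda>n. \<i> * complex_of_real (f n)) \<longlonglongrightarrow> \<i> * of_real (\<beta> / 2)"
      by (intro tendsto_intros f)
    moreover have "\<i> * complex_of_real (f n) \<in> U - {\<i> * of_real (\<beta> / 2)}" for n
      using f(1)[of n] unfolding U_def by (auto simp del: of_real_divide)
    ultimately show "\<i> * of_real (\<beta> / 2) islimpt U"
      unfolding islimpt_sequential by (intro exI[of _ "\<lambda>n. \<i> * complex_of_real (f n)"] conjI allI)
    show "(\<lambda>w. F w - G w) holomorphic_on strip \<beta>"
      using F G by (intro holomorphic_intros)
    show "F w - G w = 0" if "w \<in> U" for w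
      using that eq by (auto simp: U_def)
  qed (fact that)
  have "F z - G z = 0"
    by (rule continuous_constant_on_closure[of "strip \<beta>" "\<lambda>w. F w - G w", OF _ zero z])
      (use F G in \<open>auto intro!: continuous_intros\<close>)
  then show ?thesis
    by auto
qed

text \<open>
  Painleve's gluing principle for the real line.
\<close>
lemma holomorphic_paste_real_line:
  assumes "open S"
    and F: "continuous_on {z \<in> S. 0 \<le> Im z} F" "F holomorphic_on {z \<in> S. 0 < Im z}"
    and G: "continuous_on {z \<in> S. Im z \<le> 0} G" "G holomorphic_on {z \<in> S. Im z < 0}"
    and eq: "\<And>z. z \<in> S \<Longrightarrow> Im z = 0 \<Longrightarrow> G z = F z"
  shows "(\<lambda>z. if Im z \<le> 0 then G z else F z) holomorphic_on S" (is "?H holomorphic_on S")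
proof (rule holomorphic_on_paste_across_line[of S \<i> _ 0])
  show "continuous_on S ?H"
    by (rule continuous_on_cases_le[OF G(1) F(1)]) (auto intro!: continuous_intros eq)
  have "?H holomorphic_on {z \<in> S. Im z < 0}" "?H holomorphic_on {z \<in> S. 0 < Im z}"
    using G(2) F(2) by (auto elim: holomorphic_transform)
  then show "?H holomorphic_on S \<inter> {z. \<i> \<bullet> z < 0}" "?H holomorphic_on S \<inter> {z. 0 < \<i> \<bullet> z}"
    by (simp_all add: inner_complex_def Int_def)
qed (use \<open>open S\<close> in auto)

text \<open>
  The difference vanishes on the real line, so it can be glued to the zero function below; the
  result is holomorphic and vanishes on an open set.
\<close>
lemma strip_identity_real_line:
  assumes "0 < \<beta>"
    and F: "continuous_on (closure (strip \<beta>)) F" "F holomorphic_on strip \<beta>"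
    and G: "continuous_on (closure (strip \<beta>)) G" "G holomorphic_on strip \<beta>"
    and eq: "\<And>t. F (of_real t) = G (of_real t)"
    and z: "z \<in> closure (strip \<beta>)"
  shows "F z = G z"
proof (rule strip_identity_vertical[OF \<open>0 < \<beta>\<close> F G _ z])
  fix y assume y: "0 < y" "y < \<beta>"
  define S where "S = {z. - 1 < Im z \<and> Im z < \<beta>}"
  define H where "H z = (if Im z \<le> 0 then 0 else F z - G z)" for z
  have sub: "{z \<in> S. 0 \<le> Im z} \<subseteq> closure (strip \<beta>)" "{z \<in> S. 0 < Im z} \<subseteq> strip \<beta>"
    unfolding closure_strip[OF \<open>0 < \<beta>\<close>] by (auto simp: S_def strip_def)
  have holo: "H holomorphic_on S"
    unfolding H_def
  proof (rule holomorphic_paste_real_line)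
    show "open S"
      unfolding S_def by (rule open_strip)
    show "continuous_on {z \<in> S. 0 \<le> Im z} (\<lambda>z. F z - G z)"
      using F G sub by (intro continuous_intros) (auto intro: continuous_on_subset)
    show "(\<lambda>z. F z - G z) holomorphic_on {z \<in> S. 0 < Im z}"
      using F G sub by (intro holomorphic_intros) (auto intro: holomorphic_on_subset)
    show "0 = F z - G z" if "Im z = 0" for z
      using eq[of "Re z"] that by (metis complex_is_Real_iff diff_self of_real_Re)
  qed auto
  have "H (\<i> * of_real y) = 0"
  proof (rule analytic_continuation_open[of "{z. - 1 < Im z \<and> Im z < 0}" S H "\<lambda>_. 0"])
    show "connected S"
      unfolding S_def by (intro convex_connected convex_strip)
    have "- \<i> / 2 \<in> {z. - 1 < Im z \<and> Im z < 0}"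
      by simp
    then show "{z. - 1 < Im z \<and> Im z < 0} \<noteq> {}"
      by blast
  qed (use \<open>0 < \<beta>\<close> y holo open_strip in \<open>auto simp: S_def H_def\<close>)
  then show "F (\<i> * of_real y) = G (\<i> * of_real y)"
    using y by (simp add: H_def)
qed

section \<open>Analytic continuation of Fourier transforms of positive measures\<close>

text \<open>
  Landau's theorem on the singularity of Laplace transforms of positive measures, in the form needed
  here. For \<open>l \<le> 0\<close> expand \<open>e\<^sup>i\<^sup>z\<^sup>l\<close> in powers of \<open>w = z + \<i>\<close>; integrated termwise this is the Taylor series of
  \<open>H\<close> at \<open>- \<i>\<close>, which converges in the larger disc. At \<open>z = \<i> y\<close> all its terms are integrals of
  nonnegative functions, so monotone convergence turns the sum of the series into the integral of \<open>e\<^sup>-\<^sup>y\<^sup>l\<close>.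
\<close>
lemma laplace_transform_converges_in_disc:
  fixes \<nu> :: "real measure" and H :: "complex \<Rightarrow> complex"
  assumes fin: "finite_measure \<nu>" and sets_\<nu> [measurable_cong]: "sets \<nu> = sets borel"
    and supp: "AE l in \<nu>. l \<le> 0"
    and H: "H holomorphic_on ball (- \<i>) (1 + \<beta>)"
    and H_eq: "\<And>z. z \<in> ball (- \<i>) 1 \<Longrightarrow> H z = fourier \<nu> z"
    and y: "0 \<le> y" "y < \<beta>"
  shows "integrable \<nu> (\<lambda>l. exp (- y * l))"
proof -
  interpret finite_measure \<nu> by fact
  define c where "c n l = (\<i> * of_real l) ^ n / fact n * of_real (exp l)" for n :: nat and l :: real
  have norm_c: "norm (c n l) = (- l) ^ n / fact n * exp l" if "l \<le> 0" for n l
    using that by (simp add: c_def norm_mult norm_divide norm_power)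
  have c_bound: "norm (c n l) \<le> 1" if "l \<le> 0" for n l
  proof -
    have sums: "(\<lambda>k. (- l) ^ k / fact k) sums exp (- l)"
      using exp_converges[of "- l"] by (simp add: divide_inverse mult.commute)
    have "(\<Sum>k\<in>{n}. (- l) ^ k / fact k) \<le> (\<Sum>k. (- l) ^ k / fact k)"
      using that by (intro sum_le_suminf sums_summable[OF sums]) auto
    then have "(- l) ^ n / fact n \<le> exp (- l)"
      by (simp flip: sums_unique[OF sums])
    then have "(- l) ^ n / fact n * exp l \<le> exp (- l) * exp l"
      by (intro mult_right_mono) auto
    then show ?thesis
      using that by (simp add: norm_c exp_minus)
  qed
  define a where "a n = (\<integral>l. c n l \<partial>\<nu>)" for n
  have meas [measurable]: "c n \<in> borel_measurable borel" for n
    unfolding c_def by measurable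
  have int_c: "integrable \<nu> (c n)" for n
    by (rule integrable_const_bound[of _ 1]) (use supp c_bound in \<open>auto elim: eventually_mono\<close>)
  have c_sums: "(\<lambda>n. c n l * w ^ n) sums exp (\<i> * (- \<i> + w) * of_real l)" for l w
  proof -
    have "(\<lambda>n. (\<i> * of_real l * w) ^ n /\<^sub>R fact n * of_real (exp l)) sums (exp (\<i> * of_real l * w) * of_real (exp l))"
      by (intro sums_mult2 exp_converges)
    also have "(\<lambda>n. (\<i> * of_real l * w) ^ n /\<^sub>R fact n * of_real (exp l)) = (\<lambda>n. c n l * w ^ n)"
      by (simp add: c_def fun_eq_iff power_mult_distrib scaleR_conv_of_real divide_inverse mult_ac)
    also have "exp (\<i> * of_real l * w) * of_real (exp l) = exp (\<i> * (- \<i> + w) * of_real l)"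
      by (simp add: algebra_simps flip: exp_of_real exp_add)
    finally show ?thesis .
  qed
  have norm_c_sums: "(\<lambda>n. norm (c n l) * r ^ n) sums exp ((1 - r) * l)" if "l \<le> 0" "0 \<le> r" for l r
  proof -
    have "(\<lambda>n. (- l * r) ^ n /\<^sub>R fact n * exp l) sums (exp (- l * r) * exp l)"
      by (intro sums_mult2 exp_converges)
    also have "(\<lambda>n. (- l * r) ^ n /\<^sub>R fact n * exp l) = (\<lambda>n. norm (c n l) * r ^ n)"
      using that by (intro ext) (simp only: norm_c power_mult_distrib real_scaleR_def divide_inverse mult_ac)
    also have "exp (- l * r) * exp l = exp ((1 - r) * l)"
      by (simp add: algebra_simps flip: exp_add)
    finally show ?thesis .
  qed
  have series: "(\<lambda>n. a n * w ^ n) sums fourier \<nu> (- \<i> + w)" if "norm w < 1" for w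
  proof -
    have int: "integrable \<nu> (\<lambda>l. c n l * w ^ n)" for n
      by (intro integrable_mult_left int_c)
    have int_norm: "integrable \<nu> (\<lambda>l. exp ((1 - norm w) * l))"
      by (rule integrable_const_bound[of _ 1]) (use supp that in \<open>auto elim!: eventually_mono simp: mult_nonneg_nonpos\<close>)
    have norm_sums: "(\<lambda>n. norm (c n l * w ^ n)) sums exp ((1 - norm w) * l)" if "l \<le> 0" for l
      using norm_c_sums[OF that, of "norm w"] by (simp add: norm_mult norm_power)
    have "(\<lambda>n. \<integral>l. c n l * w ^ n \<partial>\<nu>) sums (\<integral>l. (\<Sum>n. c n l * w ^ n) \<partial>\<nu>)"
    proof (rule sums_integral[OF int])
      show "AE l in \<nu>. summable (\<lambda>n. norm (c n l * w ^ n))"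
        using supp by eventually_elim (use norm_sums sums_summable in blast)
      show "summable (\<lambda>n. \<integral>l. norm (c n l * w ^ n) \<partial>\<nu>)"
      proof (rule bounded_imp_summable[where B = "\<integral>l. exp ((1 - norm w) * l) \<partial>\<nu>"])
        fix n
        have "(\<Sum>k\<le>n. \<integral>l. norm (c k l * w ^ k) \<partial>\<nu>) = (\<integral>l. (\<Sum>k\<le>n. norm (c k l * w ^ k)) \<partial>\<nu>)"
          using int by simp
        also have "\<dots> \<le> (\<integral>l. exp ((1 - norm w) * l) \<partial>\<nu>)"
        proof (rule integral_mono_AE[OF _ int_norm])
          show "AE l in \<nu>. (\<Sum>k\<le>n. norm (c k l * w ^ k)) \<le> exp ((1 - norm w) * l)"
            using supp
          proof eventually_elim
            case (elim l)
            show ?case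
              unfolding sums_unique[OF norm_sums[OF elim]]
              using norm_sums[OF elim] by (intro sum_le_suminf) (auto simp: sums_iff)
          qed
        qed (use int in auto)
        finally show "(\<Sum>k\<le>n. \<integral>l. norm (c k l * w ^ k) \<partial>\<nu>) \<le> (\<integral>l. exp ((1 - norm w) * l) \<partial>\<nu>)" .
      qed simp
    qed
    then show ?thesis
      using int_c by (simp add: a_def fourier_def c_sums[THEN sums_unique, symmetric])
  qed
  define K where "K w = H (- \<i> + w)" for w
  have K_holo: "K holomorphic_on ball 0 (1 + \<beta>)"
    unfolding K_def
    by (rule holomorphic_on_compose_gen[OF _ H, unfolded comp_def])
      (auto intro!: holomorphic_intros simp: dist_norm)
  have "K has_fps_expansion Abs_fps a"
    unfolding has_fps_expansion_def
  proof
    have "norm (1 / 2 :: complex) \<le> conv_radius a"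
      using series[of "1 / 2"] by (intro conv_radius_geI) (simp add: sums_iff)
    then have "0 < conv_radius a"
      by (rule less_le_trans[rotated]) (simp add: zero_ereal_def)
    then show "0 < fps_conv_radius (Abs_fps a)"
      by (simp add: fps_conv_radius_def)
    have "eval_fps (Abs_fps a) w = K w" if "w \<in> ball 0 1" for w
      using series[of w] that H_eq[of "- \<i> + w"] by (simp add: eval_fps_def K_def sums_iff dist_norm)
    then show "\<forall>\<^sub>F w in nhds 0. eval_fps (Abs_fps a) w = K w"
      by (rule eventually_mono[OF eventually_nhds_in_open[of "ball 0 1" 0], rotated -1]) auto
  qed
  then have a: "a n = (deriv ^^ n) K 0 / fact n" for n
    using fps_nth_fps_expansion by fastforce
  define w where "w = \<i> * of_real (1 + y)"
  have "norm w = \<bar>1 + y\<bar>"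
    unfolding w_def by (simp only: norm_mult norm_ii norm_of_real mult_1 real_norm_def)
  then have w: "w \<in> ball 0 (1 + \<beta>)"
    using y by simp
  \<comment> \<open>On the imaginary axis all Taylor terms are nonnegative, so convergence of the series is
    convergence of the integral.\<close>
  define t where "t n = (\<integral>l. norm (c n l) * (1 + y) ^ n \<partial>\<nu>)" for n
  have "a n * w ^ n = of_real (t n)" for n
  proof -
    have "c n l * w ^ n = of_real (norm (c n l) * (1 + y) ^ n)" if "l \<le> 0" for l
    proof -
      have "(\<i> * complex_of_real l) ^ n * w ^ n = (of_real (- l * (1 + y))) ^ n"
        by (simp add: w_def algebra_simps flip: power_mult_distrib)
      then have "c n l * w ^ n = (of_real (- l * (1 + y))) ^ n / fact n * of_real (exp l)"
        by (simp add: c_def)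
      also have "\<dots> = of_real ((- l) ^ n * (1 + y) ^ n / fact n * exp l)"
        by (simp only: of_real_mult of_real_power of_real_divide of_real_fact power_mult_distrib)
      also have "(- l) ^ n * (1 + y) ^ n / fact n * exp l = norm (c n l) * (1 + y) ^ n"
        using that by (simp add: norm_c)
      finally show ?thesis .
    qed
    then have "(\<integral>l. c n l * w ^ n \<partial>\<nu>) = (\<integral>l. complex_of_real (norm (c n l) * (1 + y) ^ n) \<partial>\<nu>)"
      using supp by (intro integral_cong_AE) (auto elim: eventually_mono)
    then show ?thesis
      using int_c by (simp only: integral_complex_of_real t_def) (simp add: a_def)
  qed
  moreover have "summable (\<lambda>n. a n * w ^ n)"
    using holomorphic_power_series[OF K_holo w] by (simp add: a sums_iff)
  ultimately have t_summable: "summable t"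
    by (simp add: summable_complex_of_real)
  have t_nonneg: "0 \<le> t n" for n
    unfolding t_def using y by (intro integral_nonneg_AE) auto
  show ?thesis
  proof (rule integrableI_bounded)
    have "(\<integral>\<^sup>+l. ennreal (norm (exp (- y * l))) \<partial>\<nu>) = (\<integral>\<^sup>+l. (\<Sum>n. ennreal (norm (c n l) * (1 + y) ^ n)) \<partial>\<nu>)"
    proof (rule nn_integral_cong_AE)
      show "AE l in \<nu>. ennreal (norm (exp (- y * l))) = (\<Sum>n. ennreal (norm (c n l) * (1 + y) ^ n))"
        using supp
      proof eventually_elim
        case (elim l)
        have "(\<lambda>n. ennreal (norm (c n l) * (1 + y) ^ n)) sums ennreal (exp (- y * l))"
          using norm_c_sums[OF elim, of "1 + y"] y by (subst sums_ennreal) auto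
        then show ?case
          by (simp add: sums_iff)
      qed
    qed
    also have "\<dots> = (\<Sum>n. \<integral>\<^sup>+l. ennreal (norm (c n l) * (1 + y) ^ n) \<partial>\<nu>)"
      by (intro nn_integral_suminf) measurable
    also have "\<dots> = (\<Sum>n. ennreal (t n))"
      unfolding t_def using int_c y by (subst nn_integral_eq_integral) auto
    also have "\<dots> < \<infinity>"
      using t_summable t_nonneg by (simp add: ennreal_suminf_neq_top less_top[symmetric])
    finally show "(\<integral>\<^sup>+l. ennreal (norm (exp (- y * l))) \<partial>\<nu>) < \<infinity>" .
  qed measurable
qed

lemma integrable_exp_of_nonneg_support:
  fixes \<nu> :: "real measure"
  assumes "finite_measure \<nu>" and [measurable_cong]: "sets \<nu> = sets borel"
    and "AE l in \<nu>. 0 \<le> k * l"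
  shows "integrable \<nu> (\<lambda>l. exp (- k * l))"
proof -
  interpret finite_measure \<nu> by fact
  show ?thesis
    by (rule integrable_const_bound[of _ 1]) (use assms(3) in \<open>auto elim: eventually_mono\<close>)
qed

text \<open>
  Split \<open>\<nu>\<close> into its part \<open>P\<close> on \<open>l > 0\<close> and its part \<open>N\<close> on \<open>l \<le> 0\<close>. The transform of \<open>P\<close> is defined on
  the upper half-plane, so \<open>F\<close> minus this transform continues the transform of \<open>N\<close>, which lives on the
  lower half-plane, across the real line up to height \<open>\<beta>\<close>. Landau's theorem gives convergence for
  heights below \<open>\<beta>\<close>, and Fatou's lemma with the continuity of \<open>F\<close> at \<open>\<i> \<beta>\<close> gives it at \<open>\<beta>\<close>.
\<close>
theorem fourier_extension:
  fixes \<nu> :: "real measure"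
  assumes "0 < \<beta>" and fin: "finite_measure \<nu>" and sets_\<nu> [measurable_cong]: "sets \<nu> = sets borel"
    and F: "continuous_on (closure (strip \<beta>)) F" "F holomorphic_on strip \<beta>"
    and F_eq: "\<And>t. F (of_real t) = fourier \<nu> (of_real t)"
  shows integrable_exp_beta: "integrable \<nu> (\<lambda>l. exp (- \<beta> * l))"
    and "\<And>z. z \<in> closure (strip \<beta>) \<Longrightarrow> F z = fourier \<nu> z"
proof -
  interpret finite_measure \<nu> by fact
  define N where "N = density \<nu> (indicator {..0})"
  define P where "P = density \<nu> (indicator {0<..})"
  have sets [measurable_cong]: "sets N = sets borel" "sets P = sets borel"
    by (auto simp: N_def P_def sets_\<nu>)
  have fin_NP: "finite_measure N" "finite_measure P"
    unfolding N_def P_def by (auto intro!: finite_measureI simp: emeasure_density space_density sets_eq_imp_space_eq[OF sets_\<nu>])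
  have supp: "AE l in N. l \<le> 0" "AE l in P. 0 \<le> l"
    unfolding N_def P_def by (subst AE_density; auto simp: indicator_def)+
  have \<nu>_eq: "\<nu> = plus_measure N P"
  proof (rule measure_eqI)
    fix A assume "A \<in> sets \<nu>"
    then have [measurable]: "A \<in> sets borel"
      by (simp add: sets_\<nu>)
    have "emeasure N A = emeasure \<nu> ({..0} \<inter> A)" "emeasure P A = emeasure \<nu> ({0<..} \<inter> A)"
      unfolding N_def P_def by (simp_all add: emeasure_density flip: indicator_inter_arith)
    moreover have "emeasure \<nu> ({..0} \<inter> A) + emeasure \<nu> ({0<..} \<inter> A) = emeasure \<nu> (({..0} \<inter> A) \<union> ({0<..} \<inter> A))"
      by (intro plus_emeasure) auto
    moreover have "({..0} \<inter> A) \<union> ({0<..} \<inter> A) = A"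
      by auto
    ultimately show "emeasure \<nu> A = emeasure (plus_measure N P) A"
      by (simp add: emeasure_plus_measure sets)
  qed (simp add: sets sets_\<nu>)
  have sets_NP: "sets N = sets P"
    by (simp add: sets)
  have int_P: "integrable P (\<lambda>l. exp (- k * l))" if "0 \<le> k" for k
    by (rule integrable_exp_of_nonneg_support[OF fin_NP(2) sets(2)])
      (use supp(2) that in \<open>auto elim: eventually_mono\<close>)
  have int_N: "integrable N (\<lambda>l. exp (- k * l))" if "k \<le> 0" for k
    by (rule integrable_exp_of_nonneg_support[OF fin_NP(1) sets(1)])
      (use supp(1) that in \<open>auto elim!: eventually_mono intro: mult_nonpos_nonpos\<close>)
  note P_props = integrable_fourier_kernel[OF sets(2) int_P[of 0] int_P[of \<beta>]]
    continuous_on_fourier[OF sets(2) int_P[of 0] int_P[of \<beta>]]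
    holomorphic_on_fourier[OF sets(2) int_P[of 0] int_P[of \<beta>]]
  note N_props = integrable_fourier_kernel[OF sets(1) int_N[of "- (2 + \<beta>)"] int_N[of 0]]
    continuous_on_fourier[OF sets(1) int_N[of "- (2 + \<beta>)"] int_N[of 0]]
    holomorphic_on_fourier[OF sets(1) int_N[of "- (2 + \<beta>)"] int_N[of 0]]
  \<comment> \<open>The strip is chosen to contain the disc of radius \<open>1 + \<beta>\<close> about \<open>- \<i>\<close>.\<close>
  define S where "S = {z. - (2 + \<beta>) < Im z \<and> Im z < \<beta>}"
  define H where "H z = (if Im z \<le> 0 then fourier N z else F z - fourier P z)" for z
  have upper: "{z \<in> S. 0 \<le> Im z} \<subseteq> closure (strip \<beta>)" "{z \<in> S. 0 < Im z} \<subseteq> strip \<beta>"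
    unfolding closure_strip[OF \<open>0 < \<beta>\<close>] by (auto simp: S_def strip_def)
  have "H holomorphic_on S"
    unfolding H_def
  proof (rule holomorphic_paste_real_line)
    show "open S"
      unfolding S_def by (rule open_strip)
    show "continuous_on {z \<in> S. 0 \<le> Im z} (\<lambda>z. F z - fourier P z)"
      by (intro continuous_intros continuous_on_subset[OF F(1) upper(1)] continuous_on_subset[OF P_props(2)])
        (use \<open>0 < \<beta>\<close> in \<open>auto simp: S_def\<close>)
    show "(\<lambda>z. F z - fourier P z) holomorphic_on {z \<in> S. 0 < Im z}"
      by (intro holomorphic_intros holomorphic_on_subset[OF F(2) upper(2)] holomorphic_on_subset[OF P_props(3)])
        (use \<open>0 < \<beta>\<close> in \<open>auto simp: S_def\<close>)
    show "continuous_on {z \<in> S. Im z \<le> 0} (fourier N)"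
      by (rule continuous_on_subset[OF N_props(2)]) (use \<open>0 < \<beta>\<close> in \<open>auto simp: S_def\<close>)
    show "fourier N holomorphic_on {z \<in> S. Im z < 0}"
      by (rule holomorphic_on_subset[OF N_props(3)]) (use \<open>0 < \<beta>\<close> in \<open>auto simp: S_def\<close>)
    fix z :: complex assume "Im z = 0"
    then obtain t where z: "z = of_real t"
      by (metis complex_is_Real_iff Reals_cases)
    have "fourier \<nu> z = fourier N z + fourier P z"
      unfolding fourier_def \<nu>_eq using \<open>0 < \<beta>\<close> \<open>Im z = 0\<close>
      by (intro integral_plus_measure sets_NP N_props(1) P_props(1)) auto
    then show "fourier N z = F z - fourier P z"
      using F_eq[of t] by (simp add: z)
  qed
  moreover have "ball (- \<i>) (1 + \<beta>) \<subseteq> S"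
  proof
    fix z assume "z \<in> ball (- \<i>) (1 + \<beta>)"
    then have "\<bar>Im (- \<i> - z)\<bar> < 1 + \<beta>"
      using abs_Im_le_cmod[of "- \<i> - z"] by (simp only: mem_ball dist_norm)
    then show "z \<in> S"
      by (simp add: S_def abs_less_iff)
  qed
  ultimately have H_ball: "H holomorphic_on ball (- \<i>) (1 + \<beta>)"
    by (rule holomorphic_on_subset)
  have H_eq: "H z = fourier N z" if "z \<in> ball (- \<i>) 1" for z
  proof -
    have "\<bar>Im (- \<i> - z)\<bar> < 1"
      using that abs_Im_le_cmod[of "- \<i> - z"] by (simp only: mem_ball dist_norm)
    then show ?thesis
      by (simp add: H_def abs_less_iff)
  qed
  have int_\<nu>: "integrable \<nu> (\<lambda>l. exp (- y * l))" if "0 \<le> y" "y < \<beta>" for y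
    using laplace_transform_converges_in_disc[OF fin_NP(1) sets(1) supp(1) H_ball H_eq that] int_P[OF that(1)]
    unfolding \<nu>_eq integrable_plus_measure_iff[OF sets_NP] by blast
  have F_imag: "F (\<i> * of_real y) = of_real (\<integral>l. exp (- y * l) \<partial>\<nu>)" if "0 < y" "y < \<beta>" for y
  proof -
    have sub: "closure (strip y) \<subseteq> closure (strip \<beta>)" "strip y \<subseteq> strip \<beta>"
      using that by (auto simp: strip_def intro!: closure_mono)
    have "F (\<i> * of_real y) = fourier \<nu> (\<i> * of_real y)"
    proof (rule strip_identity_real_line[where F = F and G = "fourier \<nu>" and \<beta> = y])
      have "integrable \<nu> (\<lambda>l. exp (- 0 * l))" "integrable \<nu> (\<lambda>l. exp (- y * l))"
        using int_\<nu>[of 0] int_\<nu>[of y] that \<open>0 < \<beta>\<close> by simp_all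
      note * = continuous_on_fourier[OF sets_\<nu> this] holomorphic_on_fourier[OF sets_\<nu> this]
      show "continuous_on (closure (strip y)) (fourier \<nu>)" "fourier \<nu> holomorphic_on strip y"
        using *(1) by (simp add: closure_strip[OF \<open>0 < y\<close>]) (use *(2) in \<open>simp add: strip_eq\<close>)
      show "\<i> * of_real y \<in> closure (strip y)"
        using \<open>0 < y\<close> by (simp add: closure_strip)
    qed (use F F_eq sub \<open>0 < y\<close> in \<open>auto intro: continuous_on_subset holomorphic_on_subset\<close>)
    also have "\<dots> = of_real (\<integral>l. exp (- y * l) \<partial>\<nu>)"
      unfolding fourier_def by (simp flip: integral_complex_of_real exp_of_real add: mult.assoc[symmetric])
    finally show ?thesis .
  qed
  show int_\<beta>: "integrable \<nu> (\<lambda>l. exp (- \<beta> * l))"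
  proof (rule integrableI_bounded)
    define y where "y n = \<beta> * (1 - 1 / real (Suc (Suc n)))" for n
    have y: "0 < y n" "y n < \<beta>" for n
      using \<open>0 < \<beta>\<close> mult_strict_left_mono[of "1 - 1 / real (Suc (Suc n))" 1 \<beta>] by (simp_all add: y_def)
    have "(\<lambda>n. \<beta> * (1 - 1 / real (Suc (Suc n)))) \<longlonglongrightarrow> \<beta> * (1 - 0)"
      using LIMSEQ_Suc[OF LIMSEQ_inverse_real_of_nat] by (intro tendsto_intros) (simp add: inverse_eq_divide)
    then have y_lim: "y \<longlonglongrightarrow> \<beta>"
      by (simp add: y_def[abs_def])
    have F_lim: "(\<lambda>n. F (\<i> * of_real (y n))) \<longlonglongrightarrow> F (\<i> * of_real \<beta>)"
      using y \<open>0 < \<beta>\<close>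
      by (intro continuous_on_tendsto_compose[OF F(1)] tendsto_intros y_lim always_eventually)
        (auto simp: closure_strip less_imp_le)
    have "(\<integral>\<^sup>+l. ennreal (norm (exp (- \<beta> * l))) \<partial>\<nu>) = (\<integral>\<^sup>+l. liminf (\<lambda>n. ennreal (exp (- y n * l))) \<partial>\<nu>)"
    proof (intro nn_integral_cong)
      fix l
      have "(\<lambda>n. ennreal (exp (- y n * l))) \<longlonglongrightarrow> ennreal (exp (- \<beta> * l))"
        by (intro tendsto_ennrealI tendsto_intros y_lim)
      then show "ennreal (norm (exp (- \<beta> * l))) = liminf (\<lambda>n. ennreal (exp (- y n * l)))"
        by (simp only: lim_imp_Liminf[OF sequentially_bot] real_norm_def abs_exp_cancel)
    qed
    also have "\<dots> \<le> liminf (\<lambda>n. \<integral>\<^sup>+l. ennreal (exp (- y n * l)) \<partial>\<nu>)"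
      by (intro nn_integral_liminf) measurable
    also have "(\<lambda>n. \<integral>\<^sup>+l. ennreal (exp (- y n * l)) \<partial>\<nu>) = (\<lambda>n. ennreal (Re (F (\<i> * of_real (y n)))))"
      using y int_\<nu>[OF less_imp_le] by (subst nn_integral_eq_integral) (auto simp: F_imag)
    also have "liminf (\<lambda>n. ennreal (Re (F (\<i> * of_real (y n))))) = ennreal (Re (F (\<i> * of_real \<beta>)))"
      by (intro lim_imp_Liminf tendsto_ennrealI tendsto_Re F_lim) simp
    finally show "(\<integral>\<^sup>+l. ennreal (norm (exp (- \<beta> * l))) \<partial>\<nu>) < \<infinity>"
      by (simp add: le_less_trans)
  qed measurable
  have int_0: "integrable \<nu> (\<lambda>l. exp (- 0 * l))"
    by simp
  have "continuous_on (closure (strip \<beta>)) (fourier \<nu>)"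
    using continuous_on_fourier[OF sets_\<nu> int_0 int_\<beta>] by (simp add: closure_strip[OF \<open>0 < \<beta>\<close>])
  moreover have "fourier \<nu> holomorphic_on strip \<beta>"
    using holomorphic_on_fourier[OF sets_\<nu> int_0 int_\<beta>] by (simp add: strip_eq)
  ultimately show "F z = fourier \<nu> z" if "z \<in> closure (strip \<beta>)" for z
    using strip_identity_real_line[OF \<open>0 < \<beta>\<close> F _ _ F_eq that] by blast
qed

section \<open>Fourier inversion for damped positive definite functions\<close>

text \<open>
  Replace both arguments by values of a function \<open>D n\<close> with finite range. The double integral becomes
  a quadratic form of the kernel whose coefficients are the probabilities of these values, and
  \<open>D n\<close> converges pointwise to the identity.
\<close>
lemma pd_kernel_integral_nonneg:
  fixes K :: "real \<Rightarrow> real \<Rightarrow> complex"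
  assumes P: "real_distribution P"
    and pd: "pd_kernel UNIV K"
    and cont: "continuous_on UNIV (\<lambda>z. K (fst z) (snd z))"
    and bound: "\<And>x y. norm (K x y) \<le> B"
  shows "(\<integral>z. K (fst z) (snd z) \<partial>(P \<Otimes>\<^sub>M P)) \<in> \<real>\<^sub>\<ge>\<^sub>0"
proof -
  interpret real_distribution P by fact
  interpret PP: pair_prob_space P P ..
  have K_meas [measurable]: "(\<lambda>z. K (fst z) (snd z)) \<in> borel_measurable (borel \<Otimes>\<^sub>M borel)"
    using borel_measurable_continuous_onI[OF cont] by (simp add: borel_prod)
  \<comment> \<open>\<open>D n\<close> rounds down to multiples of \<open>1 / (n + 1)\<close> and truncates at \<open>\<plusminus> (n + 1)\<close>.\<close>
  define r where "r n x = max (- (int (Suc n))\<^sup>2) (min ((int (Suc n))\<^sup>2) \<lfloor>real (Suc n) * x\<rfloor>)" for n x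
  define R where "R n = {- (int (Suc n))\<^sup>2..(int (Suc n))\<^sup>2}" for n
  define D where "D n x = of_int (r n x) / real (Suc n)" for n x
  have r_R: "r n x \<in> R n" for n x
    by (auto simp: r_def R_def)
  have [measurable]: "r n \<in> measurable borel (count_space UNIV)" for n
    unfolding r_def by measurable
  have [measurable]: "D n \<in> borel_measurable borel" for n
    unfolding D_def by measurable
  have D_lim: "(\<lambda>n. D n x) \<longlonglongrightarrow> x" for x
  proof -
    have "(\<lambda>n. D n x - x) \<longlonglongrightarrow> 0"
    proof (rule Lim_null_comparison)
      obtain N where N: "\<bar>x\<bar> + 1 \<le> real N"
        using real_arch_simple by blast
      show "\<forall>\<^sub>F n in sequentially. norm (D n x - x) \<le> 1 / real (Suc n)"
        using eventually_ge_at_top[of N]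
      proof eventually_elim
        case (elim n)
        define m where "m = real (Suc n)"
        have m: "1 \<le> m" "\<bar>x\<bar> + 1 \<le> m"
          using N elim by (auto simp: m_def)
        have "\<bar>m * x\<bar> \<le> m * (m - 1)"
          using m unfolding abs_mult by (intro mult_mono) auto
        then have "\<bar>m * x\<bar> + 1 \<le> m\<^sup>2"
          using m by (simp add: power2_eq_square algebra_simps)
        then have "of_int \<lfloor>m * x\<rfloor> \<le> m\<^sup>2" "- m\<^sup>2 \<le> of_int \<lfloor>m * x\<rfloor>"
          by linarith+
        then have "\<lfloor>m * x\<rfloor> \<le> (int (Suc n))\<^sup>2" "- (int (Suc n))\<^sup>2 \<le> \<lfloor>m * x\<rfloor>"
          unfolding m_def by (metis of_int_le_iff of_int_of_nat_eq of_int_power, metis of_int_le_iff of_int_minus of_int_of_nat_eq of_int_power)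
        then have "D n x = of_int \<lfloor>m * x\<rfloor> / m"
          by (simp add: D_def r_def m_def)
        moreover have "of_int \<lfloor>m * x\<rfloor> / m - x = (of_int \<lfloor>m * x\<rfloor> - m * x) / m"
          using m by (simp add: field_simps)
        ultimately have "norm (D n x - x) = \<bar>of_int \<lfloor>m * x\<rfloor> - m * x\<bar> / m"
          using m by simp
        also have "\<dots> \<le> 1 / m"
          using m by (intro divide_right_mono; linarith)
        finally show ?case
          by (simp only: m_def)
      qed
      show "(\<lambda>n. 1 / real (Suc n)) \<longlonglongrightarrow> 0"
        using LIMSEQ_inverse_real_of_nat by (simp add: inverse_eq_divide)
    qed
    then show ?thesis
      by (rule LIM_zero_cancel)
  qed
  have "(\<integral>z. K (D n (fst z)) (D n (snd z)) \<partial>(P \<Otimes>\<^sub>M P)) \<in> \<real>\<^sub>\<ge>\<^sub>0" for n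
  proof -
    define q where "q a = a / real (Suc n)" for a :: real
    define A where "A a = r n -` {a}" for a
    have [measurable]: "A a \<in> sets borel" for a
      unfolding A_def using measurable_sets[of "r n" borel "count_space UNIV" "{a}"] by simp
    have "K (D n (fst z)) (D n (snd z)) = (\<Sum>a\<in>R n. \<Sum>b\<in>R n. indicat_real (A a \<times> A b) z *\<^sub>R K (q a) (q b))" for z
    proof -
      obtain x y where z: "z = (x, y)"
        by (cases z)
      have "(\<Sum>a\<in>R n. \<Sum>b\<in>R n. indicat_real (A a \<times> A b) z *\<^sub>R K (q a) (q b))
          = (\<Sum>a\<in>R n. if a = r n x then (\<Sum>b\<in>R n. if b = r n y then K (q a) (q b) else 0) else 0)"
        unfolding z by (intro sum.cong refl) (auto simp: A_def indicator_def intro!: sum.cong sum.neutral)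
      also have "\<dots> = K (D n x) (D n y)"
        using r_R by (simp add: D_def q_def R_def)
      finally show ?thesis
        by (simp add: z)
    qed
    then have "(\<integral>z. K (D n (fst z)) (D n (snd z)) \<partial>(P \<Otimes>\<^sub>M P))
        = (\<Sum>a\<in>R n. \<Sum>b\<in>R n. PP.prob (A a \<times> A b) *\<^sub>R K (q a) (q b))"
      by (simp add: PP.emeasure_eq_measure)
    also have "\<dots> = (\<Sum>a\<in>R n. \<Sum>b\<in>R n. complex_of_real (prob (A a)) * cnj (of_real (prob (A b))) * K (q a) (q b))"
      by (intro sum.cong refl) (simp add: measure_def emeasure_pair_measure_Times enn2real_mult scaleR_conv_of_real)
    also have "\<dots> = (\<Sum>x\<in>q ` of_int ` R n. \<Sum>y\<in>q ` of_int ` R n. complex_of_real (prob (A \<lfloor>x * Suc n\<rfloor>)) * cnj (of_real (prob (A \<lfloor>y * Suc n\<rfloor>))) * K x y)"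
    proof -
      have "inj_on (\<lambda>a::int. q (of_int a)) (R n)" "\<And>a::int. q (of_int a) * real (Suc n) = of_int a"
        by (auto simp: q_def inj_on_def)
      then show ?thesis
        by (simp add: image_image sum.reindex)
    qed
    also have "\<dots> \<in> \<real>\<^sub>\<ge>\<^sub>0"
      using pd[unfolded pd_kernel_def, rule_format, of "q ` of_int ` R n" "\<lambda>x. complex_of_real (prob (A \<lfloor>x * Suc n\<rfloor>))"]
      by (simp add: R_def)
    finally show ?thesis .
  qed
  moreover have "(\<lambda>n. \<integral>z. K (D n (fst z)) (D n (snd z)) \<partial>(P \<Otimes>\<^sub>M P)) \<longlonglongrightarrow> (\<integral>z. K (fst z) (snd z) \<partial>(P \<Otimes>\<^sub>M P))"
  proof (rule integral_dominated_convergence[where w = "\<lambda>_. B"])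
    show "AE z in P \<Otimes>\<^sub>M P. (\<lambda>n. K (D n (fst z)) (D n (snd z))) \<longlonglongrightarrow> K (fst z) (snd z)"
    proof (intro AE_I2)
      fix z :: "real \<times> real"
      have "(\<lambda>n. (D n (fst z), D n (snd z))) \<longlonglongrightarrow> z"
        using tendsto_Pair[OF D_lim D_lim, of "fst z" "snd z"] by simp
      then show "(\<lambda>n. K (D n (fst z)) (D n (snd z))) \<longlonglongrightarrow> K (fst z) (snd z)"
        using continuous_on_tendsto_compose[OF cont, of _ z] by fastforce
    qed
    have "(\<lambda>z. K (fst (D n (fst z), D n (snd z))) (snd (D n (fst z), D n (snd z)))) \<in> borel_measurable (borel \<Otimes>\<^sub>M borel)" for n
      by (rule measurable_compose[OF _ K_meas]) measurable
    then show "(\<lambda>z. K (D n (fst z)) (D n (snd z))) \<in> borel_measurable (P \<Otimes>\<^sub>M P)" for n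
      by simp
  qed (use bound in auto)
  ultimately show ?thesis
    by (rule closed_sequentially[OF closed_nonneg_Reals_complex])
qed

text \<open>
  Two independent normal variables have a normal difference; this turns a double integral of a function of
  \<open>x - y\<close> into a single one with a Gaussian weight.
\<close>
lemma difference_of_normals:
  fixes g :: "real \<Rightarrow> complex"
  assumes "0 < \<sigma>" and [measurable]: "g \<in> borel_measurable borel"
  defines "P \<equiv> density lborel (normal_density 0 \<sigma>)"
  shows "(\<integral>z. g (fst z - snd z) \<partial>(P \<Otimes>\<^sub>M P)) = (\<integral>t. normal_density 0 (sqrt (\<sigma>\<^sup>2 + \<sigma>\<^sup>2)) t *\<^sub>R g t \<partial>lborel)"
proof -
  interpret P: prob_space P
    unfolding P_def by (rule prob_space_normal_density) fact
  interpret PP: pair_prob_space P P ..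
  have [measurable_cong]: "sets P = sets borel"
    by (simp add: P_def)
  have "distr (P \<Otimes>\<^sub>M P) borel fst = P"
  proof -
    have "distr (P \<Otimes>\<^sub>M P) borel fst = distr (P \<Otimes>\<^sub>M P) P fst"
      by (intro distr_cong) (auto simp: P_def)
    then show ?thesis
      by (simp add: P.distr_pair_fst)
  qed
  moreover have "distr (P \<Otimes>\<^sub>M P) borel snd = P"
  proof (rule measure_eqI)
    fix A assume "A \<in> sets (distr (P \<Otimes>\<^sub>M P) borel snd)"
    then have [measurable]: "A \<in> sets borel"
      by simp
    have "snd -` A \<inter> space (P \<Otimes>\<^sub>M P) = space P \<times> A"
      by (auto simp: space_pair_measure P_def)
    then show "emeasure (distr (P \<Otimes>\<^sub>M P) borel snd) A = emeasure P A"
      by (simp add: emeasure_distr P.emeasure_pair_measure_Times P.emeasure_space_1)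
  qed (simp add: P_def)
  ultimately have margins: "distr (P \<Otimes>\<^sub>M P) borel fst = P" "distr (P \<Otimes>\<^sub>M P) borel snd = P" by blast+
  have "PP.indep_var borel fst borel snd"
    unfolding PP.indep_var_distribution_eq
  proof (intro conjI)
    have "distr (P \<Otimes>\<^sub>M P) (borel \<Otimes>\<^sub>M borel) (\<lambda>x. (fst x, snd x)) = distr (P \<Otimes>\<^sub>M P) (P \<Otimes>\<^sub>M P) (\<lambda>x. x)"
      by (intro distr_cong sets_pair_measure_cong) (auto simp: P_def)
    then show "distr (P \<Otimes>\<^sub>M P) borel fst \<Otimes>\<^sub>M distr (P \<Otimes>\<^sub>M P) borel snd = distr (P \<Otimes>\<^sub>M P) (borel \<Otimes>\<^sub>M borel) (\<lambda>x. (fst x, snd x))"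
      by (simp add: margins)
  qed measurable
  moreover have "distributed (P \<Otimes>\<^sub>M P) lborel fst (normal_density 0 \<sigma>)" "distributed (P \<Otimes>\<^sub>M P) lborel snd (normal_density 0 \<sigma>)"
    unfolding distributed_def using margins by (auto simp: P_def cong: distr_cong)
  ultimately have "distributed (P \<Otimes>\<^sub>M P) lborel (\<lambda>x. fst x - snd x) (normal_density (0 - 0) (sqrt (\<sigma>\<^sup>2 + \<sigma>\<^sup>2)))"
    using \<open>0 < \<sigma>\<close> by (intro PP.diff_indep_normal) auto
  then have "distr (P \<Otimes>\<^sub>M P) lborel (\<lambda>x. fst x - snd x) = density lborel (normal_density 0 (sqrt (\<sigma>\<^sup>2 + \<sigma>\<^sup>2)))"
    by (simp add: distributed_def)
  moreover have "(\<integral>z. g (fst z - snd z) \<partial>(P \<Otimes>\<^sub>M P)) = (\<integral>t. g t \<partial>distr (P \<Otimes>\<^sub>M P) lborel (\<lambda>x. fst x - snd x))"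
    by (subst integral_distr) auto
  ultimately show ?thesis
    by (simp add: integral_density)
qed

text \<open>
  The transform \<open>p\<close> of \<open>h\<close> is nonnegative but not known to be integrable. Integrated against a Gaussian of
  large width it gives, by Fubini's theorem, an average of \<open>h\<close> with respect to a narrow Gaussian (\<open>smoothed\<close>).
  These averages are bounded, so Fatou's lemma shows that \<open>p\<close> is integrable, and then both sides
  converge and yield the inversion formula.
\<close>
lemma fourier_inversion_nonneg:
  fixes h :: "real \<Rightarrow> complex"
  assumes cont: "continuous_on UNIV h" and int: "integrable lborel h" and bound: "\<And>t. norm (h t) \<le> C"
    and pos: "\<And>l. (\<integral>t. h t * exp (- (\<i> * of_real (l * t))) \<partial>lborel) \<in> \<real>\<^sub>\<ge>\<^sub>0"
  obtains \<nu> where "finite_measure \<nu>" "sets \<nu> = sets borel" "\<And>t. h t = fourier \<nu> (of_real t)"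
proof -
  interpret N: real_distribution std_normal_distribution
    by (rule real_dist_normal_dist)
  have C_nonneg: "0 \<le> C"
    by (rule order_trans[OF norm_ge_zero bound])
  have [measurable]: "h \<in> borel_measurable borel"
    by (rule borel_measurable_continuous_onI[OF cont])
  define p where "p l = Re (\<integral>t. h t * exp (- (\<i> * of_real (l * t))) \<partial>lborel)" for l
  have p: "(\<integral>t. h t * exp (- (\<i> * of_real (l * t))) \<partial>lborel) = of_real (p l)" and p_nonneg: "0 \<le> p l" for l
    using pos[of l] by (auto simp: p_def complex_eq_iff elim!: nonneg_Reals_cases)
  have p_meas [measurable]: "p \<in> borel_measurable borel"
    unfolding p_def by measurable
  have norm_kernel: "norm (exp (\<i> * of_real x)) = 1" "norm (exp (- (\<i> * of_real x))) = 1" for x :: real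
    by (simp_all add: norm_exp_eq_Re)
  have p_bound: "p l \<le> (\<integral>t. norm (h t) \<partial>lborel)" for l
  proof -
    have "p l \<le> norm (\<integral>t. h t * exp (- (\<i> * of_real (l * t))) \<partial>lborel)"
      unfolding p_def by (rule complex_Re_le_cmod)
    also have "\<dots> \<le> (\<integral>t. norm (h t * exp (- (\<i> * of_real (l * t)))) \<partial>lborel)"
      by (rule integral_norm_bound)
    also have "\<dots> = (\<integral>t. norm (h t) \<partial>lborel)"
      by (simp only: norm_mult norm_kernel mult_1_right)
    finally show ?thesis .
  qed
  have smoothed: "(\<integral>l. p l * exp (- (\<delta> * l)\<^sup>2 / 2) * exp (\<i> * of_real (t * l)) \<partial>lborel)
      = 2 * pi * (\<integral>u. h (t + \<delta> * u) \<partial>std_normal_distribution)" if "0 < \<delta>" for \<delta> t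
  proof -
    \<comment> \<open>Up to constant factors both sides are the integral of \<open>k\<close> over the product, in the two orders of integration.\<close>
    define k where "k x s = h s * exp (\<i> * of_real (((t - s) / \<delta>) * x))" for x s
    interpret NL: pair_sigma_finite std_normal_distribution lborel ..
    have [measurable]: "(\<lambda>(x, s). k x s) \<in> borel_measurable (std_normal_distribution \<Otimes>\<^sub>M lborel)"
      unfolding k_def by measurable
    have norm_k: "norm (k x s) = norm (h s)" for x s
      unfolding k_def by (simp only: norm_mult norm_kernel mult_1_right)
    have k_int: "integrable lborel (k x)" for x
    proof (rule Bochner_Integration.integrable_bound[OF int])
      show "k x \<in> borel_measurable lborel"
        unfolding k_def by measurable
    qed (simp add: norm_k)
    have "integrable (std_normal_distribution \<Otimes>\<^sub>M lborel) (\<lambda>(x, s). k x s)"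
    proof (rule NL.Fubini_integrable)
      show "integrable std_normal_distribution (\<lambda>x. \<integral>s. norm (case (x, s) of (x, s) \<Rightarrow> k x s) \<partial>lborel)"
        by (simp add: norm_k)
      show "AE x in std_normal_distribution. integrable lborel (\<lambda>s. case (x, s) of (x, s) \<Rightarrow> k x s)"
        by (simp add: k_int)
    qed simp
    then have fubini: "(\<integral>s. (\<integral>x. k x s \<partial>std_normal_distribution) \<partial>lborel) = (\<integral>x. (\<integral>s. k x s \<partial>lborel) \<partial>std_normal_distribution)"
      by (rule NL.Fubini_integral)
    have "(\<integral>x. k x s \<partial>std_normal_distribution) = h s * of_real (exp (- ((t - s) / \<delta>)\<^sup>2 / 2))" for s
      using fun_cong[OF char_std_normal_distribution, of "(t - s) / \<delta>"] by (simp add: k_def char_def)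
    moreover have "(\<integral>s. k x s \<partial>lborel) = exp (\<i> * of_real (t * (x / \<delta>))) * of_real (p (x / \<delta>))" for x
    proof -
      have "k x s = exp (\<i> * of_real (t * (x / \<delta>))) * (h s * exp (- (\<i> * of_real (x / \<delta> * s))))" for s
        by (simp add: k_def diff_divide_distrib algebra_simps exp_diff exp_minus divide_inverse)
      then show ?thesis
        by (simp only: p integral_mult_right_zero)
    qed
    ultimately have "(\<integral>s. h s * of_real (exp (- ((t - s) / \<delta>)\<^sup>2 / 2)) \<partial>lborel) = (\<integral>x. exp (\<i> * of_real (t * (x / \<delta>))) * of_real (p (x / \<delta>)) \<partial>std_normal_distribution)"
      using fubini by (simp only:)
    also have "\<dots> = (\<integral>x. std_normal_density x *\<^sub>R (exp (\<i> * of_real (t * (x / \<delta>))) * of_real (p (x / \<delta>))) \<partial>lborel)"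
      by (subst integral_density) auto
    also have "\<dots> = \<delta> *\<^sub>R (\<integral>l. std_normal_density (\<delta> * l) *\<^sub>R (exp (\<i> * of_real (t * l)) * of_real (p l)) \<partial>lborel)"
      using \<open>0 < \<delta>\<close> by (subst lborel_integral_real_affine[where c = \<delta> and t = 0]) auto
    also have "(\<lambda>l. std_normal_density (\<delta> * l) *\<^sub>R (exp (\<i> * of_real (t * l)) * complex_of_real (p l)))
        = (\<lambda>l. (1 / sqrt (2 * pi)) *\<^sub>R (p l * exp (- (\<delta> * l)\<^sup>2 / 2) * exp (\<i> * of_real (t * l))))"
      by (auto simp: std_normal_density_def scaleR_conv_of_real mult_ac)
    finally have lhs: "(\<integral>s. h s * of_real (exp (- ((t - s) / \<delta>)\<^sup>2 / 2)) \<partial>lborel)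
        = (\<delta> / sqrt (2 * pi)) *\<^sub>R (\<integral>l. p l * exp (- (\<delta> * l)\<^sup>2 / 2) * exp (\<i> * of_real (t * l)) \<partial>lborel)"
      by simp
    have "(\<integral>s. h s * of_real (exp (- ((t - s) / \<delta>)\<^sup>2 / 2)) \<partial>lborel) = \<delta> *\<^sub>R (\<integral>u. h (t + \<delta> * u) * of_real (exp (- u\<^sup>2 / 2)) \<partial>lborel)"
      using \<open>0 < \<delta>\<close> by (subst lborel_integral_real_affine[where c = \<delta> and t = t]) auto
    also have "(\<lambda>u. h (t + \<delta> * u) * of_real (exp (- u\<^sup>2 / 2))) = (\<lambda>u. sqrt (2 * pi) *\<^sub>R (std_normal_density u *\<^sub>R h (t + \<delta> * u)))"
      by (auto simp: std_normal_density_def scaleR_conv_of_real mult_ac)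
    also have "(\<integral>u. sqrt (2 * pi) *\<^sub>R (std_normal_density u *\<^sub>R h (t + \<delta> * u)) \<partial>lborel) = sqrt (2 * pi) *\<^sub>R (\<integral>u. h (t + \<delta> * u) \<partial>std_normal_distribution)"
      by (subst integral_density) (auto simp del: scaleR_scaleR)
    finally have "(\<delta> / sqrt (2 * pi)) *\<^sub>R (\<integral>l. p l * exp (- (\<delta> * l)\<^sup>2 / 2) * exp (\<i> * of_real (t * l)) \<partial>lborel)
        = (\<delta> * sqrt (2 * pi)) *\<^sub>R (\<integral>u. h (t + \<delta> * u) \<partial>std_normal_distribution)"
      using lhs by simp
    then have "(sqrt (2 * pi) / \<delta> * (\<delta> / sqrt (2 * pi))) *\<^sub>R (\<integral>l. p l * exp (- (\<delta> * l)\<^sup>2 / 2) * exp (\<i> * of_real (t * l)) \<partial>lborel)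
        = (sqrt (2 * pi) / \<delta> * (\<delta> * sqrt (2 * pi))) *\<^sub>R (\<integral>u. h (t + \<delta> * u) \<partial>std_normal_distribution)"
      by (simp only: scaleR_scaleR[symmetric])
    moreover have "sqrt (2 * pi) / \<delta> * (\<delta> / sqrt (2 * pi)) = 1" "sqrt (2 * pi) / \<delta> * (\<delta> * sqrt (2 * pi)) = 2 * pi"
      using \<open>0 < \<delta>\<close> by auto
    ultimately show ?thesis
      by (simp only: scaleR_one) (simp add: scaleR_conv_of_real)
  qed
  define d where "d n = 1 / real (Suc n)" for n
  have d_pos: "0 < d n" for n
    by (simp add: d_def)
  have d_lim: "d \<longlonglongrightarrow> 0"
    unfolding d_def using LIMSEQ_inverse_real_of_nat by (simp add: inverse_eq_divide)
  have right_lim: "(\<lambda>n. \<integral>u. h (t + d n * u) \<partial>std_normal_distribution) \<longlonglongrightarrow> h t" for t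
  proof -
    have "(\<lambda>n. \<integral>u. h (t + d n * u) \<partial>std_normal_distribution) \<longlonglongrightarrow> (\<integral>u. h t \<partial>std_normal_distribution)"
    proof (rule integral_dominated_convergence[where w = "\<lambda>_. C"])
      show "AE u in std_normal_distribution. (\<lambda>n. h (t + d n * u)) \<longlonglongrightarrow> h t"
      proof (intro AE_I2)
        fix u
        have "(\<lambda>n. t + d n * u) \<longlonglongrightarrow> t + 0 * u"
          by (intro tendsto_intros d_lim)
        then show "(\<lambda>n. h (t + d n * u)) \<longlonglongrightarrow> h t"
          by (intro continuous_on_tendsto_compose[OF cont]) auto
      qed
    qed (use bound in auto)
    then show ?thesis
      using N.prob_space by simp
  qed
  have gauss_lim: "(\<lambda>n. exp (- (d n * l)\<^sup>2 / 2)) \<longlonglongrightarrow> 1" for l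
  proof -
    have "(\<lambda>n. exp (- (d n * l)\<^sup>2 / 2)) \<longlonglongrightarrow> exp (- (0 * l)\<^sup>2 / 2)"
      by (intro tendsto_intros d_lim) simp
    then show ?thesis by simp
  qed
  have int_gauss: "integrable lborel (\<lambda>l. p l * exp (- (d n * l)\<^sup>2 / 2))" for n
  proof -
    have "integrable lborel (\<lambda>l. std_normal_density (0 + d n * l))"
      using lborel_integrable_real_affine[of std_normal_density "d n" 0] d_pos[of n] integrable_std_normal_moment[of 0] by simp
    then have "integrable lborel (\<lambda>l. sqrt (2 * pi) * (\<integral>t. norm (h t) \<partial>lborel) * std_normal_density (d n * l))"
      by simp
    then show ?thesis
      by (rule Bochner_Integration.integrable_bound)
        (use p_bound p_nonneg in \<open>auto simp: std_normal_density_def abs_mult intro!: AE_I2 mult_right_mono\<close>)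
  qed
  have int_p: "integrable lborel p"
  proof (rule integrableI_bounded)
    have "(\<integral>\<^sup>+l. ennreal (norm (p l)) \<partial>lborel) = (\<integral>\<^sup>+l. liminf (\<lambda>n. ennreal (p l * exp (- (d n * l)\<^sup>2 / 2))) \<partial>lborel)"
    proof (intro nn_integral_cong)
      fix l
      have "(\<lambda>n. ennreal (p l * exp (- (d n * l)\<^sup>2 / 2))) \<longlonglongrightarrow> ennreal (p l * 1)"
        by (intro tendsto_ennrealI tendsto_mult tendsto_const gauss_lim)
      then show "ennreal (norm (p l)) = liminf (\<lambda>n. ennreal (p l * exp (- (d n * l)\<^sup>2 / 2)))"
        using p_nonneg by (simp only: lim_imp_Liminf[OF sequentially_bot] real_norm_def abs_of_nonneg mult_1_right)
    qed
    also have "\<dots> \<le> liminf (\<lambda>n. \<integral>\<^sup>+l. ennreal (p l * exp (- (d n * l)\<^sup>2 / 2)) \<partial>lborel)"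
      by (intro nn_integral_liminf) measurable
    also have "\<dots> \<le> liminf (\<lambda>n. ennreal (2 * pi * C))"
    proof (intro Liminf_mono always_eventually allI)
      fix n
      have "(\<integral>\<^sup>+l. ennreal (p l * exp (- (d n * l)\<^sup>2 / 2)) \<partial>lborel) = ennreal (\<integral>l. p l * exp (- (d n * l)\<^sup>2 / 2) \<partial>lborel)"
        by (intro nn_integral_eq_integral int_gauss) (use p_nonneg in auto)
      also have "complex_of_real (\<integral>l. p l * exp (- (d n * l)\<^sup>2 / 2) \<partial>lborel) = 2 * pi * (\<integral>u. h (d n * u) \<partial>std_normal_distribution)"
        using smoothed[OF d_pos[of n], of 0] by (simp flip: integral_complex_of_real)
      then have "(\<integral>l. p l * exp (- (d n * l)\<^sup>2 / 2) \<partial>lborel) = Re (2 * pi * (\<integral>u. h (d n * u) \<partial>std_normal_distribution))"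
        by (metis Re_complex_of_real)
      also have "\<dots> \<le> norm (2 * pi * (\<integral>u. h (d n * u) \<partial>std_normal_distribution))"
        by (rule complex_Re_le_cmod)
      also have "\<dots> = 2 * pi * norm (\<integral>u. h (d n * u) \<partial>std_normal_distribution)"
        by (simp add: norm_mult)
      also have "\<dots> \<le> 2 * pi * (\<integral>u. norm (h (d n * u)) \<partial>std_normal_distribution)"
        by (intro mult_left_mono integral_norm_bound) auto
      also have "\<dots> \<le> 2 * pi * (\<integral>u. C \<partial>std_normal_distribution)"
        using bound C_nonneg by (intro mult_left_mono integral_mono N.integrable_const_bound[where B = C]) auto
      also have "\<dots> = 2 * pi * C"
        using N.prob_space by simp
      finally show "(\<integral>\<^sup>+l. ennreal (p l * exp (- (d n * l)\<^sup>2 / 2)) \<partial>lborel) \<le> ennreal (2 * pi * C)"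
        by (simp add: ennreal_leI)
    qed
    finally show "(\<integral>\<^sup>+l. ennreal (norm (p l)) \<partial>lborel) < \<infinity>"
      by (simp add: Liminf_const le_less_trans)
  qed simp
  define \<nu> where "\<nu> = density lborel (\<lambda>l. ennreal (p l / (2 * pi)))"
  have "finite_measure \<nu>"
  proof (rule finite_measureI)
    have "emeasure \<nu> (space \<nu>) = (\<integral>\<^sup>+l. ennreal (p l / (2 * pi)) \<partial>lborel)"
      by (simp add: \<nu>_def emeasure_density)
    also have "\<dots> = ennreal (\<integral>l. p l / (2 * pi) \<partial>lborel)"
      using int_p p_nonneg by (intro nn_integral_eq_integral) auto
    finally show "emeasure \<nu> (space \<nu>) \<noteq> \<infinity>"
      by simp
  qed
  moreover have "sets \<nu> = sets borel"
    by (simp add: \<nu>_def)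
  moreover have "h t = fourier \<nu> (of_real t)" for t
  proof -
    have "(\<lambda>n. \<integral>l. p l * exp (- (d n * l)\<^sup>2 / 2) * exp (\<i> * of_real (t * l)) \<partial>lborel) \<longlonglongrightarrow> (\<integral>l. p l * exp (\<i> * of_real (t * l)) \<partial>lborel)"
    proof (rule integral_dominated_convergence[where w = p])
      show "AE l in lborel. (\<lambda>n. p l * exp (- (d n * l)\<^sup>2 / 2) * exp (\<i> * of_real (t * l))) \<longlonglongrightarrow> p l * exp (\<i> * of_real (t * l))"
      proof (intro AE_I2)
        fix l
        have "(\<lambda>n. p l * exp (- (d n * l)\<^sup>2 / 2) * exp (\<i> * of_real (t * l))) \<longlonglongrightarrow> of_real (p l * 1) * exp (\<i> * of_real (t * l))"
          by (intro tendsto_mult tendsto_of_real tendsto_const gauss_lim)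
        then show "(\<lambda>n. p l * exp (- (d n * l)\<^sup>2 / 2) * exp (\<i> * of_real (t * l))) \<longlonglongrightarrow> p l * exp (\<i> * of_real (t * l))"
          by simp
      qed
      show "AE l in lborel. norm (p l * exp (- (d n * l)\<^sup>2 / 2) * exp (\<i> * of_real (t * l))) \<le> p l" for n
        unfolding norm_mult norm_kernel using p_nonneg by (intro AE_I2) (simp add: norm_mult mult_left_le)
    qed (use int_p in auto)
    moreover have "(\<lambda>n. \<integral>l. p l * exp (- (d n * l)\<^sup>2 / 2) * exp (\<i> * of_real (t * l)) \<partial>lborel) \<longlonglongrightarrow> 2 * pi * h t"
      unfolding smoothed[OF d_pos] by (intro tendsto_intros right_lim)
    ultimately have "(\<integral>l. p l * exp (\<i> * of_real (t * l)) \<partial>lborel) = 2 * pi * h t"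
      by (rule LIMSEQ_unique)
    moreover have "fourier \<nu> (of_real t) = (\<integral>l. (p l / (2 * pi)) *\<^sub>R exp (\<i> * of_real (t * l)) \<partial>lborel)"
      unfolding \<nu>_def fourier_def using p_nonneg by (subst integral_density) (auto simp: mult.assoc)
    moreover have "\<dots> = (\<integral>l. p l * exp (\<i> * of_real (t * l)) \<partial>lborel) / (2 * pi)"
      by (simp add: scaleR_conv_of_real)
    ultimately show ?thesis
      by simp
  qed
  ultimately show thesis
    by (rule that)
qed

section \<open>Positive definite kernels\<close>

lemma pd_kernel_cong:
  assumes "pd_kernel X K" "\<And>x y. x \<in> X \<Longrightarrow> y \<in> X \<Longrightarrow> K x y = L x y"
  shows "pd_kernel X L"
  unfolding pd_kernel_def
proof safe
  fix F c assume F: "finite F" "F \<subseteq> X"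
  then have "(\<Sum>x\<in>F. \<Sum>y\<in>F. c x * cnj (c y) * L x y) = (\<Sum>x\<in>F. \<Sum>y\<in>F. c x * cnj (c y) * K x y)"
    using assms(2) by (intro sum.cong refl) (metis subsetD)
  also have "\<dots> \<in> \<real>\<^sub>\<ge>\<^sub>0"
    using assms(1) F unfolding pd_kernel_def by blast
  finally show "(\<Sum>x\<in>F. \<Sum>y\<in>F. c x * cnj (c y) * L x y) \<in> \<real>\<^sub>\<ge>\<^sub>0" .
qed

lemma pd_kernel_add:
  assumes "pd_kernel X K" "pd_kernel X L"
  shows "pd_kernel X (\<lambda>x y. K x y + L x y)"
  using assms unfolding pd_kernel_def by (auto simp: distrib_left sum.distrib intro!: nonneg_Reals_add_I)

lemma pd_kernel_weight:
  assumes "pd_kernel X K"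
  shows "pd_kernel X (\<lambda>x y. u x * cnj (u y) * K x y)"
  unfolding pd_kernel_def
proof safe
  fix F c assume F: "finite F" "F \<subseteq> X"
  have "(\<Sum>x\<in>F. \<Sum>y\<in>F. c x * cnj (c y) * (u x * cnj (u y) * K x y)) = (\<Sum>x\<in>F. \<Sum>y\<in>F. (c x * u x) * cnj (c y * u y) * K x y)"
    by (simp add: mult_ac)
  also have "\<dots> \<in> \<real>\<^sub>\<ge>\<^sub>0"
    using assms[unfolded pd_kernel_def, rule_format, of F "\<lambda>x. c x * u x"] F by blast
  finally show "(\<Sum>x\<in>F. \<Sum>y\<in>F. c x * cnj (c y) * (u x * cnj (u y) * K x y)) \<in> \<real>\<^sub>\<ge>\<^sub>0" .
qed

lemma pd_kernel_one: "pd_kernel X (\<lambda>x y. 1)"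
  unfolding pd_kernel_def
proof safe
  fix F :: "'a set" and c :: "'a \<Rightarrow> complex"
  have "(\<Sum>x\<in>F. \<Sum>y\<in>F. c x * cnj (c y) * 1) = (\<Sum>x\<in>F. c x) * cnj (\<Sum>x\<in>F. c x)"
    by (simp add: sum_product cnj_sum)
  then show "(\<Sum>x\<in>F. \<Sum>y\<in>F. c x * cnj (c y) * 1) \<in> \<real>\<^sub>\<ge>\<^sub>0"
    by (simp only: complex_norm_square[symmetric] nonneg_Reals_of_real_iff zero_le_power2)
qed

lemma pd_kernel_rank_one: "pd_kernel X (\<lambda>x y. u x * cnj (u y))"
  using pd_kernel_weight[OF pd_kernel_one, of X u] by simp

text \<open>
  As \<open>g\<close> may identify points, the coefficients are summed over its fibres.
\<close>
lemma pd_kernel_pullback: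
  fixes g :: "'a \<Rightarrow> 'b"
  assumes "pd_kernel Y K" "g ` X \<subseteq> Y"
  shows "pd_kernel X (\<lambda>x y. K (g x) (g y))"
  unfolding pd_kernel_def
proof safe
  fix F and c :: "'a \<Rightarrow> complex" assume F: "finite F" "F \<subseteq> X"
  define C where "C u = (\<Sum>x | x \<in> F \<and> g x = u. c x)" for u
  have "(\<Sum>x\<in>F. \<Sum>y\<in>F. c x * cnj (c y) * K (g x) (g y)) = (\<Sum>u\<in>g ` F. \<Sum>x | x \<in> F \<and> g x = u. \<Sum>y\<in>F. c x * cnj (c y) * K (g x) (g y))"
    by (rule sum.image_gen) fact
  also have "\<dots> = (\<Sum>u\<in>g ` F. \<Sum>x | x \<in> F \<and> g x = u. \<Sum>v\<in>g ` F. \<Sum>y | y \<in> F \<and> g y = v. c x * cnj (c y) * K (g x) (g y))"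
    by (intro sum.cong refl sum.image_gen F(1))
  also have "\<dots> = (\<Sum>u\<in>g ` F. \<Sum>x | x \<in> F \<and> g x = u. \<Sum>v\<in>g ` F. c x * cnj (C v) * K u v)"
    by (intro sum.cong refl) (auto simp: C_def cnj_sum sum_distrib_left sum_distrib_right intro!: sum.cong)
  also have "\<dots> = (\<Sum>u\<in>g ` F. \<Sum>v\<in>g ` F. C u * cnj (C v) * K u v)"
    by (intro sum.cong refl, subst sum.swap) (simp add: C_def sum_distrib_right)
  also have "\<dots> \<in> \<real>\<^sub>\<ge>\<^sub>0"
    using assms(1)[unfolded pd_kernel_def, rule_format, of "g ` F" C] F assms(2) by blast
  finally show "(\<Sum>x\<in>F. \<Sum>y\<in>F. c x * cnj (c y) * K (g x) (g y)) \<in> \<real>\<^sub>\<ge>\<^sub>0" .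
qed

lemma integral_nonneg_Reals:
  fixes f :: "'a \<Rightarrow> complex"
  assumes "AE x in M. f x \<in> \<real>\<^sub>\<ge>\<^sub>0"
  shows "(\<integral>x. f x \<partial>M) \<in> \<real>\<^sub>\<ge>\<^sub>0"
proof (cases "integrable M f")
  case True
  have "(\<integral>x. f x \<partial>M) = (\<integral>x. complex_of_real (Re (f x)) \<partial>M)"
    using assms True by (intro integral_cong_AE) (auto elim!: eventually_mono nonneg_Reals_cases)
  moreover have "0 \<le> (\<integral>x. Re (f x) \<partial>M)"
    using assms by (intro integral_nonneg_AE) (auto elim!: eventually_mono nonneg_Reals_cases)
  ultimately show ?thesis
    by (simp add: nonneg_Reals_of_real_iff)
qed (simp add: not_integrable_integral_eq)

lemma pd_kernel_integral:
  assumes pd: "AE l in M. pd_kernel X (K l)"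
    and int: "\<And>x y. x \<in> X \<Longrightarrow> y \<in> X \<Longrightarrow> integrable M (\<lambda>l. K l x y)"
  shows "pd_kernel X (\<lambda>x y. \<integral>l. K l x y \<partial>M)"
  unfolding pd_kernel_def
proof safe
  fix F c assume F: "finite F" "F \<subseteq> X"
  have "(\<Sum>x\<in>F. \<Sum>y\<in>F. c x * cnj (c y) * (\<integral>l. K l x y \<partial>M)) = (\<integral>l. (\<Sum>x\<in>F. \<Sum>y\<in>F. c x * cnj (c y) * K l x y) \<partial>M)"
  proof -
    have "integrable M (\<lambda>l. c x * cnj (c y) * K l x y)" if "x \<in> F" "y \<in> F" for x y
      using int that F by (intro integrable_mult_right) auto
    then show ?thesis
      by (simp add: integral_sum integrable_sum)
  qed
  also have "\<dots> \<in> \<real>\<^sub>\<ge>\<^sub>0"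
    by (rule integral_nonneg_Reals, rule eventually_mono[OF pd]) (use F in \<open>auto simp: pd_kernel_def\<close>)
  finally show "(\<Sum>x\<in>F. \<Sum>y\<in>F. c x * cnj (c y) * (\<integral>l. K l x y \<partial>M)) \<in> \<real>\<^sub>\<ge>\<^sub>0" .
qed

lemma pd_kernel_limit:
  assumes "\<And>n::nat. pd_kernel X (K n)"
    and "\<And>x y. x \<in> X \<Longrightarrow> y \<in> X \<Longrightarrow> (\<lambda>n. K n x y) \<longlonglongrightarrow> L x y"
  shows "pd_kernel X L"
  unfolding pd_kernel_def
proof safe
  fix F c assume F: "finite F" "F \<subseteq> X"
  have lim: "(\<lambda>n. \<Sum>x\<in>F. \<Sum>y\<in>F. c x * cnj (c y) * K n x y) \<longlonglongrightarrow> (\<Sum>x\<in>F. \<Sum>y\<in>F. c x * cnj (c y) * L x y)"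
    using F assms(2) by (intro tendsto_sum tendsto_mult tendsto_const) auto
  have mem: "(\<Sum>x\<in>F. \<Sum>y\<in>F. c x * cnj (c y) * K n x y) \<in> \<real>\<^sub>\<ge>\<^sub>0" for n
    using assms(1)[of n] F unfolding pd_kernel_def by blast
  show "(\<Sum>x\<in>F. \<Sum>y\<in>F. c x * cnj (c y) * L x y) \<in> \<real>\<^sub>\<ge>\<^sub>0"
    by (rule closed_sequentially[OF closed_nonneg_Reals_complex mem lim])
qed

lemma pd_function_real_group: "pd_function real_group f \<longleftrightarrow> pd_kernel UNIV (\<lambda>x y. f (x - y))"
  unfolding pd_function_def by (simp add: inv_real_group) (simp add: real_group_def)

lemma
  assumes "pd_function real_group f"
  shows pd_function_at_minus: "f (- t) = cnj (f t)"
    and pd_function_bounded: "norm (f t) \<le> Re (f 0)"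
proof -
  have pd: "(\<Sum>x\<in>F. \<Sum>y\<in>F. c x * cnj (c y) * f (x - y)) \<in> \<real>\<^sub>\<ge>\<^sub>0" if "finite F" for F c
    using assms that unfolding pd_function_real_group pd_kernel_def by blast
  have f0: "f 0 \<in> \<real>\<^sub>\<ge>\<^sub>0"
    using pd[of "{0}" "\<lambda>_. 1"] by simp
  have two: "(a * cnj a + b * cnj b) * f 0 + a * cnj b * f t + b * cnj a * f (- t) \<in> \<real>\<^sub>\<ge>\<^sub>0" if "t \<noteq> 0" for a b
    using pd[of "{t, 0}" "\<lambda>x. if x = t then a else b"] that by (simp add: algebra_simps)
  have "f (- t) = cnj (f t) \<and> norm (f t) \<le> Re (f 0)"
  proof (cases "t = 0")
    case True
    then show ?thesis
      using f0 by (auto elim: nonneg_Reals_cases)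
  next
    case False
    have herm: "f (- t) = cnj (f t)"
      using two[OF False, of 1 1] two[OF False, of 1 \<i>] f0
      by (auto simp: complex_nonneg_Reals_iff complex_eq_iff)
    have "norm (f t) \<le> Re (f 0)"
    proof (cases "f t = 0")
      case False
      \<comment> \<open>The phase that makes the mixed terms of the quadratic form as negative as possible.\<close>
      define a where "a = - cnj (sgn (f t))"
      have a: "a * cnj a = 1" "a * f t = - of_real (norm (f t))"
        using False by (simp_all add: a_def sgn_eq complex_norm_square[symmetric] mult.commute power2_eq_square flip: complex_norm_square)
      have "cnj a * cnj (f t) = - of_real (norm (f t))"
        using arg_cong[OF a(2), of cnj] by simp
      then show ?thesis
        using two[OF \<open>t \<noteq> 0\<close>, of a 1] a by (simp add: herm complex_nonneg_Reals_iff)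
    qed (use f0 in \<open>auto elim: nonneg_Reals_cases\<close>)
    with herm show ?thesis by blast
  qed
  then show "f (- t) = cnj (f t)" "norm (f t) \<le> Re (f 0)"
    by blast+
qed

text \<open>
  A weak form of Bochner's theorem. The nonnegativity that inversion requires is the positive
  definiteness of \<open>f\<close>, multiplied by a character, integrated against the difference of two
  independent normal variables of standard deviation \<open>\<sigma>\<close>.
\<close>
lemma gaussian_damped_pd_is_fourier:
  assumes pd: "pd_function real_group f" and cont: "continuous_on UNIV f" and "0 < \<sigma>"
  obtains \<nu> where "finite_measure \<nu>" "sets \<nu> = sets borel"
    "\<And>t. f t * exp (- (of_real t / (2 * of_real \<sigma>))\<^sup>2) = fourier \<nu> (of_real t)"
proof -
  define s where "s = sqrt (\<sigma>\<^sup>2 + \<sigma>\<^sup>2)"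
  have "0 < s" and s2: "s\<^sup>2 = 2 * \<sigma>\<^sup>2"
    using \<open>0 < \<sigma>\<close> by (simp_all add: s_def)
  define w where "w = 1 / sqrt (2 * pi * s\<^sup>2)"
  have "0 < w"
    using \<open>0 < s\<close> by (simp add: w_def)
  have gauss: "normal_density 0 s t = w * exp (- (t / (2 * \<sigma>))\<^sup>2)" for t
    by (simp add: normal_density_def w_def s2 power_divide power_mult_distrib)
  have exp_eq: "exp (- (complex_of_real t / (2 * of_real \<sigma>))\<^sup>2) = of_real (exp (- (t / (2 * \<sigma>))\<^sup>2))" for t
    by (simp flip: exp_of_real)
  define h where "h t = f t * exp (- (complex_of_real t / (2 * of_real \<sigma>))\<^sup>2)" for t
  have h: "h t = exp (- (t / (2 * \<sigma>))\<^sup>2) *\<^sub>R f t" for t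
    by (simp add: h_def exp_eq scaleR_conv_of_real)
  have [measurable]: "f \<in> borel_measurable borel"
    by (rule borel_measurable_continuous_onI[OF cont])
  have h_cont: "continuous_on UNIV h"
    unfolding h_def by (intro continuous_intros cont) (use \<open>0 < \<sigma>\<close> in auto)
  have "0 \<le> Re (f 0)"
    using pd_function_bounded[OF pd, of 0] norm_ge_zero order_trans by blast
  have h_bound: "norm (h t) \<le> Re (f 0) * exp (- (t / (2 * \<sigma>))\<^sup>2)" for t
    using pd_function_bounded[OF pd, of t] by (simp add: h mult.commute mult_right_mono)
  have "integrable lborel (\<lambda>t. Re (f 0) / w * normal_density 0 s t)"
    using \<open>0 < s\<close> by (intro integrable_mult_right integrable_normal_density)
  then have h_int: "integrable lborel h"
  proof (rule Bochner_Integration.integrable_bound)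
    show "h \<in> borel_measurable lborel"
      using borel_measurable_continuous_onI[OF h_cont] by simp
    show "AE t in lborel. norm (h t) \<le> norm (Re (f 0) / w * normal_density 0 s t)"
      using h_bound \<open>0 < w\<close> \<open>0 \<le> Re (f 0)\<close> by (auto simp: gauss abs_mult)
  qed
  have pos: "(\<integral>t. h t * exp (- (\<i> * of_real (l * t))) \<partial>lborel) \<in> \<real>\<^sub>\<ge>\<^sub>0" for l
  proof -
    define P where "P = density lborel (normal_density 0 \<sigma>)"
    have "real_distribution P"
      unfolding P_def real_distribution_def real_distribution_axioms_def
      using prob_space_normal_density[OF \<open>0 < \<sigma>\<close>] by simp
    define g where "g t = f t * exp (- (\<i> * of_real (l * t)))" for t
    have g_cont: "continuous_on UNIV g"
      unfolding g_def by (intro continuous_intros cont)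
    have "(\<integral>z. g (fst z - snd z) \<partial>(P \<Otimes>\<^sub>M P)) \<in> \<real>\<^sub>\<ge>\<^sub>0"
    proof (rule pd_kernel_integral_nonneg)
      have "pd_kernel UNIV (\<lambda>x y. exp (- (\<i> * of_real (l * x))) * cnj (exp (- (\<i> * of_real (l * y)))) * f (x - y))"
        using pd unfolding pd_function_real_group by (rule pd_kernel_weight)
      moreover have "exp (- (\<i> * of_real (l * x))) * cnj (exp (- (\<i> * of_real (l * y)))) * f (x - y) = g (x - y)" for x y
        by (simp add: g_def exp_cnj algebra_simps flip: exp_add)
      ultimately show "pd_kernel UNIV (\<lambda>x y. g (x - y))"
        by (rule pd_kernel_cong)
      show "continuous_on UNIV (\<lambda>z. g (fst z - snd z))"
        by (intro continuous_on_compose2[OF g_cont] continuous_intros) auto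
      show "norm (g (x - y)) \<le> Re (f 0)" for x y
        using pd_function_bounded[OF pd] by (simp add: g_def norm_mult norm_exp_eq_Re)
    qed fact
    also have "(\<integral>z. g (fst z - snd z) \<partial>(P \<Otimes>\<^sub>M P)) = (\<integral>t. normal_density 0 s t *\<^sub>R g t \<partial>lborel)"
      unfolding P_def s_def using borel_measurable_continuous_onI[OF g_cont] by (intro difference_of_normals \<open>0 < \<sigma>\<close>)
    also have "\<dots> = (\<integral>t. w *\<^sub>R (h t * exp (- (\<i> * of_real (l * t)))) \<partial>lborel)"
      by (simp add: gauss h g_def)
    also have "\<dots> = of_real w * (\<integral>t. h t * exp (- (\<i> * of_real (l * t))) \<partial>lborel)"
      by (subst integral_scaleR_right) (simp add: scaleR_conv_of_real)
    finally show ?thesis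
      using \<open>0 < w\<close> by (simp add: complex_nonneg_Reals_iff zero_le_mult_iff)
  qed
  have "norm (h t) \<le> Re (f 0)" for t
    by (rule order_trans[OF h_bound]) (use \<open>0 \<le> Re (f 0)\<close> in \<open>simp add: mult_left_le\<close>)
  from fourier_inversion_nonneg[OF h_cont h_int this pos] show thesis
    using that unfolding h_def by blast
qed

lemma fourier_imaginary: "fourier \<nu> (\<i> * of_real y) = (\<integral>l. of_real (exp (- y * l)) \<partial>\<nu>)"
  unfolding fourier_def by (simp add: mult.assoc[symmetric] flip: exp_of_real)

lemma pd_kernel_fourier_imaginary:
  assumes "\<And>y. y \<in> {0..\<beta>} \<Longrightarrow> integrable \<nu> (\<lambda>l. exp (- y * l))"
  shows "pd_kernel {0<..<\<beta>/2} (\<lambda>s t. fourier \<nu> (\<i> * of_real (s + t)))"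
  unfolding fourier_imaginary
proof (rule pd_kernel_integral)
  have "complex_of_real (exp (- s * l)) * cnj (of_real (exp (- t * l))) = of_real (exp (- (s + t) * l))" for s t l
  proof -
    have "- (s + t) * l = - s * l + - t * l"
      by (simp add: algebra_simps)
    then show ?thesis
      by (simp only: exp_add of_real_mult complex_cnj_complex_of_real)
  qed
  then have "pd_kernel {0<..<\<beta>/2} (\<lambda>s t. complex_of_real (exp (- (s + t) * l)))" for l
    by (rule pd_kernel_cong[OF pd_kernel_rank_one])
  then show "AE l in \<nu>. pd_kernel {0<..<\<beta>/2} (\<lambda>s t. complex_of_real (exp (- (s + t) * l)))"
    by simp
  show "integrable \<nu> (\<lambda>l. complex_of_real (exp (- (s + t) * l)))" if "s \<in> {0<..<\<beta>/2}" "t \<in> {0<..<\<beta>/2}" for s t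
    using assms[of "s + t"] that by (intro integrable_of_real) auto
qed

text \<open>
  Nothing is assumed about the growth of \<open>F\<close> inside the strip, so contours cannot be shifted
  directly. The Gaussian factor is entire; hence the damped function satisfies the hypotheses of \<open>fourier_extension\<close>, and
  on the imaginary axis it is a Laplace transform of a positive measure.
\<close>
theorem pd_kernel_on_imaginary_segment:
  assumes "0 < \<beta>" and pd: "pd_function real_group f"
    and F: "continuous_on (closure (strip \<beta>)) F" "F holomorphic_on strip \<beta>" "\<And>t. F (of_real t) = f t"
  shows "pd_kernel {0<..<\<beta>/2} (\<lambda>s t. F (\<i> * of_real (s + t)))"
proof (rule pd_kernel_limit)
  have "continuous_on UNIV (\<lambda>t. F (of_real t))"
    by (intro continuous_on_compose2[OF F(1)] continuous_intros)
      (use \<open>0 < \<beta>\<close> in \<open>auto simp: closure_strip\<close>)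
  then have f_cont: "continuous_on UNIV f"
    by (simp add: F(3))
  define G where "G n z = F z * exp (- (z / (2 * of_real (real (Suc n))))\<^sup>2)" for n z
  have nz: "2 * complex_of_real (real (Suc n)) \<noteq> 0" for n
    by (simp only: mult_eq_0_iff of_real_eq_0_iff) simp
  show "pd_kernel {0<..<\<beta>/2} (\<lambda>s t. G n (\<i> * of_real (s + t)))" for n
  proof -
    have G: "continuous_on (closure (strip \<beta>)) (G n)" "G n holomorphic_on strip \<beta>"
      unfolding G_def using nz by (intro continuous_intros holomorphic_intros F; blast)+
    obtain \<nu> where \<nu>: "finite_measure \<nu>" "sets \<nu> = sets borel"
        "\<And>t. f t * exp (- (of_real t / (2 * of_real (real (Suc n))))\<^sup>2) = fourier \<nu> (of_real t)"
      using gaussian_damped_pd_is_fourier[OF pd f_cont, of "real (Suc n)"] by auto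
    have G_eq: "G n (of_real t) = fourier \<nu> (of_real t)" for t
      by (simp only: G_def F(3) \<nu>(3))
    note ext = fourier_extension[OF \<open>0 < \<beta>\<close> \<nu>(1,2) G G_eq]
    have int: "integrable \<nu> (\<lambda>l. exp (- y * l))" if "y \<in> {0..\<beta>}" for y
    proof (rule Bochner_Integration.integrable_bound)
      interpret finite_measure \<nu> by fact
      show "integrable \<nu> (\<lambda>l. exp (- 0 * l) + exp (- \<beta> * l))"
        using ext(1) by simp
      show "AE l in \<nu>. norm (exp (- y * l)) \<le> norm (exp (- 0 * l) + exp (- \<beta> * l))"
        using exp_interpolation_le[of 0 y \<beta>] that by (intro AE_I2) auto
      show "(\<lambda>l. exp (- y * l)) \<in> borel_measurable \<nu>"
        using \<nu>(2) by (simp cong: measurable_cong_sets)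
    qed
    show ?thesis
    proof (rule pd_kernel_cong[OF pd_kernel_fourier_imaginary[OF int]])
      show "fourier \<nu> (\<i> * of_real (s + t)) = G n (\<i> * of_real (s + t))" if "s \<in> {0<..<\<beta>/2}" "t \<in> {0<..<\<beta>/2}" for s t
        using ext(2)[of "\<i> * of_real (s + t)"] that \<open>0 < \<beta>\<close> by (simp add: closure_strip)
    qed
  qed
  show "(\<lambda>n. G n (\<i> * of_real (s + t))) \<longlonglongrightarrow> F (\<i> * of_real (s + t))" for s t
  proof -
    define z where "z = \<i> * complex_of_real (s + t)"
    have "(\<lambda>n. z / 2 * of_real (1 / real (Suc n))) \<longlonglongrightarrow> z / 2 * of_real 0"
      using LIMSEQ_inverse_real_of_nat by (intro tendsto_intros) (simp add: inverse_eq_divide)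
    moreover have "z / 2 * of_real (1 / real (Suc n)) = z / (2 * of_real (real (Suc n)))" for n
      by (simp only: of_real_divide) simp
    ultimately have "(\<lambda>n. z / (2 * of_real (real (Suc n)))) \<longlonglongrightarrow> 0"
      by (simp only:) simp
    then have "(\<lambda>n. F z * exp (- (z / (2 * of_real (real (Suc n))))\<^sup>2)) \<longlonglongrightarrow> F z * exp (- (0\<^sup>2))"
      by (intro tendsto_intros)
    then show ?thesis
      by (simp add: G_def z_def)
  qed
qed

section \<open>Functions on the circle\<close>

lemma cls_eq_iff: "cls \<beta> x = cls \<beta> y \<longleftrightarrow> (\<exists>k::int. y = x + of_int k * \<beta>)"
proof
  assume "cls \<beta> x = cls \<beta> y"
  moreover have "y \<in> cls \<beta> y"
    unfolding cls_altdef by (auto intro: exI[of _ 0])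
  ultimately show "\<exists>k::int. y = x + of_int k * \<beta>"
    by (auto simp: cls_altdef)
next
  assume "\<exists>k::int. y = x + of_int k * \<beta>"
  then obtain k :: int where k: "y = x + of_int k * \<beta>" ..
  have "x + of_int j * \<beta> = y + of_int (j - k) * \<beta>" "y + of_int j * \<beta> = x + of_int (j + k) * \<beta>" for j :: int
    by (simp_all add: k algebra_simps)
  then show "cls \<beta> x = cls \<beta> y"
    unfolding cls_altdef by blast
qed

lemma cls_representative:
  assumes "0 < \<beta>"
  obtains y where "y \<in> {0..<\<beta>}" "cls \<beta> t = cls \<beta> y"
proof
  have "of_int \<lfloor>t / \<beta>\<rfloor> \<le> t / \<beta>" "t / \<beta> < of_int \<lfloor>t / \<beta>\<rfloor> + 1"
    by linarith+
  then have "of_int \<lfloor>t / \<beta>\<rfloor> * \<beta> \<le> t" "t < (of_int \<lfloor>t / \<beta>\<rfloor> + 1) * \<beta>"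
    using assms by (simp_all only: pos_le_divide_eq pos_divide_less_eq)
  then show "t - of_int \<lfloor>t / \<beta>\<rfloor> * \<beta> \<in> {0..<\<beta>}"
    by (simp add: algebra_simps)
  show "cls \<beta> t = cls \<beta> (t - of_int \<lfloor>t / \<beta>\<rfloor> * \<beta>)"
    unfolding cls_eq_iff by (intro exI[of _ "- \<lfloor>t / \<beta>\<rfloor>"]) simp
qed

text \<open>
  This is the distance of \<open>t\<close> to the lattice generated by \<open>\<beta>\<close>, for \<open>\<beta> > 0\<close>. In this form
  continuity, evenness and periodicity are immediate.
\<close>
definition tent :: "real \<Rightarrow> real \<Rightarrow> real" where
  "tent \<beta> t = \<beta> / (2 * pi) * arccos (cos (2 * pi * t / \<beta>))"

lemma continuous_on_tent: "continuous_on S (tent \<beta>)"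
proof (cases "\<beta> = 0")
  case False
  then show ?thesis
    unfolding tent_def by (intro continuous_intros) auto
qed (simp add: tent_def[abs_def])

lemma tent_uminus: "tent \<beta> (- t) = tent \<beta> t"
  by (simp add: tent_def)

lemma tent_plus_period:
  assumes "\<beta> \<noteq> 0"
  shows "tent \<beta> (t + of_int k * \<beta>) = tent \<beta> t"
proof -
  have "2 * pi * (t + of_int k * \<beta>) / \<beta> = 2 * pi * t / \<beta> + 2 * pi * of_int k"
    using assms by (simp add: field_simps)
  then have "cos (2 * pi * (t + of_int k * \<beta>) / \<beta>) = cos (2 * pi * t / \<beta>)"
    by (simp add: cos_add)
  then show ?thesis
    by (simp add: tent_def)
qed

lemma tent_lower_half:
  assumes "0 < \<beta>" "0 \<le> y" "y \<le> \<beta> / 2"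
  shows "tent \<beta> y = y"
proof -
  have "0 \<le> 2 * pi * y / \<beta>" "2 * pi * y / \<beta> \<le> pi"
    using assms by (auto simp: field_simps)
  then show ?thesis
    using assms by (simp add: tent_def arccos_cos)
qed

lemma tent_upper_half:
  assumes "0 < \<beta>" "\<beta> / 2 \<le> y" "y \<le> \<beta>"
  shows "tent \<beta> y = \<beta> - y"
proof -
  have "tent \<beta> y = tent \<beta> (- y + of_int 1 * \<beta>)"
    using assms tent_plus_period[of \<beta> "- y" 1] tent_uminus by simp
  also have "\<dots> = \<beta> - y"
    using assms by (subst tent_lower_half) auto
  finally show ?thesis .
qed

lemma tent_range:
  assumes "0 < \<beta>"
  shows "tent \<beta> t \<in> {0..\<beta>}"
proof -
  have "0 \<le> arccos (cos (2 * pi * t / \<beta>))" "arccos (cos (2 * pi * t / \<beta>)) \<le> 2 * pi"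
    using arccos_lbound arccos_ubound[of "cos (2 * pi * t / \<beta>)"] pi_gt_zero by (auto intro: order_trans)
  then show ?thesis
    using assms by (auto simp: tent_def field_simps mult_left_mono)
qed

text \<open>
  For \<open>g\<close> symmetric about \<open>\<beta> / 2\<close> this is the function on the circle that equals \<open>g\<close> on a period.
\<close>
definition circle_function :: "real \<Rightarrow> (real \<Rightarrow> complex) \<Rightarrow> real set \<Rightarrow> complex" where
  "circle_function \<beta> g = restrict (\<lambda>C. g (tent \<beta> (SOME t. t \<in> C))) (carrier (circle \<beta>))"

lemma circle_function_cls:
  assumes "0 < \<beta>"
  shows "circle_function \<beta> g (cls \<beta> t) = g (tent \<beta> t)"
proof -
  have "t \<in> cls \<beta> t"
    unfolding cls_altdef by (auto intro: exI[of _ 0])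
  then have "(SOME s. s \<in> cls \<beta> t) \<in> cls \<beta> t"
    by (rule someI)
  then obtain k :: int where "(SOME s. s \<in> cls \<beta> t) = t + of_int k * \<beta>"
    unfolding cls_altdef by blast
  then show ?thesis
    using assms by (simp add: circle_function_def carrier_circle tent_plus_period)
qed

lemma circle_function_on_period:
  assumes "0 < \<beta>" "\<And>y. y \<in> {0..\<beta>} \<Longrightarrow> g (\<beta> - y) = g y" "y \<in> {0..\<beta>}"
  shows "circle_function \<beta> g (cls \<beta> y) = g y"
  using assms tent_lower_half[of \<beta> y] tent_upper_half[of \<beta> y]
  by (cases "y \<le> \<beta> / 2") (simp_all add: circle_function_cls)

lemma continuous_map_circle_iff:
  "continuous_map (circle_topology \<beta>) euclidean \<phi> \<longleftrightarrow> continuous_on UNIV (\<lambda>t. \<phi> (cls \<beta> t))"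
  using continuous_compose_quotient_map_eq[OF quotient_map_cls[of \<beta>], of euclidean \<phi>]
  by (simp add: comp_def)

lemma continuous_map_circle_function:
  assumes "0 < \<beta>" "continuous_on {0..\<beta>} g"
  shows "continuous_map (circle_topology \<beta>) euclidean (circle_function \<beta> g)"
  unfolding continuous_map_circle_iff circle_function_cls[OF assms(1)]
  by (rule continuous_on_compose2[OF assms(2) continuous_on_tent]) (use tent_range[OF assms(1)] in auto)

lemma pd_kernel_min: "pd_kernel {0::real..} (\<lambda>x y. complex_of_real (min x y))"
proof (rule pd_kernel_cong[OF pd_kernel_integral])
  define K where "K r x y = complex_of_real (indicator {0<..x} r) * cnj (complex_of_real (indicator {0<..y} r))"
    for r x y :: real
  have K: "K r x y = of_real (indicator {0<..min x y} r)" for x y r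
    by (auto simp: K_def indicator_def)
  show "AE r in lborel. pd_kernel {0..} (K r)"
    unfolding K_def by (intro AE_I2 pd_kernel_rank_one)
  fix x y :: real assume "x \<in> {0..}" "y \<in> {0..}"
  then show "integrable lborel (\<lambda>r. K r x y)" "(\<integral>r. K r x y \<partial>lborel) = complex_of_real (min x y)"
    unfolding K by (auto intro!: integrable_of_real integrable_real_indicator)
qed

text \<open>
  Let \<open>q = e\<^sup>-\<^sup>k\<^sup>\<beta>\<close>, \<open>M = q\<^sup>-\<^sup>2\<close> and \<open>X t = e\<^sup>2\<^sup>k\<^sup>t\<close> with \<open>k = \<bar>l\<bar>\<close>. Up to the weights \<open>e\<^sup>-\<^sup>k\<^sup>s e\<^sup>-\<^sup>k\<^sup>t\<close> and the factor \<open>1 + q\<close>,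
  the kernel is \<open>m + q m'\<close>, where \<open>m\<close> and \<open>m'\<close> are the minimum and maximum of \<open>X s\<close> and \<open>X t\<close>, and
  \<open>m + q m' = (1 - q) (m - 1) (M - m') / (M - 1) + (q X s + 1) (q X t + 1) / (1 + q)\<close>. The second
  summand has rank one. The first is the covariance of a Brownian bridge on \<open>[1, M]\<close>, which is a
  weighted minimum kernel in \<open>u = (X - 1) / (M - X)\<close>.
\<close>
lemma pd_kernel_basic_rp_difference:
  assumes "0 < \<beta>"
  shows "pd_kernel {0..<\<beta>} (\<lambda>s t. complex_of_real (basic_rp \<beta> l \<bar>s - t\<bar>))"
proof (cases "l = 0")
  case True
  then show ?thesis
    by (intro pd_kernel_cong[OF pd_kernel_one]) (simp add: basic_rp_def)
next
  case False
  define k where "k = \<bar>l\<bar>"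
  have "0 < k"
    using False by (simp add: k_def)
  define q where "q = exp (- k * \<beta>)"
  define M where "M = exp (2 * k * \<beta>)"
  have q: "0 < q" "q < 1" "q\<^sup>2 * M = 1" and "1 < M"
    using \<open>0 < k\<close> \<open>0 < \<beta>\<close> by (simp_all add: q_def M_def power2_eq_square flip: exp_add)
  define X where "X t = exp (2 * k * t)" for t
  have X: "1 \<le> X t" "X t < M" if "t \<in> {0..<\<beta>}" for t
    using that \<open>0 < k\<close> by (auto simp: X_def M_def)
  define c where "c = (1 - q) / ((M - 1) * (1 + q))"
  have "0 \<le> c"
    using q \<open>1 < M\<close> by (simp add: c_def)
  define u where "u t = (X t - 1) / (M - X t)" for t
  define v where "v t = sqrt c * (M - X t) * exp (- k * t)" for t
  define w where "w t = (q * X t + 1) / (1 + q) * exp (- k * t)" for t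
  have "pd_kernel {0..<\<beta>} (\<lambda>s t. complex_of_real (min (u s) (u t)))"
    by (rule pd_kernel_pullback[OF pd_kernel_min]) (use X in \<open>auto simp: u_def less_imp_le\<close>)
  then have "pd_kernel {0..<\<beta>} (\<lambda>s t. complex_of_real (v s) * cnj (complex_of_real (v t)) * complex_of_real (min (u s) (u t)) + complex_of_real (w s) * cnj (complex_of_real (w t)))"
    by (intro pd_kernel_add pd_kernel_weight pd_kernel_rank_one)
  then show ?thesis
  proof (rule pd_kernel_cong)
    have ordered: "v s * v t * min (u s) (u t) + w s * w t = basic_rp \<beta> l (t - s)"
      if "s \<in> {0..<\<beta>}" "t \<in> {0..<\<beta>}" "s \<le> t" for s t
    proof -
      have "X s \<le> X t"
        using that \<open>0 < k\<close> by (simp add: X_def)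
      then have "u s \<le> u t"
        using X that \<open>0 < k\<close> by (auto simp: u_def intro!: frac_le)
      define e where "e = exp (- k * s) * exp (- k * t)"
      have "v s * v t * min (u s) (u t) = e * (c * (X s - 1) * (M - X t))"
        using \<open>u s \<le> u t\<close> X[OF that(1)] \<open>0 \<le> c\<close> by (simp add: v_def u_def e_def min_def mult_ac)
      moreover have "w s * w t = e * ((q * X s + 1) * (q * X t + 1) / (1 + q)\<^sup>2)"
        by (simp add: w_def e_def power2_eq_square)
      ultimately have "v s * v t * min (u s) (u t) + w s * w t = e * (c * (X s - 1) * (M - X t) + (q * X s + 1) * (q * X t + 1) / (1 + q)\<^sup>2)"
        by (simp add: distrib_left)
      also have "c * (X s - 1) * (M - X t) + (q * X s + 1) * (q * X t + 1) / (1 + q)\<^sup>2 = (X s + q * X t) / (1 + q)"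
      proof -
        have "M = 1 / q\<^sup>2"
          using q by (simp add: field_simps)
        then have c: "c = q\<^sup>2 / (1 + q)\<^sup>2" 
        proof -
          have "M - 1 = (1 - q) * (1 + q) / q\<^sup>2"
            using q \<open>M = 1 / q\<^sup>2\<close> by (simp add: field_simps power2_eq_square)
          then show ?thesis
            using q by (simp add: c_def power2_eq_square)
        qed
        have "c * (X s - 1) * (M - X t) = (X s - 1) * (1 - q\<^sup>2 * X t) / (1 + q)\<^sup>2"
        proof -
          have "q\<^sup>2 * (M - X t) = 1 - q\<^sup>2 * X t"
            using q(3) by (simp add: right_diff_distrib)
          moreover have "c * (X s - 1) * (M - X t) = (X s - 1) * (q\<^sup>2 * (M - X t)) / (1 + q)\<^sup>2"
            by (simp add: c mult_ac)
          ultimately show ?thesis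
            by (simp only:)
        qed
        then have "c * (X s - 1) * (M - X t) + (q * X s + 1) * (q * X t + 1) / (1 + q)\<^sup>2 = ((X s - 1) * (1 - q\<^sup>2 * X t) + (q * X s + 1) * (q * X t + 1)) / (1 + q)\<^sup>2"
          by (simp add: add_divide_distrib)
        also have "(X s - 1) * (1 - q\<^sup>2 * X t) + (q * X s + 1) * (q * X t + 1) = (1 + q) * (X s + q * X t)"
          by (simp add: algebra_simps power2_eq_square)
        finally show ?thesis
          using q by (simp add: power2_eq_square)
      qed
      also have "e * ((X s + q * X t) / (1 + q)) = (exp (- k * (t - s)) + exp (- k * (\<beta> - (t - s)))) / (1 + q)"
      proof -
        have "e * X s = exp (- k * (t - s))" "e * (q * X t) = exp (- k * (\<beta> - (t - s)))"
          by (simp_all add: e_def X_def q_def algebra_simps flip: exp_add)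
        then show ?thesis
          by (simp add: distrib_left)
      qed
      also have "\<dots> = basic_rp \<beta> k (t - s)"
        by (simp add: basic_rp_def q_def)
      finally show ?thesis
        by (simp add: k_def)
    qed
    fix s t assume st: "s \<in> {0..<\<beta>}" "t \<in> {0..<\<beta>}"
    have "v s * v t * min (u s) (u t) + w s * w t = basic_rp \<beta> l \<bar>s - t\<bar>"
    proof (cases "s \<le> t")
      case False
      with ordered[OF st(2,1)] show ?thesis
        by (simp add: min.commute mult.commute)
    qed (use ordered[OF st] in simp)
    then show "complex_of_real (v s) * cnj (complex_of_real (v t)) * complex_of_real (min (u s) (u t)) + complex_of_real (w s) * cnj (complex_of_real (w t)) = complex_of_real (basic_rp \<beta> l \<bar>s - t\<bar>)"
      by (simp flip: of_real_mult of_real_add)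
  qed
qed

text \<open>
  Positive definiteness on the quotient group need only be tested on the representatives in
  \<open>[0, \<beta>)\<close>, whose differences are, up to sign, again in \<open>[0, \<beta>)\<close>.
\<close>
lemma pd_function_circle_if_representation:
  assumes "0 < \<beta>" and fin: "finite_measure \<mu>" and sets_\<mu> [measurable_cong]: "sets \<mu> = sets borel"
    and even: "\<And>t. \<phi> (cls \<beta> (- t)) = \<phi> (cls \<beta> t)"
    and rep: "\<And>y. y \<in> {0..\<beta>} \<Longrightarrow> \<phi> (cls \<beta> y) = of_real (\<integral>l. basic_rp \<beta> l y \<partial>\<mu>)"
  shows "pd_function (circle \<beta>) \<phi>"
proof -
  interpret finite_measure \<mu> by fact
  have "pd_kernel {0..<\<beta>} (\<lambda>s t. \<integral>l. complex_of_real (basic_rp \<beta> l \<bar>s - t\<bar>) \<partial>\<mu>)"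
  proof (rule pd_kernel_integral)
    show "integrable \<mu> (\<lambda>l. complex_of_real (basic_rp \<beta> l \<bar>s - t\<bar>))" if "s \<in> {0..<\<beta>}" "t \<in> {0..<\<beta>}" for s t
      using that by (intro integrable_of_real integrable_const_bound[of _ 1] AE_I2) (auto intro!: abs_basic_rp_le_1)
  qed (use pd_kernel_basic_rp_difference[OF \<open>0 < \<beta>\<close>] in auto)
  then have reps: "pd_kernel {0..<\<beta>} (\<lambda>s t. \<phi> (cls \<beta> (s - t)))"
  proof (rule pd_kernel_cong)
    fix s t assume st: "s \<in> {0..<\<beta>}" "t \<in> {0..<\<beta>}"
    have "\<phi> (cls \<beta> (s - t)) = \<phi> (cls \<beta> \<bar>s - t\<bar>)"
      using even[of "s - t"] by (simp add: abs_if)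
    then show "(\<integral>l. complex_of_real (basic_rp \<beta> l \<bar>s - t\<bar>) \<partial>\<mu>) = \<phi> (cls \<beta> (s - t))"
      using st rep[of "\<bar>s - t\<bar>"] by auto
  qed
  have "\<forall>C\<in>carrier (circle \<beta>). \<exists>y\<in>{0..<\<beta>}. C = cls \<beta> y"
    unfolding carrier_circle using cls_representative[OF \<open>0 < \<beta>\<close>] by blast
  then obtain r where r: "\<And>C. C \<in> carrier (circle \<beta>) \<Longrightarrow> r C \<in> {0..<\<beta>} \<and> C = cls \<beta> (r C)"
    by metis
  have "pd_kernel (carrier (circle \<beta>)) (\<lambda>C D. \<phi> (cls \<beta> (r C - r D)))"
    by (rule pd_kernel_pullback[OF reps]) (use r in blast)
  then show ?thesis
    unfolding pd_function_def
  proof (rule pd_kernel_cong)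
    fix C D assume "C \<in> carrier (circle \<beta>)" "D \<in> carrier (circle \<beta>)"
    then have "C \<otimes>\<^bsub>circle \<beta>\<^esub> inv\<^bsub>circle \<beta>\<^esub> D = cls \<beta> (r C) \<otimes>\<^bsub>circle \<beta>\<^esub> inv\<^bsub>circle \<beta>\<^esub> cls \<beta> (r D)"
      using r by metis
    also have "\<dots> = cls \<beta> (r C - r D)"
      by (simp add: inv_circle_cls mult_circle_cls)
    finally show "\<phi> (cls \<beta> (r C - r D)) = \<phi> (C \<otimes>\<^bsub>circle \<beta>\<^esub> inv\<^bsub>circle \<beta>\<^esub> D)"
      by simp
  qed
qed

text \<open>
  Positivity of the kernel on the half period already implies positive definiteness on the
  whole circle, by way of the integral representation.
\<close>
theorem circle_function_in_cont_refl_pos: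
  assumes "0 < \<beta>" and cont: "continuous_on {0..\<beta>} g"
    and sym: "\<And>y. y \<in> {0..\<beta>} \<Longrightarrow> g (\<beta> - y) = g y"
    and pd: "pd_kernel {0<..<\<beta>/2} (\<lambda>s t. g (s + t))"
  shows "circle_function \<beta> g \<in> cont_refl_pos \<beta>"
proof -
  obtain \<mu> where \<mu>: "finite_measure \<mu>" "sets \<mu> = sets borel"
      "\<And>y. y \<in> {0..\<beta>} \<Longrightarrow> g y = of_real (\<integral>l. basic_rp \<beta> l y \<partial>\<mu>)"
    using reflection_positive_integral_representation[OF assms] by metis
  have even: "circle_function \<beta> g (cls \<beta> (- t)) = circle_function \<beta> g (cls \<beta> t)" for t
    by (simp add: circle_function_cls[OF \<open>0 < \<beta>\<close>] tent_uminus)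
  have on_period: "circle_function \<beta> g (cls \<beta> y) = g y" if "y \<in> {0..\<beta>}" for y
    by (rule circle_function_on_period[OF \<open>0 < \<beta>\<close> _ that]) (rule sym)
  have "pd_function (circle \<beta>) (circle_function \<beta> g)"
    by (rule pd_function_circle_if_representation[OF \<open>0 < \<beta>\<close> \<mu>(1,2) even]) (simp add: on_period \<mu>(3))
  moreover have "pd_kernel {0<..<\<beta>/2} (\<lambda>s t. circle_function \<beta> g (cls \<beta> (s + t)))"
    by (rule pd_kernel_cong[OF pd]) (subst on_period, auto)
  ultimately have "reflection_positive \<beta> (circle_function \<beta> g)"
    using even by (simp add: reflection_positive_def)
  then show ?thesis
    using continuous_map_circle_function[OF \<open>0 < \<beta>\<close> cont]
    by (simp add: cont_refl_pos_def circle_function_def)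
qed

section \<open>The correspondence between the circle and the line\<close>

context
  fixes \<beta> :: real and \<mu> :: "real measure"
  assumes \<beta>: "0 < \<beta>" and fin: "finite_measure \<mu>" and sets_\<mu> [measurable_cong]: "sets \<mu> = sets borel"
    and supp: "emeasure \<mu> {..<0} = 0"
begin

lemma AE_nonneg: "AE l in \<mu>. 0 \<le> l"
  by (rule AE_I[of _ _ "{..<0}"]) (use supp sets_\<mu> in \<open>auto simp: sets_eq_imp_space_eq[OF sets_\<mu>] not_le\<close>)

lemma sets_Gamma_measure [measurable_cong]: "sets (Gamma_measure \<beta> \<mu>) = sets borel"
  by (simp add: Gamma_measure_def sets_\<mu>)

text \<open>
  The weight of \<open>Gamma_measure\<close> at a reflected point: the reflected half of the measure carries the
  additional factor \<open>e\<^sup>-\<^sup>\<beta>\<^sup>l\<close>, and this is the KMS symmetry.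
\<close>
lemma Gamma_weight: "1 / (1 + exp (\<beta> * l)) = exp (- \<beta> * l) / (1 + exp (- \<beta> * l))"
  by (simp add: exp_minus field_simps)

lemma
  fixes f :: "real \<Rightarrow> 'b :: {banach, second_countable_topology}"
  assumes f [measurable]: "f \<in> borel_measurable borel"
    and int: "integrable \<mu> (\<lambda>l. (1 / (1 + exp (- \<beta> * l))) *\<^sub>R f l)"
      "integrable \<mu> (\<lambda>l. (exp (- \<beta> * l) / (1 + exp (- \<beta> * l))) *\<^sub>R f (- l))"
  shows integrable_Gamma_measure: "integrable (Gamma_measure \<beta> \<mu>) f"
    and integral_Gamma_measure: "(\<integral>l. f l \<partial>Gamma_measure \<beta> \<mu>) =
      (\<integral>l. (1 / (1 + exp (- \<beta> * l))) *\<^sub>R f l + (exp (- \<beta> * l) / (1 + exp (- \<beta> * l))) *\<^sub>R f (- l) \<partial>\<mu>)"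
proof -
  define D where "D = distr \<mu> borel uminus"
  have sets: "sets \<mu> = sets D"
    by (simp add: D_def sets_\<mu>)
  have [measurable_cong]: "sets (plus_measure \<mu> D) = sets borel"
    by (simp add: sets_\<mu>)
  have pos: "0 \<le> 1 / (1 + exp (- \<beta> * l))" for l
    by (simp add: add_nonneg_nonneg)
  have D: "integrable D (\<lambda>l. (1 / (1 + exp (- \<beta> * l))) *\<^sub>R f l)"
    "(\<integral>l. (1 / (1 + exp (- \<beta> * l))) *\<^sub>R f l \<partial>D) = (\<integral>l. (exp (- \<beta> * l) / (1 + exp (- \<beta> * l))) *\<^sub>R f (- l) \<partial>\<mu>)"
    unfolding D_def using int(2) by (subst integrable_distr_eq integral_distr; simp add: Gamma_weight)+
  have plus: "integrable (plus_measure \<mu> D) (\<lambda>l. (1 / (1 + exp (- \<beta> * l))) *\<^sub>R f l)"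
    using int(1) D(1) by (simp add: integrable_plus_measure_iff[OF sets])
  show "integrable (Gamma_measure \<beta> \<mu>) f"
    unfolding Gamma_measure_def D_def[symmetric] by (subst integrable_density) (use plus pos in auto)
  have "(\<integral>l. f l \<partial>Gamma_measure \<beta> \<mu>) = (\<integral>l. (1 / (1 + exp (- \<beta> * l))) *\<^sub>R f l \<partial>plus_measure \<mu> D)"
    unfolding Gamma_measure_def D_def[symmetric] by (subst integral_density) (use pos in auto)
  also have "\<dots> = (\<integral>l. (1 / (1 + exp (- \<beta> * l))) *\<^sub>R f l \<partial>\<mu>) + (\<integral>l. (exp (- \<beta> * l) / (1 + exp (- \<beta> * l))) *\<^sub>R f (- l) \<partial>\<mu>)"
    using int(1) D by (simp add: integral_plus_measure[OF sets])
  finally show "(\<integral>l. f l \<partial>Gamma_measure \<beta> \<mu>) =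
      (\<integral>l. (1 / (1 + exp (- \<beta> * l))) *\<^sub>R f l + (exp (- \<beta> * l) / (1 + exp (- \<beta> * l))) *\<^sub>R f (- l) \<partial>\<mu>)"
    using int by simp
qed

lemma weighted_kernels_integrable:
  assumes "0 \<le> Im z" "Im z \<le> \<beta>"
  shows "integrable \<mu> (\<lambda>l. (1 / (1 + exp (- \<beta> * l))) *\<^sub>R exp (\<i> * z * complex_of_real l))" (is "integrable _ ?f")
    and "integrable \<mu> (\<lambda>l. (exp (- \<beta> * l) / (1 + exp (- \<beta> * l))) *\<^sub>R exp (\<i> * z * complex_of_real (- l)))" (is "integrable _ ?g")
proof -
  interpret finite_measure \<mu> by (rule fin)
  have w: "0 \<le> 1 / (1 + exp (- \<beta> * l))" "1 / (1 + exp (- \<beta> * l)) \<le> 1" for l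
    by (simp_all add: add_nonneg_nonneg add_pos_pos)
  have f: "norm (?f l) \<le> 1" if "0 \<le> l" for l
  proof -
    have "norm (?f l) = 1 / (1 + exp (- \<beta> * l)) * exp (- Im z * l)"
      using w(1) by (simp only: norm_scaleR norm_fourier_kernel abs_of_nonneg)
    also have "\<dots> \<le> 1 * 1"
      using w assms that by (intro mult_mono) auto
    finally show ?thesis by simp
  qed
  have g: "norm (?g l) \<le> 1" if "0 \<le> l" for l
  proof -
    have "norm (?g l) = exp (- \<beta> * l) / (1 + exp (- \<beta> * l)) * exp (- Im z * (- l))"
      by (simp only: norm_scaleR norm_fourier_kernel abs_of_nonneg[OF divide_nonneg_nonneg] exp_ge_zero add_nonneg_nonneg zero_le_one)
    also have "\<dots> = 1 / (1 + exp (- \<beta> * l)) * exp (- (\<beta> - Im z) * l)"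
      by (simp add: algebra_simps flip: exp_add)
    also have "\<dots> \<le> 1 * 1"
    proof (intro mult_mono w)
      have "0 \<le> (\<beta> - Im z) * l"
        using assms that by (intro mult_nonneg_nonneg) auto
      then show "exp (- (\<beta> - Im z) * l) \<le> 1"
        by (simp only: mult_minus_left exp_le_one_iff neg_le_0_iff_le)
    qed auto
    finally show ?thesis by simp
  qed
  show "integrable \<mu> ?f" "integrable \<mu> ?g"
    by (rule integrable_const_bound[of _ 1], rule eventually_mono[OF AE_nonneg], use f g in blast, measurable)+
qed

lemma fourier_Gamma_measure:
  assumes "0 \<le> Im z" "Im z \<le> \<beta>"
  shows "fourier (Gamma_measure \<beta> \<mu>) z =
    (\<integral>l. (exp (\<i> * z * of_real l) + exp (- (\<beta> * l)) * exp (- (\<i> * z * of_real l))) / (1 + exp (- \<beta> * l)) \<partial>\<mu>)"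
proof -
  have [measurable]: "(\<lambda>l. exp (\<i> * z * complex_of_real l)) \<in> borel_measurable borel"
    by measurable
  have "fourier (Gamma_measure \<beta> \<mu>) z = (\<integral>l. (1 / (1 + exp (- \<beta> * l))) *\<^sub>R exp (\<i> * z * complex_of_real l)
      + (exp (- \<beta> * l) / (1 + exp (- \<beta> * l))) *\<^sub>R exp (\<i> * z * complex_of_real (- l)) \<partial>\<mu>)"
    unfolding fourier_def by (intro integral_Gamma_measure weighted_kernels_integrable assms) measurable
  also have "\<dots> = (\<integral>l. (exp (\<i> * z * of_real l) + exp (- (\<beta> * l)) * exp (- (\<i> * z * of_real l))) / (1 + exp (- \<beta> * l)) \<partial>\<mu>)"
    by (intro Bochner_Integration.integral_cong refl) (simp add: scaleR_conv_of_real add_divide_distrib)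
  finally show ?thesis .
qed

lemma integrable_exp_Gamma_measure:
  assumes "y \<in> {0..\<beta>}"
  shows "integrable (Gamma_measure \<beta> \<mu>) (\<lambda>l. exp (- y * l))"
proof -
  have "integrable (Gamma_measure \<beta> \<mu>) (\<lambda>l. exp (\<i> * (\<i> * complex_of_real y) * complex_of_real l))"
    by (intro integrable_Gamma_measure weighted_kernels_integrable) (use assms in auto)
  then have "integrable (Gamma_measure \<beta> \<mu>) (\<lambda>l. norm (exp (\<i> * (\<i> * complex_of_real y) * complex_of_real l)))"
    by (rule integrable_norm)
  then show ?thesis
    by (simp only: norm_fourier_kernel) simp
qed

lemma fourier_Gamma_measure_strip:
  "continuous_on (closure (strip \<beta>)) (fourier (Gamma_measure \<beta> \<mu>))"
  "fourier (Gamma_measure \<beta> \<mu>) holomorphic_on strip \<beta>"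
proof -
  have "integrable (Gamma_measure \<beta> \<mu>) (\<lambda>l. exp (- 0 * l))" "integrable (Gamma_measure \<beta> \<mu>) (\<lambda>l. exp (- \<beta> * l))"
    by (rule integrable_exp_Gamma_measure; use \<beta> in simp)+
  note * = continuous_on_fourier[OF sets_Gamma_measure this] holomorphic_on_fourier[OF sets_Gamma_measure this]
  show "continuous_on (closure (strip \<beta>)) (fourier (Gamma_measure \<beta> \<mu>))"
    using *(1) by (simp add: closure_strip[OF \<beta>])
  show "fourier (Gamma_measure \<beta> \<mu>) holomorphic_on strip \<beta>"
    using *(2) by (simp add: strip_eq)
qed

lemma fourier_Gamma_measure_imaginary:
  assumes "y \<in> {0..\<beta>}"
  shows "fourier (Gamma_measure \<beta> \<mu>) (\<i> * of_real y) = of_real (\<integral>l. basic_rp \<beta> l y \<partial>\<mu>)"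
proof -
  have "(exp (\<i> * (\<i> * of_real y) * of_real l) + exp (- (\<beta> * l)) * exp (- (\<i> * (\<i> * of_real y) * of_real l))) / (1 + exp (- \<beta> * l))
      = complex_of_real (basic_rp \<beta> l y)" for l
  proof -
    have arg: "\<i> * (\<i> * complex_of_real y) * complex_of_real l = of_real (- l * y)" "- complex_of_real (- l * y) = of_real (l * y)"
      by (simp_all add: mult.assoc[symmetric])
    have "exp (- (\<beta> * l)) * exp (l * y) = exp (- l * (\<beta> - y))"
      by (simp add: algebra_simps flip: exp_add)
    then have "basic_rp \<beta> l y = (exp (- l * y) + exp (- (\<beta> * l)) * exp (l * y)) / (1 + exp (- \<beta> * l))"
      by (simp add: basic_rp_def mult.commute)
    then show ?thesis
      by (simp only: arg exp_of_real) (simp only: of_real_add of_real_mult of_real_divide of_real_1)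
  qed
  then show ?thesis
    using assms by (simp add: fourier_Gamma_measure)
qed

lemma fourier_Gamma_measure_KMS: "fourier (Gamma_measure \<beta> \<mu>) (\<i> * of_real \<beta> + of_real t) = cnj (fourier (Gamma_measure \<beta> \<mu>) (of_real t))"
proof -
  define e where "e l = exp (\<i> * complex_of_real (t * l))" for l
  have arg: "\<i> * (\<i> * of_real \<beta> + of_real t) * complex_of_real l = of_real (- (\<beta> * l)) + \<i> * of_real (t * l)" for l
    by (simp add: algebra_simps)
  have top: "exp (\<i> * (\<i> * of_real \<beta> + of_real t) * complex_of_real l) = exp (- (\<beta> * l)) * e l" for l
    by (simp only: arg exp_add e_def exp_of_real)
  have top': "exp (- (\<beta> * l)) * exp (- (\<i> * (\<i> * of_real \<beta> + of_real t) * complex_of_real l)) = cnj (e l)" for l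
  proof -
    have "exp (complex_of_real (- (\<beta> * l))) * exp (- (complex_of_real (- (\<beta> * l)) + \<i> * of_real (t * l))) = exp (- (\<i> * of_real (t * l)))"
      by (simp flip: exp_add)
    then show ?thesis
      by (simp only: arg exp_of_real) (simp add: e_def exp_cnj)
  qed
  have bot: "exp (\<i> * complex_of_real t * complex_of_real l) = e l"  "exp (- (\<i> * complex_of_real t * complex_of_real l)) = cnj (e l)" for l
    by (simp_all add: e_def exp_cnj mult.assoc)
  have "fourier (Gamma_measure \<beta> \<mu>) (\<i> * of_real \<beta> + of_real t) = (\<integral>l. (exp (- (\<beta> * l)) * e l + cnj (e l)) / (1 + exp (- \<beta> * l)) \<partial>\<mu>)"
    using \<beta> by (subst fourier_Gamma_measure) (simp_all only: top top', simp_all)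
  also have "\<dots> = (\<integral>l. cnj ((e l + exp (- (\<beta> * l)) * cnj (e l)) / (1 + exp (- \<beta> * l))) \<partial>\<mu>)"
    by (simp add: add.commute)
  also have "\<dots> = cnj (\<integral>l. (e l + exp (- (\<beta> * l)) * cnj (e l)) / (1 + exp (- \<beta> * l)) \<partial>\<mu>)"
    by (rule Bochner_Integration.integral_cnj)
  also have "(\<integral>l. (e l + exp (- (\<beta> * l)) * cnj (e l)) / (1 + exp (- \<beta> * l)) \<partial>\<mu>) = fourier (Gamma_measure \<beta> \<mu>) (of_real t)"
    using \<beta> by (subst fourier_Gamma_measure) (simp_all only: bot, simp_all)
  finally show ?thesis .
qed

end

lemma pd_function_fourier:
  assumes "finite_measure \<nu>" and [measurable_cong]: "sets \<nu> = sets borel"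
  shows "pd_function real_group (\<lambda>t. fourier \<nu> (of_real t))"
  unfolding pd_function_real_group fourier_def
proof (rule pd_kernel_integral)
  interpret finite_measure \<nu> by fact
  have "exp (\<i> * of_real x * of_real l) * cnj (exp (\<i> * of_real y * of_real l)) = exp (\<i> * complex_of_real (x - y) * of_real l)" for x y l :: real
    by (simp add: exp_cnj algebra_simps flip: exp_add)
  then have "pd_kernel UNIV (\<lambda>x y. exp (\<i> * complex_of_real (x - y) * of_real l))" for l
    by (rule pd_kernel_cong[OF pd_kernel_rank_one])
  then show "AE l in \<nu>. pd_kernel UNIV (\<lambda>x y. exp (\<i> * complex_of_real (x - y) * of_real l))"
    by simp
  show "integrable \<nu> (\<lambda>l. exp (\<i> * complex_of_real (x - y) * of_real l))" for x y
  proof (rule integrable_const_bound[of _ 1])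
    show "AE l in \<nu>. norm (exp (\<i> * complex_of_real (x - y) * of_real l)) \<le> 1"
      unfolding norm_fourier_kernel by simp
  qed measurable
qed

lemma strip_extension_unique:
  assumes "0 < \<beta>" "strip_extension \<beta> \<phi> \<Phi>" "strip_extension \<beta> \<phi> \<Psi>"
  shows "\<Phi> = \<Psi>"
proof (rule extensionalityI[of _ "closure (strip \<beta>)"])
  fix z assume z: "z \<in> closure (strip \<beta>)"
  show "\<Phi> z = \<Psi> z"
  proof (rule strip_identity_vertical[OF \<open>0 < \<beta>\<close> _ _ _ _ _ z])
    show "\<Phi> (\<i> * of_real y) = \<Psi> (\<i> * of_real y)" if "0 < y" "y < \<beta>" for y
      using assms(2,3) that by (simp add: strip_extension_def)
  qed (use assms(2,3) in \<open>simp_all add: strip_extension_def\<close>)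
qed (use assms(2,3) in \<open>simp_all add: strip_extension_def\<close>)

lemma strip_extension_restrict:
  assumes "continuous_on (closure (strip \<beta>)) F" "F holomorphic_on strip \<beta>" "0 < \<beta>"
    and "\<And>y. y \<in> {0..\<beta>} \<Longrightarrow> F (\<i> * of_real y) = \<phi> (cls \<beta> y)"
  shows "strip_extension \<beta> \<phi> (restrict F (closure (strip \<beta>)))"
  unfolding strip_extension_def
proof (intro conjI ballI)
  show "continuous_on (closure (strip \<beta>)) (restrict F (closure (strip \<beta>)))"
    using assms(1) by (simp cong: continuous_on_cong)
  show "restrict F (closure (strip \<beta>)) holomorphic_on strip \<beta>"
    by (rule holomorphic_transform[OF assms(2)]) (use closure_subset[of "strip \<beta>"] in auto)
qed (use assms in \<open>auto simp: closure_strip\<close>)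

lemma real_restriction_eq:
  assumes "0 < \<beta>" "continuous_on (closure (strip \<beta>)) F" "F holomorphic_on strip \<beta>"
    and "\<And>y. y \<in> {0..\<beta>} \<Longrightarrow> F (\<i> * of_real y) = \<phi> (cls \<beta> y)"
  shows "real_restriction \<beta> \<phi> t = F (of_real t)"
proof -
  have ext: "strip_extension \<beta> \<phi> (restrict F (closure (strip \<beta>)))"
    using assms by (intro strip_extension_restrict) auto
  then have "(THE \<Phi>. strip_extension \<beta> \<phi> \<Phi>) = restrict F (closure (strip \<beta>))"
    using strip_extension_unique[OF \<open>0 < \<beta>\<close>] by blast
  then show ?thesis
    using \<open>0 < \<beta>\<close> by (simp add: real_restriction_def closure_strip)
qed

lemma cont_refl_pos_representation:
  assumes "0 < \<beta>" "\<phi> \<in> cont_refl_pos \<beta>"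
  obtains \<mu> where "finite_measure \<mu>" "sets \<mu> = sets borel" "emeasure \<mu> {..<0} = 0"
    "\<And>y. y \<in> {0..\<beta>} \<Longrightarrow> \<phi> (cls \<beta> y) = of_real (\<integral>l. basic_rp \<beta> l y \<partial>\<mu>)"
proof -
  have refl: "reflection_positive \<beta> \<phi>" and map: "continuous_map (circle_topology \<beta>) euclidean \<phi>"
    using assms(2) by (simp_all add: cont_refl_pos_def)
  have cont: "continuous_on UNIV (\<lambda>t. \<phi> (cls \<beta> t))"
    using map by (rule continuous_map_circle_iff[THEN iffD1])
  have period: "cls \<beta> (\<beta> - y) = cls \<beta> (- y)" for y
    unfolding cls_eq_iff by (intro exI[of _ "-1"]) simp
  show thesis
  proof (rule reflection_positive_integral_representation[OF \<open>0 < \<beta>\<close>])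
    show "continuous_on {0..\<beta>} (\<lambda>t. \<phi> (cls \<beta> t))"
      using cont by (rule continuous_on_subset) simp
    show "\<phi> (cls \<beta> (\<beta> - y)) = \<phi> (cls \<beta> y)" for y
      using refl by (simp add: reflection_positive_def period)
    show "pd_kernel {0<..<\<beta>/2} (\<lambda>s t. \<phi> (cls \<beta> (s + t)))"
      using refl by (simp add: reflection_positive_def)
  qed (rule that)
qed

lemma cont_refl_pos_eqI:
  assumes "0 < \<beta>" "\<phi> \<in> cont_refl_pos \<beta>" "\<psi> \<in> cont_refl_pos \<beta>"
    and "\<And>y. y \<in> {0..\<beta>} \<Longrightarrow> \<phi> (cls \<beta> y) = \<psi> (cls \<beta> y)"
  shows "\<phi> = \<psi>"
proof (rule extensionalityI[of _ "carrier (circle \<beta>)"])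
  fix C assume "C \<in> carrier (circle \<beta>)"
  then obtain t where "C = cls \<beta> t"
    by (auto simp: carrier_circle)
  then obtain y where "y \<in> {0..<\<beta>}" "C = cls \<beta> y"
    using cls_representative[OF \<open>0 < \<beta>\<close>] by metis
  then show "\<phi> C = \<psi> C"
    using assms(4)[of y] by simp
qed (use assms in \<open>auto simp: cont_refl_pos_def\<close>)

lemma KMS_comes_from_circle:
  assumes "0 < \<beta>" and pd: "pd_function real_group f"
    and F: "continuous_on (closure (strip \<beta>)) F" "F holomorphic_on strip \<beta>" "\<And>t. F (of_real t) = f t"
    and KMS: "\<And>t. F (\<i> * of_real \<beta> + of_real t) = cnj (f t)"
  obtains \<phi> where "\<phi> \<in> cont_refl_pos \<beta>" "\<And>y. y \<in> {0..\<beta>} \<Longrightarrow> \<phi> (cls \<beta> y) = F (\<i> * of_real y)"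
proof -
  define g where "g y = F (\<i> * of_real y)" for y
  have cont: "continuous_on {0..\<beta>} g"
    unfolding g_def by (intro continuous_on_compose2[OF F(1)] continuous_intros) (use \<open>0 < \<beta>\<close> in \<open>auto simp: closure_strip\<close>)
  \<comment> \<open>Hermitian symmetry and the KMS condition make \<open>F\<close> and its point reflection agree on the real line.\<close>
  have reflect: "F (\<i> * of_real \<beta> - z) = F z" if "z \<in> closure (strip \<beta>)" for z
  proof (rule strip_identity_real_line[where F = "\<lambda>z. F (\<i> * of_real \<beta> - z)" and G = F and \<beta> = \<beta>])
    show "continuous_on (closure (strip \<beta>)) (\<lambda>z. F (\<i> * of_real \<beta> - z))"
      by (intro continuous_on_compose2[OF F(1)] continuous_intros) (use \<open>0 < \<beta>\<close> in \<open>auto simp: closure_strip\<close>)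
    show "(\<lambda>z. F (\<i> * of_real \<beta> - z)) holomorphic_on strip \<beta>"
      by (rule holomorphic_on_compose_gen[OF _ F(2), unfolded comp_def]) (auto intro!: holomorphic_intros simp: strip_def)
    show "F (\<i> * of_real \<beta> - of_real t) = F (of_real t)" for t
      using KMS[of "- t"] pd_function_at_minus[OF pd, of t] by (simp add: F(3))
  qed (use F \<open>0 < \<beta>\<close> that in auto)
  have sym: "g (\<beta> - y) = g y" if "y \<in> {0..\<beta>}" for y
    using reflect[of "\<i> * of_real y"] that \<open>0 < \<beta>\<close> by (simp add: g_def closure_strip right_diff_distrib)
  have "pd_kernel {0<..<\<beta>/2} (\<lambda>s t. g (s + t))"
    unfolding g_def by (rule pd_kernel_on_imaginary_segment[OF \<open>0 < \<beta>\<close> pd F])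
  then have "circle_function \<beta> g \<in> cont_refl_pos \<beta>"
    by (intro circle_function_in_cont_refl_pos \<open>0 < \<beta>\<close> cont sym)
  moreover have "circle_function \<beta> g (cls \<beta> y) = F (\<i> * of_real y)" if "y \<in> {0..\<beta>}" for y
    using circle_function_on_period[OF \<open>0 < \<beta>\<close> _ that, of g] sym by (simp add: g_def)
  ultimately show thesis
    by (rule that)
qed

theorem theorem5p5:
  fixes \<beta> :: real
  assumes "\<beta> > 0"
  shows
    "(\<forall>\<phi>\<in>cont_refl_pos \<beta>. \<exists>!\<Phi>. strip_extension \<beta> \<phi> \<Phi>) \<and>
     bij_betw (real_restriction \<beta>) (cont_refl_pos \<beta>) (pd_KMS \<beta>) \<and>
     (\<forall>\<phi>\<in>cont_refl_pos \<beta>. \<exists>\<mu>.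
        finite_measure \<mu> \<and> sets \<mu> = sets borel \<and> emeasure \<mu> {..<0} = 0 \<and>
        (\<forall>y\<in>{0..\<beta>}. \<phi> (cls \<beta> y) = of_real (LINT l:{0..}|\<mu>. basic_rp \<beta> l y)) \<and>
        (\<forall>t. real_restriction \<beta> \<phi> t = fourier (Gamma_measure \<beta> \<mu>) (of_real t))) \<and>
     (\<forall>f\<in>pd_KMS \<beta>. \<forall>\<nu>.
        finite_measure \<nu> \<and> sets \<nu> = sets borel \<and> (\<forall>t. f t = fourier \<nu> (of_real t)) \<longrightarrow>
        (\<forall>y\<in>{0..\<beta>}. integrable \<nu> (\<lambda>l. exp (\<i> * (\<i> * complex_of_real y) * of_real l))) \<and>
        (\<exists>\<phi>\<in>cont_refl_pos \<beta>. \<forall>y\<in>{0..\<beta>}. \<phi> (cls \<beta> y) = fourier \<nu> (\<i> * of_real y)))"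
proof (intro conjI)
  have "0 < \<beta>"
    by fact
  have Phi: "\<exists>\<mu> F. finite_measure \<mu> \<and> sets \<mu> = sets borel \<and> emeasure \<mu> {..<0} = 0 \<and>
      F = fourier (Gamma_measure \<beta> \<mu>) \<and>
      continuous_on (closure (strip \<beta>)) F \<and> F holomorphic_on strip \<beta> \<and>
      (\<forall>y\<in>{0..\<beta>}. F (\<i> * of_real y) = \<phi> (cls \<beta> y)) \<and>
      (\<forall>y\<in>{0..\<beta>}. \<phi> (cls \<beta> y) = of_real (\<integral>l. basic_rp \<beta> l y \<partial>\<mu>)) \<and>
      (\<forall>t. real_restriction \<beta> \<phi> t = F (of_real t))" if \<phi>: "\<phi> \<in> cont_refl_pos \<beta>" for \<phi>
  proof -
    obtain \<mu> where \<mu>: "finite_measure \<mu>" "sets \<mu> = sets borel" "emeasure \<mu> {..<0} = 0"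
        "\<And>y. y \<in> {0..\<beta>} \<Longrightarrow> \<phi> (cls \<beta> y) = of_real (\<integral>l. basic_rp \<beta> l y \<partial>\<mu>)"
      using cont_refl_pos_representation[OF \<open>0 < \<beta>\<close> \<phi>] by metis
    note strip = fourier_Gamma_measure_strip[OF \<open>0 < \<beta>\<close> \<mu>(1-3)]
    have imag: "fourier (Gamma_measure \<beta> \<mu>) (\<i> * of_real y) = \<phi> (cls \<beta> y)" if "y \<in> {0..\<beta>}" for y
      using fourier_Gamma_measure_imaginary[OF \<open>0 < \<beta>\<close> \<mu>(1-3) that] \<mu>(4)[OF that] by simp
    show ?thesis
      using \<mu> strip imag real_restriction_eq[OF \<open>0 < \<beta>\<close> strip imag] by blast
  qed
  have finite_Gamma: "finite_measure (Gamma_measure \<beta> \<mu>)"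
    if "finite_measure \<mu>" "sets \<mu> = sets borel" "emeasure \<mu> {..<0} = 0" for \<mu>
  proof -
    have "integrable (Gamma_measure \<beta> \<mu>) (\<lambda>l. exp (- 0 * l))"
      using integrable_exp_Gamma_measure[OF \<open>0 < \<beta>\<close> that, of 0] \<open>0 < \<beta>\<close> by simp
    then have "integrable (Gamma_measure \<beta> \<mu>) (\<lambda>_. 1 :: real)"
      by simp
    then show ?thesis
      by (intro finite_measureI) (simp add: integrable_iff_bounded)
  qed
  show "\<forall>\<phi>\<in>cont_refl_pos \<beta>. \<exists>!\<Phi>. strip_extension \<beta> \<phi> \<Phi>"
  proof
    fix \<phi> assume "\<phi> \<in> cont_refl_pos \<beta>"
    from Phi[OF this] obtain F where "continuous_on (closure (strip \<beta>)) F" "F holomorphic_on strip \<beta>"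
      "\<And>y. y \<in> {0..\<beta>} \<Longrightarrow> F (\<i> * of_real y) = \<phi> (cls \<beta> y)"
      by blast
    then have ext: "strip_extension \<beta> \<phi> (restrict F (closure (strip \<beta>)))"
      by (rule strip_extension_restrict[OF _ _ \<open>0 < \<beta>\<close>])
    show "\<exists>!\<Phi>. strip_extension \<beta> \<phi> \<Phi>"
      by (rule ex1I[of "strip_extension \<beta> \<phi>", OF ext]) (rule strip_extension_unique[OF \<open>0 < \<beta>\<close> _ ext])
  qed
  show "\<forall>\<phi>\<in>cont_refl_pos \<beta>. \<exists>\<mu>.
        finite_measure \<mu> \<and> sets \<mu> = sets borel \<and> emeasure \<mu> {..<0} = 0 \<and>
        (\<forall>y\<in>{0..\<beta>}. \<phi> (cls \<beta> y) = of_real (LINT l:{0..}|\<mu>. basic_rp \<beta> l y)) \<and>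
        (\<forall>t. real_restriction \<beta> \<phi> t = fourier (Gamma_measure \<beta> \<mu>) (of_real t))"
  proof
    fix \<phi> assume "\<phi> \<in> cont_refl_pos \<beta>"
    from Phi[OF this] obtain \<mu> where \<mu>: "finite_measure \<mu>" "sets \<mu> = sets borel" "emeasure \<mu> {..<0} = 0"
      "\<And>y. y \<in> {0..\<beta>} \<Longrightarrow> \<phi> (cls \<beta> y) = of_real (\<integral>l. basic_rp \<beta> l y \<partial>\<mu>)"
      "\<And>t. real_restriction \<beta> \<phi> t = fourier (Gamma_measure \<beta> \<mu>) (of_real t)"
      by blast
    have "(LINT l:{0..}|\<mu>. basic_rp \<beta> l y) = (\<integral>l. basic_rp \<beta> l y \<partial>\<mu>)" for y
      unfolding set_lebesgue_integral_def using \<mu>(2)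
      by (intro integral_cong_AE eventually_mono[OF AE_nonneg[OF \<open>0 < \<beta>\<close> \<mu>(1-3)]]) (auto cong: measurable_cong_sets)
    with \<mu> show "\<exists>\<mu>. finite_measure \<mu> \<and> sets \<mu> = sets borel \<and> emeasure \<mu> {..<0} = 0 \<and>
        (\<forall>y\<in>{0..\<beta>}. \<phi> (cls \<beta> y) = of_real (LINT l:{0..}|\<mu>. basic_rp \<beta> l y)) \<and>
        (\<forall>t. real_restriction \<beta> \<phi> t = fourier (Gamma_measure \<beta> \<mu>) (of_real t))"
      by (intro exI[of _ \<mu>]) simp
  qed
  show "bij_betw (real_restriction \<beta>) (cont_refl_pos \<beta>) (pd_KMS \<beta>)"
    unfolding bij_betw_def
  proof
    show "inj_on (real_restriction \<beta>) (cont_refl_pos \<beta>)"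
    proof (rule inj_onI)
      fix \<phi> \<psi> assume \<phi>: "\<phi> \<in> cont_refl_pos \<beta>" and \<psi>: "\<psi> \<in> cont_refl_pos \<beta>"
        and eq: "real_restriction \<beta> \<phi> = real_restriction \<beta> \<psi>"
      from Phi[OF \<phi>] obtain F where F: "continuous_on (closure (strip \<beta>)) F" "F holomorphic_on strip \<beta>"
          "\<And>y. y \<in> {0..\<beta>} \<Longrightarrow> F (\<i> * of_real y) = \<phi> (cls \<beta> y)" "\<And>t. real_restriction \<beta> \<phi> t = F (of_real t)"
        by blast
      from Phi[OF \<psi>] obtain G where G: "continuous_on (closure (strip \<beta>)) G" "G holomorphic_on strip \<beta>"
          "\<And>y. y \<in> {0..\<beta>} \<Longrightarrow> G (\<i> * of_real y) = \<psi> (cls \<beta> y)" "\<And>t. real_restriction \<beta> \<psi> t = G (of_real t)"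
        by blast
      have "F z = G z" if "z \<in> closure (strip \<beta>)" for z
        by (rule strip_identity_real_line[OF \<open>0 < \<beta>\<close> F(1,2) G(1,2) _ that]) (metis F(4) G(4) eq)
      then have "\<phi> (cls \<beta> y) = \<psi> (cls \<beta> y)" if "y \<in> {0..\<beta>}" for y
        using F(3)[OF that] G(3)[OF that] that \<open>0 < \<beta>\<close> by (simp add: closure_strip)
      then show "\<phi> = \<psi>"
        by (rule cont_refl_pos_eqI[OF \<open>0 < \<beta>\<close> \<phi> \<psi>])
    qed
    show "real_restriction \<beta> ` cont_refl_pos \<beta> = pd_KMS \<beta>"
    proof (intro subset_antisym subsetI)
      fix f assume "f \<in> real_restriction \<beta> ` cont_refl_pos \<beta>"
      then obtain \<phi> where "\<phi> \<in> cont_refl_pos \<beta>" "f = real_restriction \<beta> \<phi>"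
        by blast
      with Phi[of \<phi>] obtain \<mu> where \<mu>: "finite_measure \<mu>" "sets \<mu> = sets borel" "emeasure \<mu> {..<0} = 0"
          and f: "\<And>t. f t = fourier (Gamma_measure \<beta> \<mu>) (of_real t)"
        by blast
      have "pd_function real_group (\<lambda>t. fourier (Gamma_measure \<beta> \<mu>) (of_real t))"
        by (intro pd_function_fourier finite_Gamma sets_Gamma_measure[OF \<open>0 < \<beta>\<close>] \<mu>)
      then have "pd_function real_group f"
        by (simp flip: f)
      moreover have "KMS \<beta> f"
        unfolding KMS_def using fourier_Gamma_measure_strip[OF \<open>0 < \<beta>\<close> \<mu>] fourier_Gamma_measure_KMS[OF \<open>0 < \<beta>\<close> \<mu>] f
        by (intro exI[of _ "fourier (Gamma_measure \<beta> \<mu>)"]) simp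
      ultimately show "f \<in> pd_KMS \<beta>"
        by (simp add: pd_KMS_def)
    next
      fix f assume "f \<in> pd_KMS \<beta>"
      then obtain F where pd: "pd_function real_group f"
          and F: "continuous_on (closure (strip \<beta>)) F" "F holomorphic_on strip \<beta>" "\<And>t. F (of_real t) = f t"
          and KMS: "\<And>t. F (\<i> * of_real \<beta> + of_real t) = cnj (f t)"
        by (auto simp: pd_KMS_def KMS_def)
      obtain \<phi> where \<phi>: "\<phi> \<in> cont_refl_pos \<beta>" "\<And>y. y \<in> {0..\<beta>} \<Longrightarrow> \<phi> (cls \<beta> y) = F (\<i> * of_real y)"
        using KMS_comes_from_circle[OF \<open>0 < \<beta>\<close> pd F KMS] by metis
      have "real_restriction \<beta> \<phi> = f"
        using real_restriction_eq[OF \<open>0 < \<beta>\<close> F(1,2), of \<phi>] \<phi>(2) F(3) by (intro ext) simp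
      with \<phi>(1) show "f \<in> real_restriction \<beta> ` cont_refl_pos \<beta>"
        by blast
    qed
  qed
  show "\<forall>f\<in>pd_KMS \<beta>. \<forall>\<nu>.
        finite_measure \<nu> \<and> sets \<nu> = sets borel \<and> (\<forall>t. f t = fourier \<nu> (of_real t)) \<longrightarrow>
        (\<forall>y\<in>{0..\<beta>}. integrable \<nu> (\<lambda>l. exp (\<i> * (\<i> * complex_of_real y) * of_real l))) \<and>
        (\<exists>\<phi>\<in>cont_refl_pos \<beta>. \<forall>y\<in>{0..\<beta>}. \<phi> (cls \<beta> y) = fourier \<nu> (\<i> * of_real y))"
  proof (intro ballI allI impI, elim conjE)
    fix f \<nu> assume "f \<in> pd_KMS \<beta>" and \<nu>: "finite_measure \<nu>" "sets \<nu> = sets borel" and f: "\<forall>t. f t = fourier \<nu> (of_real t)"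
    then obtain F where pd: "pd_function real_group f"
        and F: "continuous_on (closure (strip \<beta>)) F" "F holomorphic_on strip \<beta>" "\<And>t. F (of_real t) = f t"
        and KMS: "\<And>t. F (\<i> * of_real \<beta> + of_real t) = cnj (f t)"
      by (auto simp: pd_KMS_def KMS_def)
    obtain \<phi> where \<phi>: "\<phi> \<in> cont_refl_pos \<beta>" "\<And>y. y \<in> {0..\<beta>} \<Longrightarrow> \<phi> (cls \<beta> y) = F (\<i> * of_real y)"
      using KMS_comes_from_circle[OF \<open>0 < \<beta>\<close> pd F KMS] by metis
    have "F (of_real t) = fourier \<nu> (of_real t)" for t
      using f F(3) by simp
    note ext = fourier_extension[OF \<open>0 < \<beta>\<close> \<nu> F(1,2) this]
    interpret finite_measure \<nu> by (rule \<nu>(1))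
    have int_0: "integrable \<nu> (\<lambda>l. exp (- 0 * l))"
      by simp
    have "integrable \<nu> (\<lambda>l. exp (\<i> * (\<i> * complex_of_real y) * of_real l))" if "y \<in> {0..\<beta>}" for y
      by (rule integrable_fourier_kernel[OF \<nu>(2) int_0 ext(1)]) (use that in auto)
    moreover have "\<phi> (cls \<beta> y) = fourier \<nu> (\<i> * of_real y)" if "y \<in> {0..\<beta>}" for y
      using \<phi>(2)[OF that] ext(2)[of "\<i> * of_real y"] that \<open>0 < \<beta>\<close> by (simp add: closure_strip)
    ultimately show "(\<forall>y\<in>{0..\<beta>}. integrable \<nu> (\<lambda>l. exp (\<i> * (\<i> * complex_of_real y) * of_real l))) \<and>
        (\<exists>\<phi>\<in>cont_refl_pos \<beta>. \<forall>y\<in>{0..\<beta>}. \<phi> (cls \<beta> y) = fourier \<nu> (\<i> * of_real y))"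
      using \<phi>(1) by blast
  qed
qed

end
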